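(* There exists a non-empty open subset $\mathcal{U}\subset\mathbb{R}^3$ such that for every $(u,v,w)\in\mathcal{U}$ there exists $f\in\mathcal{P}^{s0}_{3,6}$ satisfying: (1) $f(u,v,1)=f(w,1,1)=f(1,1,1)=0$; (2) $f$ is irreducible in $\mathbb{C}[a,b,c]$; (3) $f\in\mathcal{E}(\mathcal{P}_{3,6})\setminus\Sigma_{3,6}$; (4) the complex projective plane curve $V_{\mathbb{C}}(f)=\{f=0\}\subset\mathbb{P}^2_{\mathbb{C}}$ is an irreducible rational curve having 10 acnodes.
   Context: $\mathcal{H}_{3,6}$ is the real vector space of homogeneous polynomials of degree 6 in $\mathbb{R}[a,b,c]$. $\mathcal{P}_{3,6}=\{f\in\mathcal{H}_{3,6}: f(x)\ge0\ \forall x\in\mathbb{R}^3\}$; $\Sigma_{3,6}\subset\mathcal{P}_{3,6}$ is the cone of sums of squares of real cubic forms. $\mathcal{P}^{s0}_{3,6}$ is the set of $f\in\mathcal{P}_{3,6}$ that are symmetric (invariant under all permutations of $a,b,c$) and satisfy $f(1,1,1)=0$. For a closed convex cone $\mathcal{P}$, $f\in\mathcal{P}\setminus\{0\}$ is extremal if $f=g+h$ with $g,h\in\mathcal{P}$ forces $g,h\in\mathbb{R}_{\ge0}f$; $\mathcal{E}(\mathcal{P})$ denotes the set of extremal elements. An acnode is a real isolated singular point of a real plane curve (a node with complex conjugate tangents). *)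

theory Defs
  imports "HOL-Analysis.Analysis"
begin

text \<open>Polynomials in three variables a, b, c are represented by their coefficient
  functions: c (i,j,k) is the coefficient of the monomial a^i b^j c^k.\<close>

type_synonym 'a poly3 = "nat \<times> nat \<times> nat \<Rightarrow> 'a"

definition finite_support :: "'a::zero poly3 \<Rightarrow> bool" where
  "finite_support p \<longleftrightarrow> finite {m. p m \<noteq> 0}"

definition is_form :: "nat \<Rightarrow> 'a::zero poly3 \<Rightarrow> bool" where
  "is_form d p \<longleftrightarrow> (\<forall>i j k. p (i,j,k) \<noteq> 0 \<longrightarrow> i + j + k = d)"

definition feval :: "nat \<Rightarrow> 'a::comm_semiring_1 poly3 \<Rightarrow> 'a \<Rightarrow> 'a \<Rightarrow> 'a \<Rightarrow> 'a" where
  "feval d p x y z =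
     (\<Sum>(i,j,k)\<in>{..d} \<times> {..d} \<times> {..d}. p (i,j,k) * x ^ i * y ^ j * z ^ k)"

definition pmul :: "'a::comm_semiring_1 poly3 \<Rightarrow> 'a poly3 \<Rightarrow> 'a poly3" where
  "pmul p q = (\<lambda>(i,j,k). \<Sum>(i1,j1,k1)\<in>{..i} \<times> {..j} \<times> {..k}.
                 p (i1,j1,k1) * q (i - i1, j - j1, k - k1))"

definition is_unit_poly3 :: "'a::field poly3 \<Rightarrow> bool" where
  "is_unit_poly3 p \<longleftrightarrow> p (0,0,0) \<noteq> 0 \<and> (\<forall>m. m \<noteq> (0,0,0) \<longrightarrow> p m = 0)"

definition irreducible_poly3 :: "'a::field poly3 \<Rightarrow> bool" where
  "irreducible_poly3 p \<longleftrightarrow> finite_support p \<and> p \<noteq> (\<lambda>_. 0) \<and> \<not> is_unit_poly3 p \<and>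
     (\<forall>g h. finite_support g \<and> finite_support h \<and> p = pmul g h \<longrightarrow>
        is_unit_poly3 g \<or> is_unit_poly3 h)"

definition complexify :: "real poly3 \<Rightarrow> complex poly3" where
  "complexify p = (\<lambda>m. complex_of_real (p m))"

definition H36 :: "real poly3 set" where
  "H36 = {p. is_form 6 p}"

definition P36 :: "real poly3 set" where
  "P36 = {p \<in> H36. \<forall>x y z. feval 6 p x y z \<ge> 0}"

definition Sigma36 :: "real poly3 set" where
  "Sigma36 = {p. \<exists>gs :: real poly3 list. (\<forall>g\<in>set gs. is_form 3 g) \<and>
                  p = (\<lambda>m. \<Sum>g\<leftarrow>gs. pmul g g m)}"

definition symmetric_poly3 :: "'a poly3 \<Rightarrow> bool" where
  "symmetric_poly3 p \<longleftrightarrow> (\<forall>i j k.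
     p (i,j,k) = p (j,i,k) \<and> p (i,j,k) = p (k,j,i) \<and> p (i,j,k) = p (i,k,j) \<and>
     p (i,j,k) = p (j,k,i) \<and> p (i,j,k) = p (k,i,j))"

definition Ps036 :: "real poly3 set" where
  "Ps036 = {p \<in> P36. symmetric_poly3 p \<and> feval 6 p 1 1 1 = 0}"

definition extremal :: "real poly3 set \<Rightarrow> real poly3 set" where
  "extremal P = {f \<in> P. f \<noteq> (\<lambda>_. 0) \<and>
     (\<forall>g h. g \<in> P \<and> h \<in> P \<and> f = (\<lambda>m. g m + h m) \<longrightarrow>
        (\<exists>t\<ge>0. g = (\<lambda>m. t * f m)) \<and> (\<exists>t\<ge>0. h = (\<lambda>m. t * f m)))}"

definition pderiv3 :: "nat \<Rightarrow> 'a::comm_semiring_1 poly3 \<Rightarrow> 'a poly3" where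
  "pderiv3 n p = (\<lambda>(i,j,k).
     if n = 0 then of_nat (i+1) * p (i+1,j,k)
     else if n = 1 then of_nat (j+1) * p (i,j+1,k)
     else of_nat (k+1) * p (i,j,k+1))"

text \<open>An acnode of the real plane sextic curve f = 0 at the point (x:y:z):
  a real singular point whose Hessian quadratic form is definite modulo the point,
  i.e. a node (nondegenerate quadratic tangent cone) with complex conjugate tangents.\<close>
definition is_acnode6 :: "real poly3 \<Rightarrow> real \<times> real \<times> real \<Rightarrow> bool" where
  "is_acnode6 f pt = (case pt of (x,y,z) \<Rightarrow>
     (x,y,z) \<noteq> (0,0,0) \<and> feval 6 f x y z = 0 \<and>
     (\<forall>n<3. feval 5 (pderiv3 n f) x y z = 0) \<and>
     (let Q = (\<lambda>u :: nat \<Rightarrow> real.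
            \<Sum>n<3. \<Sum>l<3. feval 4 (pderiv3 n (pderiv3 l f)) x y z * u n * u l);
          notprop = (\<lambda>u :: nat \<Rightarrow> real. \<not> (\<exists>t. u 0 = t * x \<and> u 1 = t * y \<and> u 2 = t * z))
      in (\<forall>u. notprop u \<longrightarrow> Q u > 0) \<or> (\<forall>u. notprop u \<longrightarrow> Q u < 0)))"

definition proj_point :: "real \<times> real \<times> real \<Rightarrow> (real \<times> real \<times> real) set" where
  "proj_point pt = (case pt of (x,y,z) \<Rightarrow> {(t*x, t*y, t*z) | t. t \<noteq> 0})"

definition acnodes6 :: "real poly3 \<Rightarrow> (real \<times> real \<times> real) set set" where
  "acnodes6 f = proj_point ` {pt. is_acnode6 f pt}"

definition beval :: "nat \<Rightarrow> (nat \<Rightarrow> complex) \<Rightarrow> complex \<Rightarrow> complex \<Rightarrow> complex" where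
  "beval m a s t = (\<Sum>i\<le>m. a i * s ^ i * t ^ (m - i))"

text \<open>The complex projective curve f = 0 (f a sextic) is rational: it is the image of a
  non-constant morphism P^1 -> P^2 given by binary forms (by Lueroth's theorem, for an
  irreducible curve this is equivalent to being birational to P^1).\<close>
definition rational_curve6 :: "real poly3 \<Rightarrow> bool" where
  "rational_curve6 f \<longleftrightarrow> (\<exists>m a1 a2 a3.
     (\<forall>s t. feval 6 (complexify f) (beval m a1 s t) (beval m a2 s t) (beval m a3 s t) = 0) \<and>
     (\<exists>s t s' t'.
        (beval m a1 s t, beval m a2 s t, beval m a3 s t) \<noteq> (0,0,0) \<and>
        (beval m a1 s' t', beval m a2 s' t', beval m a3 s' t') \<noteq> (0,0,0) \<and>
        \<not> (\<exists>c. beval m a1 s' t' = c * beval m a1 s t \<and> beval m a2 s' t' = c * beval m a2 s t \<and>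
               beval m a3 s' t' = c * beval m a3 s t)))"

end

theory Submission
  imports Defs
begin

text \<open>
  Write \<open>A\<close> for a multiple of \<open>a + b + c\<close>, and \<open>3 x\<close>, \<open>q\<close> for the second and third elementary
  symmetric functions of the centred coordinates. The curves used here are images of the
  conic \<open>y1 + y2 + y3 = 0\<close>, \<open>y1 y2 + y2 y3 + y3 y1 = 3\<close>, which has no real point, under
  \<open>(C y1 : C y2 : C y3)\<close> with \<open>C\<close> a real cubic polynomial.  Eliminating the parameter gives the sextic as a
  binary quadratic form \<open>G\<^sup>2 - A G H - e x H\<^sup>2\<close> in a cubic form \<open>G\<close> and a quadratic form \<open>H\<close>.
  Where this quadratic form is definite it vanishes only at \<open>G = H = 0\<close>, an orbit of six points; elsewhere
  it is monotone in \<open>q\<close>, so it is bounded below by its values on the mirror lines \<open>a = b\<close>, \<open>b = c\<close>, \<open>c = a\<close>, where it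
  factors explicitly and vanishes at the four remaining points.

  A sextic form that vanishes to second order at these ten points is a multiple of \<open>f\<close>: on the chart
  \<open>A = 1\<close> its parts that are symmetric resp. alternating in \<open>b, c\<close> are polynomials in \<open>a\<close> and \<open>x\<close>, and the
  vanishing conditions become a small linear system.  This gives extremality. If \<open>f = g h\<close> over the
  complex numbers, then \<open>g\<close> times the conjugate of \<open>h\<close> also vanishes to second order at the ten (real)
  points, so \<open>h\<close> is proportional to a real form, and real factors are excluded by a
  sign argument on the line \<open>A = 0\<close>, where \<open>f\<close> has no zero.

  Finally, the two parameters of the family and the scale \<open>\<mu>\<close> are recovered from an open set of triples
  \<open>(u, v, w)\<close> because the invariants of the nodes have a surjective derivative at one point.
\<close>

section \<open>Forms and their coefficients\<close>

text \<open>The quadratic form comes from the parametrisation: with \<open>A = N + e v\<close> and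
  \<open>x = - N v\<close> on the curve, \<open>N\<close> and \<open>e v\<close> are the roots of
  \<open>Z\<^sup>2 - A Z - e x\<close>, and \<open>G / H\<close> is the rational expression for
  \<open>N\<close>. Its discriminant \<open>A\<^sup>2 + 4 e x\<close> separates the definite region
  from the rest. A conic without real points is used because a smooth real point of its image would
  lift to one, so that real points can occur only at nodes. The parameter bounds have separate
  tasks: \<open>e < 3\<close> and \<open>K < 3 e\<close> make \<open>D\<close> positive,
  \<open>K < 3 e\<close> also places the vertex, \<open>e < K\<close> keeps the residual factor on
  the mirror lines positive, and \<open>(1 + e)\<^sup>2 < 8 (K - 1)\<close> makes the mirror nodes
  nondegenerate. Ten double zeros are 30 linear conditions on a 28-dimensional space, so uniqueness
  of \<open>f\<close> is not a matter of counting. Shifting the second symmetric function by its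
  value at the generic nodes decouples the conditions there. Three parameters \<open>K\<close>,
  \<open>e\<close>, \<open>\<mu>\<close> face three coordinates; dividing by powers of
  \<open>t\<close> removes \<open>\<mu>\<close> and leaves a map of the plane to be
  inverted.\<close>

definition monomials :: "nat \<Rightarrow> (nat \<times> nat \<times> nat) set" where
  "monomials d = {(i,j,k). i + j + k = d}"

lemma monomials_subset: "monomials d \<subseteq> {..d} \<times> {..d} \<times> {..d}"
  by (auto simp: monomials_def)

lemma finite_monomials [simp]: "finite (monomials d)"
  by (rule finite_subset[OF monomials_subset]) auto

lemma feval_form:
  assumes "is_form d p"
  shows "feval d p x y z = (\<Sum>(i,j,k)\<in>monomials d. p (i,j,k) * x ^ i * y ^ j * z ^ k)"
  unfolding feval_def
proof (rule sum.mono_neutral_right)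
  show "monomials d \<subseteq> {..d} \<times> {..d} \<times> {..d}" by (rule monomials_subset)
  show "\<forall>m\<in>{..d} \<times> {..d} \<times> {..d} - monomials d. (case m of (i,j,k) \<Rightarrow> p (i,j,k) * x ^ i * y ^ j * z ^ k) = 0"
  proof
    fix m assume m: "m \<in> {..d} \<times> {..d} \<times> {..d} - monomials d"
    obtain i j k where [simp]: "m = (i,j,k)" by (cases m) auto
    have "p (i,j,k) = 0" using m assms by (auto simp: is_form_def monomials_def)
    then show "(case m of (i,j,k) \<Rightarrow> p (i,j,k) * x ^ i * y ^ j * z ^ k) = 0" by simp
  qed
qed auto

lemma pmul_restrict:
  assumes "is_form d p"
  shows "pmul p q (i,j,k) = (\<Sum>(a,b,c)\<in>{m \<in> monomials d. fst m \<le> i \<and> fst (snd m) \<le> j \<and> snd (snd m) \<le> k}.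
           p (a,b,c) * q (i - a, j - b, k - c))"
proof -
  have "(\<Sum>(a,b,c)\<in>{..i} \<times> {..j} \<times> {..k}. p (a,b,c) * q (i - a, j - b, k - c)) =
    (\<Sum>(a,b,c)\<in>{m \<in> monomials d. fst m \<le> i \<and> fst (snd m) \<le> j \<and> snd (snd m) \<le> k}.
           p (a,b,c) * q (i - a, j - b, k - c))"
  proof (rule sum.mono_neutral_right)
    show "\<forall>m\<in>{..i} \<times> {..j} \<times> {..k} - {m \<in> monomials d. fst m \<le> i \<and> fst (snd m) \<le> j \<and> snd (snd m) \<le> k}.
       (case m of (a,b,c) \<Rightarrow> p (a,b,c) * q (i - a, j - b, k - c)) = 0"
    proof
      fix m assume m: "m \<in> {..i} \<times> {..j} \<times> {..k} - {m \<in> monomials d. fst m \<le> i \<and> fst (snd m) \<le> j \<and> snd (snd m) \<le> k}"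
      obtain a b c where [simp]: "m = (a,b,c)" by (cases m) auto
      have "(a,b,c) \<notin> monomials d" using m by auto
      then have "p (a,b,c) = 0" using assms by (auto simp: is_form_def monomials_def)
      then show "(case m of (a,b,c) \<Rightarrow> p (a,b,c) * q (i - a, j - b, k - c)) = 0" by simp
    qed
  qed auto
  then show ?thesis by (simp add: pmul_def)
qed

lemma is_form_pmul:
  assumes "is_form d p" "is_form e q"
  shows "is_form (d + e) (pmul p q)"
  unfolding is_form_def
proof (intro allI impI)
  fix i j k
  assume "pmul p q (i,j,k) \<noteq> 0"
  then have "(\<Sum>(a,b,c)\<in>{..i} \<times> {..j} \<times> {..k}. p (a,b,c) * q (i - a, j - b, k - c)) \<noteq> 0"
    by (simp add: pmul_def)
  then obtain m where m: "m \<in> {..i} \<times> {..j} \<times> {..k}"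
      "(case m of (a,b,c) \<Rightarrow> p (a,b,c) * q (i - a, j - b, k - c)) \<noteq> 0"
    by (rule sum.not_neutral_contains_not_neutral)
  obtain a b c where [simp]: "m = (a,b,c)" by (cases m) auto
  have "p (a,b,c) \<noteq> 0" "q (i - a, j - b, k - c) \<noteq> 0" using m by auto
  then have "a + b + c = d" "(i - a) + (j - b) + (k - c) = e"
    using assms unfolding is_form_def by blast+
  then show "i + j + k = d + e" using m(1) by auto
qed

lemma feval_pmul:
  assumes p: "is_form d p" and q: "is_form e q"
  shows "feval (d + e) (pmul p q) x y z = feval d p x y z * feval e q x y z"
proof -
  let ?N = "\<lambda>i j k. {m \<in> monomials d. fst m \<le> i \<and> fst (snd m) \<le> j \<and> snd (snd m) \<le> k}"
  have "feval (d + e) (pmul p q) x y z =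
    (\<Sum>n\<in>monomials (d + e). \<Sum>m\<in>?N (fst n) (fst (snd n)) (snd (snd n)).
       p m * q (fst n - fst m, fst (snd n) - fst (snd m), snd (snd n) - snd (snd m)) *
       x ^ fst n * y ^ fst (snd n) * z ^ snd (snd n))"
    unfolding feval_form[OF is_form_pmul[OF p q]]
    by (intro sum.cong) (auto simp: pmul_restrict[OF p] sum_distrib_right case_prod_unfold)
  also have "\<dots> = (\<Sum>(n,m)\<in>(SIGMA n:monomials (d + e). ?N (fst n) (fst (snd n)) (snd (snd n))).
       p m * q (fst n - fst m, fst (snd n) - fst (snd m), snd (snd n) - snd (snd m)) *
       x ^ fst n * y ^ fst (snd n) * z ^ snd (snd n))"
    by (rule sum.Sigma) auto
  also have "\<dots> = (\<Sum>(m,m')\<in>monomials d \<times> monomials e.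
       (p m * x ^ fst m * y ^ fst (snd m) * z ^ snd (snd m)) *
       (q m' * x ^ fst m' * y ^ fst (snd m') * z ^ snd (snd m')))"
    by (rule sum.reindex_bij_witness[symmetric, where
          j = "\<lambda>(m,m'). ((fst m + fst m', fst (snd m) + fst (snd m'), snd (snd m) + snd (snd m')), m)" and
          i = "\<lambda>(n,m). (m, (fst n - fst m, fst (snd n) - fst (snd m), snd (snd n) - snd (snd m)))"])
       (auto simp: monomials_def algebra_simps power_add)
  also have "\<dots> = feval d p x y z * feval e q x y z"
    unfolding feval_form[OF p] feval_form[OF q] sum_product sum.cartesian_product
    by (simp add: case_prod_unfold)
  finally show ?thesis .
qed

lemma is_form_add: "is_form d p \<Longrightarrow> is_form d q \<Longrightarrow> is_form d (\<lambda>m. p m + (q m :: 'a::comm_ring_1))"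
  unfolding is_form_def by (metis add.right_neutral)

lemma is_form_diff: "is_form d p \<Longrightarrow> is_form d q \<Longrightarrow> is_form d (\<lambda>m. p m - (q m :: 'a::comm_ring_1))"
  unfolding is_form_def by (metis diff_zero)

lemma is_form_cmult: "is_form d p \<Longrightarrow> is_form d (\<lambda>m. c * (p m :: 'a::comm_ring_1))"
  unfolding is_form_def by (metis mult_zero_right)

lemma feval_add: "feval d (\<lambda>m. p m + q m) x y z = feval d p x y z + feval d q x y z"
  by (simp add: feval_def sum.distrib[symmetric] case_prod_unfold algebra_simps)

lemma feval_diff:
  fixes p q :: "'a::comm_ring_1 poly3"
  shows "feval d (\<lambda>m. p m - q m) x y z = feval d p x y z - feval d q x y z"
  by (simp add: feval_def sum_subtractf[symmetric] case_prod_unfold algebra_simps)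

lemma feval_cmult: "feval d (\<lambda>m. c * p m) x y z = c * feval d p x y z"
  by (simp add: feval_def sum_distrib_left case_prod_unfold algebra_simps)

lemma feval_zero [simp]: "feval d (\<lambda>m. 0) x y z = 0"
  by (simp add: feval_def)

lemma feval_scale:
  assumes "is_form d p"
  shows "feval d p (t * x) (t * y) (t * z) = t ^ d * feval d p x y z"
  unfolding feval_form[OF assms] sum_distrib_left
  by (rule sum.cong) (auto simp: monomials_def power_mult_distrib power_add algebra_simps)

lemma feval_line:
  fixes p :: "'a::comm_ring_1 poly3"
  shows "\<exists>P. \<forall>s. feval d p (x + s * u) (y + s * v) (z + s * w) = poly P s"
proof -
  let ?P = "\<Sum>(i,j,k)\<in>{..d} \<times> {..d} \<times> {..d}. smult (p (i,j,k)) ([:x,u:] ^ i * [:y,v:] ^ j * [:z,w:] ^ k)"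
  have "feval d p (x + s * u) (y + s * v) (z + s * w) = poly ?P s" for s
    by (simp add: feval_def poly_sum case_prod_unfold algebra_simps)
  then show ?thesis by blast
qed

text \<open>Kronecker substitution: for \<open>B > d\<close> the monomials of degree \<open>d\<close> have distinct
  exponents along the curve \<open>(s, s^B, s^(B^2))\<close>.\<close>

lemma finite_zeros_kronecker:
  fixes p :: "'a::real_field poly3"
  assumes p: "is_form d p" "p \<noteq> (\<lambda>_. 0)" and B: "d < B"
  shows "finite {s::real. feval d p (of_real s) (of_real (s ^ B)) (of_real (s ^ (B\<^sup>2))) = 0}"
proof -
  define code where "code = (\<lambda>(i,j,k). i + B * (j + B * k))"
  have inj: "m = m'" if "m \<in> monomials d" "m' \<in> monomials d" "code m = code m'" for m m'
  proof -
    obtain i j k i' j' k' where mm: "m = (i,j,k)" "m' = (i',j',k')" by (metis prod_cases3)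
    have lt: "i < B" "j < B" "i' < B" "j' < B" using that B mm by (auto simp: monomials_def)
    have *: "i + B * (j + B * k) = i' + B * (j' + B * k')" using that(3) mm by (simp add: code_def)
    from lt have "(i + B * (j + B * k)) mod B = i" "(i' + B * (j' + B * k')) mod B = i'" by auto
    with * have "i = i'" by simp
    from lt have "(i + B * (j + B * k)) div B = j + B * k" "(i' + B * (j' + B * k')) div B = j' + B * k'" by auto
    with * have 2: "j + B * k = j' + B * k'" by simp
    from lt have "(j + B * k) mod B = j" "(j' + B * k') mod B = j'" by auto
    with 2 have "j = j'" by simp
    with 2 have "k = k'" using lt by auto
    show ?thesis using \<open>i = i'\<close> \<open>j = j'\<close> \<open>k = k'\<close> mm by simp
  qed
  define P where "P = (\<Sum>m\<in>monomials d. monom (p m) (code m))"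
  obtain m0 where m0: "p m0 \<noteq> 0" using p(2) by blast
  have m0': "m0 \<in> monomials d" using m0 p(1) by (cases m0) (auto simp: is_form_def monomials_def)
  have "coeff P (code m0) = (\<Sum>m\<in>monomials d. if m = m0 then p m else 0)"
    unfolding P_def coeff_sum coeff_monom
    by (rule sum.cong) (use inj m0' in auto)
  also have "\<dots> = p m0" using m0' by simp
  finally have "P \<noteq> 0" using m0 by auto
  then have fin: "finite {x. poly P x = 0}" by (rule poly_roots_finite)
  have "feval d p (of_real s) (of_real (s ^ B)) (of_real (s ^ (B\<^sup>2))) = poly P (of_real s)" for s
    unfolding feval_form[OF p(1)] P_def poly_sum poly_monom code_def
    by (rule sum.cong) (auto simp: power_add power_mult power2_eq_square)
  then have "{s::real. feval d p (of_real s) (of_real (s ^ B)) (of_real (s ^ (B\<^sup>2))) = 0}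
      = of_real -` {x. poly P x = 0}" by auto
  moreover have "finite ((of_real :: real \<Rightarrow> 'a) -` {x. poly P x = 0})"
    by (rule finite_vimageI[OF fin]) (auto intro: injI)
  ultimately show ?thesis by simp
qed

text \<open>One exponent base above both degrees makes both polynomials along the Kronecker curve
  nonzero, so only finitely many real parameters are bad. The point is real even for complex
  coefficients: this serves as identity principle and as absence of zero divisors.\<close>

lemma forms_nonzero_point:
  fixes p :: "'a::real_field poly3" and q :: "'b::real_field poly3"
  assumes p: "is_form d p" "p \<noteq> (\<lambda>_. 0)" and q: "is_form e q" "q \<noteq> (\<lambda>_. 0)"
  obtains x y z :: real where "feval d p (of_real x) (of_real y) (of_real z) \<noteq> 0"
    "feval e q (of_real x) (of_real y) (of_real z) \<noteq> 0"
proof -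
  define B where "B = Suc (d + e)"
  have "finite ({s::real. feval d p (of_real s) (of_real (s ^ B)) (of_real (s ^ (B\<^sup>2))) = 0} \<union>
      {s::real. feval e q (of_real s) (of_real (s ^ B)) (of_real (s ^ (B\<^sup>2))) = 0})"
    using finite_zeros_kronecker[OF p, of B] finite_zeros_kronecker[OF q, of B] by (auto simp: B_def)
  then obtain s where "s \<notin> {s::real. feval d p (of_real s) (of_real (s ^ B)) (of_real (s ^ (B\<^sup>2))) = 0} \<union>
      {s::real. feval e q (of_real s) (of_real (s ^ B)) (of_real (s ^ (B\<^sup>2))) = 0}"
    using ex_new_if_finite[OF infinite_UNIV_char_0] by blast
  then show ?thesis using that[of s "s ^ B" "s ^ (B\<^sup>2)"] by blast
qed

lemma form_eq_zeroI:
  fixes p :: "'a::real_field poly3"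
  assumes "is_form d p" "\<And>x y z :: real. feval d p (of_real x) (of_real y) (of_real z) = 0"
  shows "p = (\<lambda>_. 0)"
  using forms_nonzero_point[OF assms(1) _ assms(1)] assms(2) by metis

lemma form_eqI:
  fixes p q :: "'a::real_field poly3"
  assumes "is_form d p" "is_form d q"
    "\<And>x y z :: real. feval d p (of_real x) (of_real y) (of_real z) = feval d q (of_real x) (of_real y) (of_real z)"
  shows "p = q"
proof -
  have "(\<lambda>m. p m - q m) = (\<lambda>_. 0)"
    by (rule form_eq_zeroI[where d = d]) (use assms in \<open>auto intro: is_form_diff simp: feval_diff\<close>)
  then show ?thesis by (auto simp: fun_eq_iff)
qed

text \<open>Working with values keeps the degree while forms are composed; over the real and complex
  numbers \<open>form_eqI\<close> makes the coefficients unique.\<close>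

definition form_fun :: "nat \<Rightarrow> ('a::comm_ring_1 \<Rightarrow> 'a \<Rightarrow> 'a \<Rightarrow> 'a) \<Rightarrow> bool" where
  "form_fun d F \<longleftrightarrow> (\<exists>p. is_form d p \<and> (\<forall>x y z. F x y z = feval d p x y z))"

lemma form_fun_feval: "is_form d p \<Longrightarrow> form_fun d (feval d p)"
  by (auto simp: form_fun_def)

lemma form_fun_add: "form_fun d F \<Longrightarrow> form_fun d F' \<Longrightarrow> form_fun d (\<lambda>x y z. F x y z + F' x y z)"
  unfolding form_fun_def using is_form_add feval_add by metis

lemma form_fun_cmult: "form_fun d F \<Longrightarrow> form_fun d (\<lambda>x y z. c * F x y z)"
  unfolding form_fun_def using is_form_cmult feval_cmult by metis

lemma form_fun_mult:
  "form_fun d F \<Longrightarrow> form_fun e F' \<Longrightarrow> form_fun (d + e) (\<lambda>x y z. F x y z * F' x y z)"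
  unfolding form_fun_def using is_form_pmul feval_pmul by metis

lemma form_fun_coords:
  "form_fun 1 (\<lambda>x y z :: 'a::comm_ring_1. x)" "form_fun 1 (\<lambda>x y z :: 'a. y)" "form_fun 1 (\<lambda>x y z :: 'a. z)"
proof -
  have f: "is_form 1 (\<lambda>m. if m = n then 1 else (0::'a))" if "n \<in> monomials 1" for n
    using that by (auto simp: is_form_def monomials_def)
  have e: "feval 1 (\<lambda>m. if m = n then 1 else 0) x y z = x ^ fst n * y ^ fst (snd n) * z ^ snd (snd n)"
    if n: "n \<in> monomials 1" for n and x y z :: 'a
  proof -
    have "feval 1 (\<lambda>m. if m = n then 1 else 0) x y z =
      (\<Sum>m\<in>monomials 1. if m = n then x ^ fst n * y ^ fst (snd n) * z ^ snd (snd n) else 0)"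
      unfolding feval_form[OF f[OF n]] by (rule sum.cong) auto
    then show ?thesis using n by simp
  qed
  have m: "(1,0,0) \<in> monomials 1" "(0,1,0) \<in> monomials 1" "(0,0,1) \<in> monomials 1"
    by (auto simp: monomials_def)
  show "form_fun 1 (\<lambda>x y z :: 'a. x)" unfolding form_fun_def
    using f[OF m(1)] e[OF m(1)] by (intro exI[of _ "\<lambda>m. if m = (1,0,0) then 1 else 0"]) simp
  show "form_fun 1 (\<lambda>x y z :: 'a. y)" unfolding form_fun_def
    using f[OF m(2)] e[OF m(2)] by (intro exI[of _ "\<lambda>m. if m = (0,1,0) then 1 else 0"]) simp
  show "form_fun 1 (\<lambda>x y z :: 'a. z)" unfolding form_fun_def
    using f[OF m(3)] e[OF m(3)] by (intro exI[of _ "\<lambda>m. if m = (0,0,1) then 1 else 0"]) simp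
qed

lemma form_fun_line: "form_fun d F \<Longrightarrow> \<exists>P. \<forall>s. F (x + s * u) (y + s * v) (z + s * w) = poly P s"
  unfolding form_fun_def by (metis feval_line)

lemma form_fun_scale: "form_fun d F \<Longrightarrow> F (t * x) (t * y) (t * z) = t ^ d * F x y z"
  unfolding form_fun_def by (metis feval_scale)

lemma is_form_swap:
  assumes "is_form d p"
  shows "is_form d (\<lambda>(i,j,k). p (i,k,j))" "is_form d (\<lambda>(i,j,k). p (j,i,k))"
  using assms unfolding is_form_def by (simp_all, (metis add.assoc add.commute)+)

lemma feval_swap:
  shows "feval d (\<lambda>(i,j,k). p (i,k,j)) x y z = feval d p x z y"
    and "feval d (\<lambda>(i,j,k). p (j,i,k)) x y z = feval d p y x z"
proof -
  show "feval d (\<lambda>(i,j,k). p (i,k,j)) x y z = feval d p x z y" unfolding feval_def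
    by (rule sum.reindex_bij_witness[where i = "\<lambda>(i,j,k). (i,k,j)" and j = "\<lambda>(i,j,k). (i,k,j)"]) (auto simp: ac_simps)
  show "feval d (\<lambda>(i,j,k). p (j,i,k)) x y z = feval d p y x z" unfolding feval_def
    by (rule sum.reindex_bij_witness[where i = "\<lambda>(i,j,k). (j,i,k)" and j = "\<lambda>(i,j,k). (j,i,k)"]) (auto simp: ac_simps)
qed

section \<open>Double zeros and acnodes\<close>

text \<open>Order of vanishing at least two, tested on lines: every restriction is divisible by
  \<open>s\<^sup>2\<close> as a polynomial. In this shape it combines with products and
  factorisations without partial derivatives.\<close>

definition double_zero :: "(real \<Rightarrow> real \<Rightarrow> real \<Rightarrow> real) \<Rightarrow> real \<Rightarrow> real \<Rightarrow> real \<Rightarrow> bool" where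
  "double_zero F x y z \<longleftrightarrow>
     (\<forall>u v w. \<exists>C. \<forall>s. F (x + s * u) (y + s * v) (z + s * w) = s\<^sup>2 * poly C s)"

lemma double_zero_value: "double_zero F x y z \<Longrightarrow> F x y z = 0"
proof -
  assume "double_zero F x y z"
  then obtain C where "\<And>s. F (x + s * 0) (y + s * 0) (z + s * 0) = s\<^sup>2 * poly C s"
    unfolding double_zero_def by meson
  from this[of 0] show ?thesis by simp
qed

lemma double_zero_DERIV:
  assumes "double_zero F x y z"
  shows "((\<lambda>s. F (x + s * u) (y + s * v) (z + s * w)) has_real_derivative 0) (at 0)"
proof -
  obtain C where "\<And>s. F (x + s * u) (y + s * v) (z + s * w) = s\<^sup>2 * poly C s"
    using assms unfolding double_zero_def by meson
  then show ?thesis by (auto intro!: derivative_eq_intros poly_DERIV)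
qed

text \<open>Each restriction to a line through the zero is a polynomial with a minimum at
  \<open>s = 0\<close>, so its constant and linear coefficients vanish.\<close>

lemma double_zero_of_nonneg:
  assumes F: "form_fun d F" and nn: "\<And>x y z. 0 \<le> F x y z" and z: "F x y z = 0"
  shows "double_zero F x y z"
  unfolding double_zero_def
proof (intro allI)
  fix u v w
  obtain P where P: "\<And>s. F (x + s * u) (y + s * v) (z + s * w) = poly P s"
    using form_fun_line[OF F] by meson
  obtain a0 P1 where P1: "P = pCons a0 P1" by (cases P) auto
  obtain a1 C where C: "P1 = pCons a1 C" by (cases P1) auto
  have "a0 = 0" using P[of 0] z by (simp add: P1)
  have "poly (pderiv P) 0 = 0"
    by (rule DERIV_local_min[OF poly_DERIV zero_less_one]) (use nn P z \<open>a0 = 0\<close> in \<open>metis P1 add_0 mult_zero_left poly_pCons\<close>)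
  then have "a1 = 0" by (simp add: P1 C pderiv_pCons)
  have "F (x + s * u) (y + s * v) (z + s * w) = s\<^sup>2 * poly C s" for s
    unfolding P P1 C \<open>a0 = 0\<close> \<open>a1 = 0\<close> by (simp add: power2_eq_square)
  then show "\<exists>C. \<forall>s. F (x + s * u) (y + s * v) (z + s * w) = s\<^sup>2 * poly C s" by blast
qed

section \<open>Formal derivatives and the acnode criterion\<close>

lemma is_form_pderiv3:
  fixes p :: "real poly3"
  assumes "is_form (Suc d) p" shows "is_form d (pderiv3 n p)"
  using assms unfolding is_form_def pderiv3_def by (auto split: if_splits) (metis add_Suc_right add_Suc Suc_inject mult_zero_right)+

lemma feval_pderiv3:
  fixes p :: "real poly3"
  assumes p: "is_form (Suc d) p"
  shows "feval d (pderiv3 0 p) x y z = (\<Sum>(i,j,k)\<in>monomials (Suc d). p (i,j,k) * (real i * x ^ (i - 1)) * y ^ j * z ^ k)"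
    and "feval d (pderiv3 1 p) x y z = (\<Sum>(i,j,k)\<in>monomials (Suc d). p (i,j,k) * x ^ i * (real j * y ^ (j - 1)) * z ^ k)"
    and "feval d (pderiv3 2 p) x y z = (\<Sum>(i,j,k)\<in>monomials (Suc d). p (i,j,k) * x ^ i * y ^ j * (real k * z ^ (k - 1)))"
proof -
  have fin: "finite {m. (case m of (i,j,k) \<Rightarrow> i + j + k = Suc d) \<and> Q m}" for Q
    by (rule finite_subset[OF _ finite_monomials[of "Suc d"]]) (auto simp: monomials_def)
  show "feval d (pderiv3 0 p) x y z = (\<Sum>(i,j,k)\<in>monomials (Suc d). p (i,j,k) * (real i * x ^ (i - 1)) * y ^ j * z ^ k)"
    unfolding feval_form[OF is_form_pderiv3[OF p]]
    by (rule sum.reindex_bij_witness_not_neutral[where S' = "{}" and T' = "{m \<in> monomials (Suc d). fst m = 0}"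
          and j = "\<lambda>(i,j,k). (Suc i,j,k)" and i = "\<lambda>(i,j,k). (i - 1,j,k)"])
       (auto simp: fin monomials_def pderiv3_def)
  show "feval d (pderiv3 1 p) x y z = (\<Sum>(i,j,k)\<in>monomials (Suc d). p (i,j,k) * x ^ i * (real j * y ^ (j - 1)) * z ^ k)"
    unfolding feval_form[OF is_form_pderiv3[OF p]]
    by (rule sum.reindex_bij_witness_not_neutral[where S' = "{}" and T' = "{m \<in> monomials (Suc d). fst (snd m) = 0}"
          and j = "\<lambda>(i,j,k). (i,Suc j,k)" and i = "\<lambda>(i,j,k). (i,j - 1,k)"])
       (auto simp: fin monomials_def pderiv3_def)
  show "feval d (pderiv3 2 p) x y z = (\<Sum>(i,j,k)\<in>monomials (Suc d). p (i,j,k) * x ^ i * y ^ j * (real k * z ^ (k - 1)))"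
    unfolding feval_form[OF is_form_pderiv3[OF p]]
    by (rule sum.reindex_bij_witness_not_neutral[where S' = "{}" and T' = "{m \<in> monomials (Suc d). snd (snd m) = 0}"
          and j = "\<lambda>(i,j,k). (i,j,Suc k)" and i = "\<lambda>(i,j,k). (i,j,k - 1)"])
       (auto simp: fin monomials_def pderiv3_def)
qed

lemma feval_DERIV:
  fixes p :: "real poly3"
  assumes p: "is_form (Suc d) p"
  shows "((\<lambda>s. feval (Suc d) p (x + s * u) (y + s * v) (z + s * w)) has_real_derivative
     (u * feval d (pderiv3 0 p) (x + s * u) (y + s * v) (z + s * w) +
      v * feval d (pderiv3 1 p) (x + s * u) (y + s * v) (z + s * w) +
      w * feval d (pderiv3 2 p) (x + s * u) (y + s * v) (z + s * w))) (at s)"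
  unfolding feval_pderiv3[OF p] feval_form[OF p]
  by (auto intro!: derivative_eq_intros simp: case_prod_unfold sum_distrib_left sum.distrib[symmetric] algebra_simps
      intro!: sum.cong)

text \<open>Only a limit of \<open>C\<close> is assumed, and the equation only near
  \<open>0\<close>, because after a central projection the quotient involves
  \<open>s / (1 + s \<tau>)\<close>. The restriction itself is a polynomial, so its low coefficients
  are found by cancelling one power of \<open>s\<close> at a time and comparing limits.\<close>

lemma hessian_line:
  fixes p :: "real poly3"
  assumes p: "is_form 6 p"
    and ev: "\<forall>\<^sub>F s in at 0. feval 6 p (x + s * u 0) (y + s * u 1) (z + s * u 2) = s\<^sup>2 * C s"
    and lim: "(C \<longlongrightarrow> c) (at 0)"
  shows "(\<Sum>n<3. u n * feval 5 (pderiv3 n p) x y z) = 0"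
    and "(\<Sum>n<3. \<Sum>l<3. feval 4 (pderiv3 n (pderiv3 l p)) x y z * u n * u l) = 2 * c"
    and "feval 6 p x y z = 0"
proof -
  let ?L = "\<lambda>s. feval 6 p (x + s * u 0) (y + s * u 1) (z + s * u 2)"
  obtain P where P: "\<And>s. ?L s = poly P s" using feval_line[of 6 p x "u 0" y "u 1" z "u 2"] by meson
  have p5: "is_form 6 p" "is_form (Suc 5) p" "is_form 5 (pderiv3 n p)" "is_form (Suc 4) (pderiv3 n p)" for n
    using p is_form_pderiv3[of 5 p n] by (simp_all add: eval_nat_numeral)
  have n6: "(6::nat) = Suc 5" "(5::nat) = Suc 4" by simp_all
  define D1 where "D1 = (\<lambda>s. u 0 * feval 5 (pderiv3 0 p) (x + s * u 0) (y + s * u 1) (z + s * u 2) +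
      u 1 * feval 5 (pderiv3 1 p) (x + s * u 0) (y + s * u 1) (z + s * u 2) +
      u 2 * feval 5 (pderiv3 2 p) (x + s * u 0) (y + s * u 1) (z + s * u 2))"
  have "(?L has_real_derivative D1 s) (at s)" for s
    unfolding D1_def n6(1) by (rule feval_DERIV[OF p5(2)])
  then have D1: "D1 s = poly (pderiv P) s" for s
    unfolding P using DERIV_unique poly_DERIV by blast
  have g: "((\<lambda>s. feval 5 (pderiv3 n p) (x + s * u 0) (y + s * u 1) (z + s * u 2)) has_real_derivative
     (u 0 * feval 4 (pderiv3 0 (pderiv3 n p)) (x + s * u 0) (y + s * u 1) (z + s * u 2) +
      u 1 * feval 4 (pderiv3 1 (pderiv3 n p)) (x + s * u 0) (y + s * u 1) (z + s * u 2) +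
      u 2 * feval 4 (pderiv3 2 (pderiv3 n p)) (x + s * u 0) (y + s * u 1) (z + s * u 2))) (at s)" for n s
    unfolding n6(2) by (rule feval_DERIV[OF p5(4)])
  have "(D1 has_real_derivative (\<Sum>n<3. \<Sum>l<3. feval 4 (pderiv3 n (pderiv3 l p)) x y z * u n * u l)) (at 0)"
    unfolding D1_def
    by (rule derivative_eq_intros g | simp add: eval_nat_numeral algebra_simps)+
  moreover have "(D1 has_real_derivative poly (pderiv (pderiv P)) 0) (at 0)"
    unfolding D1 by (rule poly_DERIV)
  ultimately have D2: "(\<Sum>n<3. \<Sum>l<3. feval 4 (pderiv3 n (pderiv3 l p)) x y z * u n * u l) = poly (pderiv (pderiv P)) 0"
    by (rule DERIV_unique)
  have D10: "D1 0 = (\<Sum>n<3. u n * feval 5 (pderiv3 n p) x y z)"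
    by (simp add: D1_def eval_nat_numeral)
  obtain a0 P1 where P1: "P = pCons a0 P1" by (cases P) auto
  obtain a1 R where R: "P1 = pCons a1 R" by (cases P1) auto
  have lims: "((\<lambda>s. poly Z s) \<longlongrightarrow> poly Z 0) (at 0)" for Z :: "real poly"
    using poly_isCont[of 0 Z] by (simp add: isCont_def)
  have e0: "\<forall>\<^sub>F s in at (0::real). s \<noteq> 0" by (simp add: eventually_at_filter)
  have "((\<lambda>s. s\<^sup>2 * C s) \<longlongrightarrow> 0\<^sup>2 * c) (at 0)" by (intro tendsto_intros lim)
  moreover have ev': "\<forall>\<^sub>F s in at 0. s\<^sup>2 * C s = poly P s"
    using ev by eventually_elim (metis P)
  ultimately have "((\<lambda>s. poly P s) \<longlongrightarrow> 0\<^sup>2 * c) (at 0)"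
    by (rule Lim_transform_eventually)
  from tendsto_unique[OF _ lims[of P] this] have "a0 = 0" by (simp add: P1)
  have "((\<lambda>s. s * C s) \<longlongrightarrow> 0 * c) (at 0)" by (intro tendsto_intros lim)
  moreover have "\<forall>\<^sub>F s in at 0. s * C s = poly P1 s"
    using ev' e0 by eventually_elim (auto simp: P1 \<open>a0 = 0\<close> power2_eq_square)
  ultimately have "((\<lambda>s. poly P1 s) \<longlongrightarrow> 0 * c) (at 0)"
    by (rule Lim_transform_eventually)
  from tendsto_unique[OF _ lims[of P1] this] have "a1 = 0" by (simp add: R)
  have "\<forall>\<^sub>F s in at 0. C s = poly R s"
    using ev' e0 by eventually_elim (auto simp: P1 R \<open>a0 = 0\<close> \<open>a1 = 0\<close> power2_eq_square)
  with lim have "((\<lambda>s. poly R s) \<longlongrightarrow> c) (at 0)" by (rule Lim_transform_eventually)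
  from tendsto_unique[OF _ lims[of R] this] have "poly R 0 = c" by simp
  show "(\<Sum>n<3. u n * feval 5 (pderiv3 n p) x y z) = 0"
    using D10 D1[of 0] by (simp add: P1 R \<open>a1 = 0\<close> pderiv_pCons)
  show "(\<Sum>n<3. \<Sum>l<3. feval 4 (pderiv3 n (pderiv3 l p)) x y z * u n * u l) = 2 * c"
    unfolding D2 P1 R using \<open>poly R 0 = c\<close> by (simp add: pderiv_pCons pderiv_add)
  show "feval 6 p x y z = 0" using P[of 0] by (simp add: P1 \<open>a0 = 0\<close>)
qed

text \<open>The Hessian degenerates along the point itself. Since
  \<open>x + y + z \<noteq> 0\<close>, the directions with coordinate sum zero form a complement of
  the point, and homogeneity transfers the test from them to all directions.\<close>

lemma acnodeI:
  assumes p: "is_form 6 p" and sum: "x + y + z \<noteq> 0"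
    and C: "\<And>u v w. u + v + w = 0 \<Longrightarrow> \<exists>C. (\<forall>s. feval 6 p (x + s * u) (y + s * v) (z + s * w) = s\<^sup>2 * C s) \<and>
        isCont C 0 \<and> ((u,v,w) \<noteq> (0,0,0) \<longrightarrow> 0 < C 0)"
  shows "is_acnode6 p (x,y,z)"
proof -
  have main: "(\<Sum>n<3. u n * feval 5 (pderiv3 n p) x y z) = 0 \<and>
      ((\<nexists>t. u 0 = t * x \<and> u 1 = t * y \<and> u 2 = t * z) \<longrightarrow>
        0 < (\<Sum>n<3. \<Sum>l<3. feval 4 (pderiv3 n (pderiv3 l p)) x y z * u n * u l)) \<and>
      feval 6 p x y z = 0" for u :: "nat \<Rightarrow> real"
  proof -
    \<comment> \<open>\<open>\<tau>\<close> is the multiple of the point whose removal from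
      \<open>u\<close> leaves a direction with coordinate sum zero.\<close>
    define \<tau> where "\<tau> = (u 0 + u 1 + u 2) / (x + y + z)"
    define a b c where "a = u 0 - \<tau> * x" and "b = u 1 - \<tau> * y" and "c = u 2 - \<tau> * z"
    have "\<tau> * (x + y + z) = u 0 + u 1 + u 2" using sum by (simp add: \<tau>_def)
    then have "a + b + c = 0" by (simp add: a_def b_def c_def algebra_simps)
    from C[OF this] obtain C where C: "\<And>s. feval 6 p (x + s * a) (y + s * b) (z + s * c) = s\<^sup>2 * C s"
        "isCont C 0" "(a,b,c) \<noteq> (0,0,0) \<Longrightarrow> 0 < C 0" by blast
    have "((\<lambda>s. 1 + s * \<tau>) \<longlongrightarrow> 1 + 0 * \<tau>) (at 0)" by (intro tendsto_intros)
    then have lim1: "((\<lambda>s. 1 + s * \<tau>) \<longlongrightarrow> 1) (at 0)" by simp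
    then have ne: "\<forall>\<^sub>F s in at 0. 1 + s * \<tau> \<noteq> 0" by (rule tendsto_imp_eventually_ne) simp
    \<comment> \<open>Pulling out \<open>1 + s \<tau>\<close> turns the motion into a transversal
      one with parameter \<open>s / (1 + s \<tau>)\<close>; of the six powers, two cancel against
      the square of this parameter.\<close>
    have ev: "\<forall>\<^sub>F s in at 0. feval 6 p (x + s * u 0) (y + s * u 1) (z + s * u 2) =
        s\<^sup>2 * ((1 + s * \<tau>) ^ 4 * C (s / (1 + s * \<tau>)))"
      using ne
    proof eventually_elim
      case (elim s)
      let ?m = "1 + s * \<tau>"
      have "feval 6 p (x + s * u 0) (y + s * u 1) (z + s * u 2) =
        feval 6 p (?m * (x + (s / ?m) * a)) (?m * (y + (s / ?m) * b)) (?m * (z + (s / ?m) * c))"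
      proof -
        have "?m * (X + (s / ?m) * Y) = X + s * (Y + \<tau> * X)" for X Y
        proof -
          have "?m * (X + (s / ?m) * Y) = ?m * X + (?m * (s / ?m)) * Y" by (simp only: distrib_left mult.assoc)
          also have "?m * (s / ?m) = s" using elim by simp
          finally show ?thesis by (simp add: algebra_simps)
        qed
        from this[of x a] this[of y b] this[of z c]
        show ?thesis by (simp add: a_def b_def c_def)
      qed
      also have "\<dots> = ?m ^ 6 * ((s / ?m)\<^sup>2 * C (s / ?m))" by (simp only: feval_scale[OF p] C(1))
      also have "\<dots> = s\<^sup>2 * (?m ^ 4 * C (s / ?m))"
        using elim by (simp add: power_divide eval_nat_numeral)
      finally show ?case .
    qed
    have "((\<lambda>s. s / (1 + s * \<tau>)) \<longlongrightarrow> 0 / 1) (at 0)" by (intro tendsto_intros lim1) auto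
    then have "((\<lambda>s. C (s / (1 + s * \<tau>))) \<longlongrightarrow> C 0) (at 0)"
      using isCont_tendsto_compose[OF C(2)] by simp
    then have "((\<lambda>s. (1 + s * \<tau>) ^ 4 * C (s / (1 + s * \<tau>))) \<longlongrightarrow> 1 ^ 4 * C 0) (at 0)"
      by (intro tendsto_intros lim1)
    note H = hessian_line[OF p ev this]
    show ?thesis
    proof (intro conjI impI)
      assume "\<nexists>t. u 0 = t * x \<and> u 1 = t * y \<and> u 2 = t * z"
      then have "(a,b,c) \<noteq> (0,0,0)" by (auto simp: a_def b_def c_def)
      then show "0 < (\<Sum>n<3. \<Sum>l<3. feval 4 (pderiv3 n (pderiv3 l p)) x y z * u n * u l)"
        unfolding H(2) using C(3) by simp
    qed (use H in auto)
  qed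
  have "feval 5 (pderiv3 n p) x y z = 0" if "n < 3" for n
    using main[of "\<lambda>l. if l = n then 1 else 0"] that by (simp add: if_distrib[of "\<lambda>a. a * _"] cong: if_cong)
  moreover have "(x,y,z) \<noteq> (0,0,0)" using sum by auto
  ultimately show ?thesis
    unfolding is_acnode6_def Let_def prod.case using main by blast
qed

section \<open>Real and imaginary parts, homogeneous components\<close>

lemma feval_Re: "feval d (\<lambda>m. Re (p m)) x y z = Re (feval d p (of_real x) (of_real y) (of_real z))"
proof -
  have *: "of_real x ^ i = complex_of_real (x ^ i)" for x i by simp
  show ?thesis unfolding feval_def case_prod_unfold Re_sum
    by (intro sum.cong refl) (simp add: * del: of_real_power)
qed

lemma feval_Im: "feval d (\<lambda>m. Im (p m)) x y z = Im (feval d p (of_real x) (of_real y) (of_real z))"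
proof -
  have *: "of_real x ^ i = complex_of_real (x ^ i)" for x i by simp
  show ?thesis unfolding feval_def case_prod_unfold Im_sum
    by (intro sum.cong refl) (simp add: * del: of_real_power)
qed

lemma feval_cnj: "feval d (\<lambda>m. cnj (p m)) (of_real x) (of_real y) (of_real z) =
    cnj (feval d p (of_real x) (of_real y) (of_real z))"
  unfolding feval_def case_prod_unfold by simp

lemma feval_complexify: "feval d (complexify p) (of_real x) (of_real y) (of_real z) = of_real (feval d p x y z)"
  unfolding feval_def case_prod_unfold complexify_def by simp

definition total_degree :: "nat \<times> nat \<times> nat \<Rightarrow> nat" where
  "total_degree = (\<lambda>(i,j,k). i + j + k)"

definition hom_part :: "nat \<Rightarrow> 'a::zero poly3 \<Rightarrow> 'a poly3" where
  "hom_part d p = (\<lambda>m. if total_degree m = d then p m else 0)"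

lemma is_form_hom_part: "is_form d (hom_part d p)"
  by (auto simp: is_form_def hom_part_def total_degree_def)

text \<open>By \<open>sel\<close> a single pair of homogeneous parts contributes in degree
  \<open>a + b\<close>, as happens for the two top or the two bottom parts. Their product is then
  that component of \<open>pmul g h\<close>, and it is nonzero because forms have no zero
  divisors.\<close>

lemma extreme_degrees_add:
  fixes g h :: "'a::real_field poly3"
  assumes f: "is_form n (pmul g h)"
    and sel: "\<And>m m'. g m \<noteq> 0 \<Longrightarrow> h m' \<noteq> 0 \<Longrightarrow> total_degree m + total_degree m' = a + b \<Longrightarrow>
               total_degree m = a \<and> total_degree m' = b"
    and ne: "hom_part a g \<noteq> (\<lambda>_. 0)" "hom_part b h \<noteq> (\<lambda>_. 0)"
  shows "a + b = n"
proof (rule ccontr)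
  assume "a + b \<noteq> n"
  note fa = is_form_hom_part[of a g] and fb = is_form_hom_part[of b h]
  have "pmul (hom_part a g) (hom_part b h) (i,j,k) = 0" for i j k
  proof (cases "i + j + k = a + b")
    case True
    have "pmul (hom_part a g) (hom_part b h) (i,j,k) = pmul g h (i,j,k)"
      unfolding pmul_def prod.case
    proof (rule sum.cong)
      fix m assume "m \<in> {..i} \<times> {..j} \<times> {..k}"
      then obtain r s t where m: "m = (r,s,t)" "r \<le> i" "s \<le> j" "t \<le> k" by (cases m) auto
      have "total_degree (r,s,t) + total_degree (i - r, j - s, k - t) = a + b"
        using m True by (simp add: total_degree_def)
      then show "(case m of (i1,j1,k1) \<Rightarrow> hom_part a g (i1,j1,k1) * hom_part b h (i - i1, j - j1, k - k1)) =
        (case m of (i1,j1,k1) \<Rightarrow> g (i1,j1,k1) * h (i - i1, j - j1, k - k1))"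
        unfolding m prod.case hom_part_def
        using sel[of "(r,s,t)" "(i - r, j - s, k - t)"] by auto
    qed simp
    also have "\<dots> = 0" using f True \<open>a + b \<noteq> n\<close> unfolding is_form_def by metis
    finally show ?thesis .
  next
    case False
    then show ?thesis using is_form_pmul[OF fa fb] unfolding is_form_def by metis
  qed
  then have "pmul (hom_part a g) (hom_part b h) = (\<lambda>_. 0)" by (auto simp: fun_eq_iff)
  then have "feval a (hom_part a g) x y z * feval b (hom_part b h) x y z = 0" for x y z
    using feval_pmul[OF fa fb, of x y z] by simp
  then show False using forms_nonzero_point[OF fa ne(1) fb ne(2)] by (metis mult_eq_0_iff)
qed

text \<open>The top degrees of the factors add up to \<open>n\<close>, and so do the bottom degrees;
  hence top and bottom coincide in each factor.\<close>

lemma factors_of_form: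
  fixes g h :: "'a::real_field poly3"
  assumes fin: "finite_support g" "finite_support h" and f: "is_form n (pmul g h)" and ne: "pmul g h \<noteq> (\<lambda>_. 0)"
  obtains a b where "a + b = n" "is_form a g" "is_form b h"
proof -
  define Sg Sh where "Sg = total_degree ` {m. g m \<noteq> 0}" and "Sh = total_degree ` {m. h m \<noteq> 0}"
  have finS: "finite Sg" "finite Sh" using fin by (auto simp: Sg_def Sh_def finite_support_def)
  have "g \<noteq> (\<lambda>_. 0)" "h \<noteq> (\<lambda>_. 0)" using ne by (auto simp: pmul_def)
  then have neS: "Sg \<noteq> {}" "Sh \<noteq> {}" by (auto simp: Sg_def Sh_def)
  have hp: "a \<in> Sg \<Longrightarrow> hom_part a g \<noteq> (\<lambda>_. 0)" "a \<in> Sh \<Longrightarrow> hom_part a h \<noteq> (\<lambda>_. 0)" for a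
    unfolding Sg_def Sh_def hom_part_def by (auto simp: fun_eq_iff)
  have inS: "g m \<noteq> 0 \<Longrightarrow> total_degree m \<in> Sg" "h m \<noteq> 0 \<Longrightarrow> total_degree m \<in> Sh" for m
    by (auto simp: Sg_def Sh_def)
  have bounds: "d \<in> Sg \<Longrightarrow> Min Sg \<le> d \<and> d \<le> Max Sg" "d \<in> Sh \<Longrightarrow> Min Sh \<le> d \<and> d \<le> Max Sh" for d
    using finS by auto
  have 1: "Max Sg + Max Sh = n"
  proof (rule extreme_degrees_add[OF f])
    fix m m' assume "g m \<noteq> 0" "h m' \<noteq> 0" "total_degree m + total_degree m' = Max Sg + Max Sh"
    then show "total_degree m = Max Sg \<and> total_degree m' = Max Sh"
      using bounds(1)[OF inS(1)[of m]] bounds(2)[OF inS(2)[of m']] by linarith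
  qed (use hp Max_in finS neS in blast)+
  have 2: "Min Sg + Min Sh = n"
  proof (rule extreme_degrees_add[OF f])
    fix m m' assume "g m \<noteq> 0" "h m' \<noteq> 0" "total_degree m + total_degree m' = Min Sg + Min Sh"
    then show "total_degree m = Min Sg \<and> total_degree m' = Min Sh"
      using bounds(1)[OF inS(1)[of m]] bounds(2)[OF inS(2)[of m']] by linarith
  qed (use hp Min_in finS neS in blast)+
  have "Min Sg \<le> Max Sg" "Min Sh \<le> Max Sh" using finS neS by auto
  with 1 2 have "Min Sg = Max Sg" "Min Sh = Max Sh" by auto
  then have "g m \<noteq> 0 \<Longrightarrow> total_degree m = Max Sg" "h m \<noteq> 0 \<Longrightarrow> total_degree m = Max Sh" for m
    using bounds inS by (metis antisym)+
  then have "is_form (Max Sg) g" "is_form (Max Sh) h"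
    unfolding is_form_def total_degree_def by fastforce+
  with 1 that show ?thesis by blast
qed

section \<open>A family of symmetric sextics\<close>

text \<open>\<open>a\<close> is a root of the cubic with roots \<open>u\<close>, \<open>v\<close>,
  \<open>w\<close>; the other two values are then fixed by their sum and product.\<close>

lemma same_symmetric_functions_perm:
  fixes a b c u v w :: "'a::idom"
  assumes 1: "a + b + c = u + v + w" and 2: "a * b + b * c + c * a = u * v + v * w + w * u"
    and 3: "a * b * c = u * v * w"
  shows "(a,b,c) \<in> {(u,v,w),(u,w,v),(v,u,w),(v,w,u),(w,u,v),(w,v,u)}"
proof -
  have pair: "(y = p \<and> z = q) \<or> (y = q \<and> z = p)" if "y + z = p + q" "y * z = p * q" for y z p q :: 'a
  proof -
    have z: "z = p + q - y" using that(1) by (simp add: algebra_simps)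
    have "(y - p) * (y - q) = y * y - y * (p + q) + p * q" by (simp add: algebra_simps)
    also have "\<dots> = y * y - y * (y + z) + y * z" using that by simp
    also have "\<dots> = 0" by (simp add: algebra_simps)
    finally have "y = p \<or> y = q" by auto
    with z show ?thesis by auto
  qed
  have "(a - u) * (a - v) * (a - w) = a ^ 3 - (u + v + w) * a\<^sup>2 + (u * v + v * w + w * u) * a - u * v * w"
    by (simp add: algebra_simps power2_eq_square power3_eq_cube)
  also have "\<dots> = a ^ 3 - (a + b + c) * a\<^sup>2 + (a * b + b * c + c * a) * a - a * b * c"
    using assms by simp
  also have "\<dots> = 0" by (simp add: algebra_simps power2_eq_square power3_eq_cube)
  finally consider "a = u" | "a = v" | "a = w" by auto
  then show ?thesis
  proof cases
    case 1
    have s: "b + c = v + w" using 1 assms(1) by (simp add: algebra_simps)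
    have "b * c = (a * b + b * c + c * a) - a * (b + c)" by (simp add: algebra_simps)
    also have "\<dots> = (u * v + v * w + w * u) - a * (v + w)" by (simp only: assms(2) s)
    also have "\<dots> = v * w" unfolding 1 by (simp add: algebra_simps)
    finally have "b * c = v * w" .
    from pair[OF s this] 1 show ?thesis by auto
  next
    case 2
    have s: "b + c = u + w" using 2 assms(1) by (simp add: algebra_simps)
    have "b * c = (a * b + b * c + c * a) - a * (b + c)" by (simp add: algebra_simps)
    also have "\<dots> = (u * v + v * w + w * u) - a * (u + w)" by (simp only: assms(2) s)
    also have "\<dots> = u * w" unfolding 2 by (simp add: algebra_simps)
    finally have "b * c = u * w" .
    from pair[OF s this] 2 show ?thesis by auto
  next
    case 3
    have s: "b + c = u + v" using 3 assms(1) by (simp add: algebra_simps)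
    have "b * c = (a * b + b * c + c * a) - a * (b + c)" by (simp add: algebra_simps)
    also have "\<dots> = (u * v + v * w + w * u) - a * (u + v)" by (simp only: assms(2) s)
    also have "\<dots> = u * v" unfolding 3 by (simp add: algebra_simps)
    finally have "b * c = u * v" .
    from pair[OF s this] 3 show ?thesis by auto
  qed
qed

text \<open>One third of the second elementary symmetric function of the coordinates minus their
  mean, written through differences so that no mean occurs. Likewise each factor of
  \<open>sym3\<close> is three times a centred coordinate.\<close>

definition sym2 :: "'a::field \<Rightarrow> 'a \<Rightarrow> 'a \<Rightarrow> 'a" where
  "sym2 a b c = - ((a - b)\<^sup>2 + (b - c)\<^sup>2 + (c - a)\<^sup>2) / 18"

definition sym3 :: "'a::field \<Rightarrow> 'a \<Rightarrow> 'a \<Rightarrow> 'a" where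
  "sym3 a b c = (2 * a - b - c) * (2 * b - c - a) * (2 * c - a - b) / 27"

lemma sym2_centered:
  fixes m z1 z2 z3 :: "'a::field_char_0"
  assumes "z1 + z2 + z3 = 0"
  shows "sym2 (m + z1) (m + z2) (m + z3) = (z1 * z2 + z2 * z3 + z3 * z1) / 3"
proof -
  have z3: "z3 = - z1 - z2" using assms by (simp add: eq_neg_iff_add_eq_0 add.commute algebra_simps)
  show ?thesis unfolding z3 sym2_def by (simp add: field_simps power2_eq_square)
qed

lemma sym3_centered:
  fixes m z1 z2 z3 :: "'a::field_char_0"
  assumes "z1 + z2 + z3 = 0"
  shows "sym3 (m + z1) (m + z2) (m + z3) = z1 * z2 * z3"
proof -
  have z3: "z3 = - z1 - z2" using assms by (simp add: eq_neg_iff_add_eq_0 add.commute algebra_simps)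
  have "2 * (m + z1) - (m + z2) - (m + z3) = 3 * z1" "2 * (m + z2) - (m + z3) - (m + z1) = 3 * z2"
      "2 * (m + z3) - (m + z1) - (m + z2) = 3 * z3"
    unfolding z3 by (simp_all add: algebra_simps)
  then show ?thesis unfolding sym3_def by (simp only:) simp
qed

text \<open>Generic in the field, so that the real form and its values on the complex
  parametrisation share one expression. \<open>A\<close> is normalised to \<open>1\<close> on the
  chart of mean \<open>\<mu>\<close>.\<close>

definition sextic :: "'a::field_char_0 \<Rightarrow> 'a \<Rightarrow> 'a \<Rightarrow> 'a \<Rightarrow> 'a \<Rightarrow> 'a \<Rightarrow> 'a \<Rightarrow> 'a" where
  "sextic K e D \<mu> a b c = (let A = (a + b + c) / (3 * \<mu>); x = sym2 a b c;
     G = (K - 1) * e * sym3 a b c - (e\<^sup>2 - K) * x * A; H = D * x + e * A\<^sup>2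
   in G\<^sup>2 - A * G * H - e * x * H\<^sup>2)"

lemma form_fun_sextic:
  fixes K e D \<mu> :: "'a::field_char_0"
  shows "form_fun 6 (sextic K e D \<mu>)"
proof -
  note c = form_fun_coords
  have A: "form_fun 1 (\<lambda>a b c. (1 / (3 * \<mu>)) * ((a + b) + c))"
    by (intro form_fun_cmult form_fun_add c)
  have x: "form_fun (1 + 1) (\<lambda>a b c :: 'a. (- 1 / 18) * (((a + (-1) * b) * (a + (-1) * b) + (b + (-1) * c) * (b + (-1) * c)) +
      (c + (-1) * a) * (c + (-1) * a)))"
    by (intro form_fun_cmult form_fun_add form_fun_mult c)
  have x: "form_fun 2 (sym2 :: 'a \<Rightarrow> 'a \<Rightarrow> 'a \<Rightarrow> 'a)"
  proof -
    have "(\<lambda>a b c. (- 1 / 18) * (((a + (-1) * b) * (a + (-1) * b) + (b + (-1) * c) * (b + (-1) * c)) +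
      (c + (-1) * a) * (c + (-1) * a))) = (sym2 :: 'a \<Rightarrow> 'a \<Rightarrow> 'a \<Rightarrow> 'a)"
      by (simp add: sym2_def fun_eq_iff power2_eq_square field_simps)
    from x[unfolded this] show ?thesis by (simp add: numeral_2_eq_2)
  qed
  have q: "form_fun (1 + 1 + 1) (\<lambda>a b c :: 'a. (1 / 27) * (((2 * a + (-1) * b + (-1) * c) * (2 * b + (-1) * c + (-1) * a)) *
      (2 * c + (-1) * a + (-1) * b)))"
    by (intro form_fun_cmult form_fun_add form_fun_mult c)
  have q: "form_fun 3 (sym3 :: 'a \<Rightarrow> 'a \<Rightarrow> 'a \<Rightarrow> 'a)"
  proof -
    have "(\<lambda>a b c. (1 / 27) * (((2 * a + (-1) * b + (-1) * c) * (2 * b + (-1) * c + (-1) * a)) *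
      (2 * c + (-1) * a + (-1) * b))) = (sym3 :: 'a \<Rightarrow> 'a \<Rightarrow> 'a \<Rightarrow> 'a)"
      by (simp add: sym3_def fun_eq_iff)
    from q[unfolded this] show ?thesis by (simp add: numeral_3_eq_3)
  qed
  define A' where "A' = (\<lambda>a b c. (1 / (3 * \<mu>)) * ((a + b) + c))"
  note A = A[folded A'_def]
  have G: "form_fun (1 + 2) (\<lambda>a b c. A' a b c * ((- (e\<^sup>2 - K)) * sym2 a b c))"
    by (intro form_fun_mult form_fun_cmult A x)
  have G: "form_fun 3 (\<lambda>a b c. ((K - 1) * e) * sym3 a b c + A' a b c * ((- (e\<^sup>2 - K)) * sym2 a b c))"
    by (intro form_fun_add form_fun_cmult q) (use G in \<open>simp add: numeral_3_eq_3\<close>)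
  have H: "form_fun (1 + 1) (\<lambda>a b c. A' a b c * A' a b c)" by (intro form_fun_mult A)
  have H: "form_fun 2 (\<lambda>a b c. D * sym2 a b c + e * (A' a b c * A' a b c))"
    by (intro form_fun_add form_fun_cmult x) (use H in \<open>simp add: numeral_2_eq_2\<close>)
  define G' where "G' = (\<lambda>a b c. ((K - 1) * e) * sym3 a b c + A' a b c * ((- (e\<^sup>2 - K)) * sym2 a b c))"
  define H' where "H' = (\<lambda>a b c. D * sym2 a b c + e * (A' a b c * A' a b c))"
  note G = G[folded G'_def] and H = H[folded H'_def]
  have 1: "form_fun (3 + 3) (\<lambda>a b c. G' a b c * G' a b c)" by (intro form_fun_mult G)
  have 2: "form_fun (1 + 3 + 2) (\<lambda>a b c. A' a b c * G' a b c * H' a b c)" by (intro form_fun_mult G A H)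
  have 3: "form_fun (2 + 2 + 2) (\<lambda>a b c. sym2 a b c * H' a b c * H' a b c)" by (intro form_fun_mult H x)
  have "form_fun 6 (\<lambda>a b c. G' a b c * G' a b c + (-1) * (A' a b c * G' a b c * H' a b c) +
      (- e) * (sym2 a b c * H' a b c * H' a b c))"
    by (intro form_fun_add form_fun_cmult) (use 1 2 3 in simp_all)
  moreover have "(\<lambda>a b c. G' a b c * G' a b c + (-1) * (A' a b c * G' a b c * H' a b c) +
      (- e) * (sym2 a b c * H' a b c * H' a b c)) = sextic K e D \<mu>"
  proof -
    have "(a + b + c) / (3 * \<mu>) = A' a b c" for a b c by (simp add: A'_def)
    moreover have "(K - 1) * e * sym3 a b c - (e\<^sup>2 - K) * sym2 a b c * A' a b c = G' a b c"
        "D * sym2 a b c + e * (A' a b c)\<^sup>2 = H' a b c" for a b c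
      by (simp_all add: G'_def H'_def power2_eq_square algebra_simps)
    ultimately show ?thesis by (simp add: fun_eq_iff sextic_def power2_eq_square Let_def mult.assoc)
  qed
  ultimately show ?thesis by simp
qed

text \<open>In the chart where the mean of the coordinates is \<open>\<mu>\<close>, the nodes have centred coordinates
  \<open>(0,0,0)\<close>, \<open>(2t,-t,-t)\<close> and \<open>(\<zeta>1,\<zeta>2,\<zeta>3)\<close> up to permutation. In terms of the conic of the introduction,
  \<open>e\<close> and \<open>K\<close> are a reparametrisation of the shape of the cubic polynomial \<open>C\<close>: up to scaling,
  \<open>C y = y\<^sup>2 + k y\<close> plus a linear function of \<open>y\<^sup>3 + 3 y\<close>, and \<open>K = k\<^sup>2 + 1\<close>.\<close>

locale acnodal_sextic =
  fixes K e \<mu> \<zeta>1 \<zeta>2 \<zeta>3 D t :: real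
  assumes e1: "1 < e" and e3: "e < 3" and eK: "e < K" and K3: "K < 3 * e"
    and K8: "(1 + e)\<^sup>2 < 8 * (K - 1)" and mu: "\<mu> \<noteq> 0"
    and D_def: "D = K - e * (K - 3) + e\<^sup>2" and t_def: "t = 1 / (1 + e)"
    and zsum: "\<zeta>1 + \<zeta>2 + \<zeta>3 = 0"
    and ze2: "\<zeta>1 * \<zeta>2 + \<zeta>2 * \<zeta>3 + \<zeta>3 * \<zeta>1 = - 3 * e / D"
    and ze3: "\<zeta>1 * \<zeta>2 * \<zeta>3 = - (e\<^sup>2 - K) / ((K - 1) * D)"
    and zdist: "\<zeta>1 \<noteq> \<zeta>2" "\<zeta>2 \<noteq> \<zeta>3" "\<zeta>1 \<noteq> \<zeta>3"
begin

section \<open>Nonnegativity and the real zeros\<close>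

lemma K1: "1 < K" using e1 eK by simp

lemma D_pos: "0 < D"
proof -
  have "D = (3 - e) * (2 * e) + (3 * e - K) * (e - 1)"
    by (simp add: D_def algebra_simps power2_eq_square)
  moreover have "0 < (3 - e) * (2 * e)" "0 < (3 * e - K) * (e - 1)"
    using e1 e3 K3 by (intro mult_pos_pos; simp)+
  ultimately show ?thesis by linarith
qed

lemma t_pos: "0 < t" and t_eq: "t * (1 + e) = 1" and t_sq: "e * t\<^sup>2 = t - t\<^sup>2" and t_half: "2 * t < 1"
proof -
  show "0 < t" and *: "t * (1 + e) = 1" and "2 * t < 1" using e1 by (simp_all add: t_def)
  have "e * t\<^sup>2 = t * (t * (1 + e)) - t\<^sup>2" by (simp add: algebra_simps power2_eq_square)
  then show "e * t\<^sup>2 = t - t\<^sup>2" unfolding * by simp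
qed

definition GG :: "real \<Rightarrow> real \<Rightarrow> real \<Rightarrow> real" where
  "GG A x q = (K - 1) * e * q - (e\<^sup>2 - K) * x * A"

definition HH :: "real \<Rightarrow> real \<Rightarrow> real" where
  "HH A x = D * x + e * A\<^sup>2"

definition FF :: "real \<Rightarrow> real \<Rightarrow> real \<Rightarrow> real" where
  "FF A x q = (GG A x q)\<^sup>2 - A * GG A x q * HH A x - e * x * (HH A x)\<^sup>2"

definition f :: "real \<Rightarrow> real \<Rightarrow> real \<Rightarrow> real" where
  "f a b c = FF ((a + b + c) / (3 * \<mu>)) (sym2 a b c) (sym3 a b c)"

lemma f_swap: "f a b c = f b a c" "f a b c = f a c b"
  unfolding f_def sym2_def sym3_def by (simp_all add: algebra_simps power2_commute)

lemma f_chart: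
  assumes "z1 + z2 + z3 = 0"
  shows "f (\<mu> + z1) (\<mu> + z2) (\<mu> + z3) = FF 1 ((z1 * z2 + z2 * z3 + z3 * z1) / 3) (z1 * z2 * z3)"
proof -
  have "\<mu> + z1 + (\<mu> + z2) + (\<mu> + z3) = 3 * \<mu>" using assms by simp
  then show ?thesis unfolding f_def sym2_centered[OF assms] sym3_centered[OF assms] using mu by simp
qed

lemma f_eq_sextic: "f = sextic K e D \<mu>"
  by (simp add: fun_eq_iff f_def FF_def GG_def HH_def sextic_def Let_def)

lemma form_fun_f: "form_fun 6 f"
  unfolding f_eq_sextic by (rule form_fun_sextic)

text \<open>The arguments belong to the centred point \<open>(2 T, - T, - T)\<close> of a mirror
  line. Of the six intersections of this line with the sextic, \<open>T = 0\<close> and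
  \<open>T = t\<close> count twice; the last factor carries the other two. The auxiliary identities
  compare coefficients in \<open>T\<close>.\<close>

lemma FF_mirror:
  "FF 1 (- T\<^sup>2) (2 * T ^ 3) = T\<^sup>2 * (T * (1 + e) - 1)\<^sup>2 * (e * (K + 2 * (K + e) * T + (K\<^sup>2 - 2 * e * (K - 2) + e\<^sup>2) * T\<^sup>2))"
proof -
  define g0 g1 q1 q2 where "g0 = e\<^sup>2 - K" and "g1 = 2 * (K - 1) * e" and "q1 = 2 * (K + e)"
    and "q2 = K\<^sup>2 - 2 * e * (K - 2) + e\<^sup>2"
  note defs = g0_def g1_def q1_def q2_def D_def power2_eq_square
  have c0: "e * e\<^sup>2 - g0 * e = e * K" unfolding defs by (simp add: algebra_simps)
  have c1: "- g1 * e = e * (q1 - 2 * (1 + e) * K)" unfolding defs by (simp add: algebra_simps)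
  have c2: "g0\<^sup>2 + g0 * D - 2 * e\<^sup>2 * D = e * (q2 - 2 * (1 + e) * q1 + (1 + e)\<^sup>2 * K)"
    unfolding defs by (simp add: algebra_simps)
  have c3: "2 * g0 * g1 + g1 * D = e * ((1 + e)\<^sup>2 * q1 - 2 * (1 + e) * q2)" unfolding defs by (simp add: algebra_simps)
  have c4: "g1\<^sup>2 + e * D\<^sup>2 = e * ((1 + e)\<^sup>2 * q2)" unfolding defs by (simp add: algebra_simps)
  have G: "GG 1 (- T\<^sup>2) (2 * T ^ 3) = T\<^sup>2 * (g1 * T + g0)" unfolding GG_def g0_def g1_def
    by (simp add: algebra_simps power2_eq_square power3_eq_cube)
  have H: "HH 1 (- T\<^sup>2) = e - D * T\<^sup>2" by (simp add: HH_def)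
  have "FF 1 (- T\<^sup>2) (2 * T ^ 3) = T\<^sup>2 * ((e * e\<^sup>2 - g0 * e) + (- g1 * e) * T + (g0\<^sup>2 + g0 * D - 2 * e\<^sup>2 * D) * T\<^sup>2
      + (2 * g0 * g1 + g1 * D) * T ^ 3 + (g1\<^sup>2 + e * D\<^sup>2) * T ^ 4)"
    unfolding FF_def G H by (simp add: algebra_simps eval_nat_numeral)
  also have "\<dots> = T\<^sup>2 * (T * (1 + e) - 1)\<^sup>2 * (e * (K + q1 * T + q2 * T\<^sup>2))"
    unfolding c0 c1 c2 c3 c4 by (simp add: algebra_simps eval_nat_numeral)
  finally show ?thesis unfolding q1_def q2_def .
qed

text \<open>Multiplied by \<open>K\<close>, the quadratic is a square plus \<open>K - 1\<close>
  times a square; \<open>e < K\<close> keeps the two from vanishing together.\<close>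

lemma mirror_quadratic_pos: "0 < K + 2 * (K + e) * T + (K\<^sup>2 - 2 * e * (K - 2) + e\<^sup>2) * T\<^sup>2"
    (is "0 < ?q")
proof -
  have "K * ?q = (K + (K + e) * T)\<^sup>2 + (K - 1) * ((K - e) * T)\<^sup>2"
    by (simp add: algebra_simps power2_eq_square)
  moreover have "0 < (K + (K + e) * T)\<^sup>2 + (K - 1) * ((K - e) * T)\<^sup>2"
  proof (cases "T = 0")
    case True then show ?thesis using K1 by simp
  next
    case False
    then have "0 < (K - 1) * ((K - e) * T)\<^sup>2" using K1 eK by (intro mult_pos_pos) auto
    then show ?thesis by (rule add_nonneg_pos[rotated]) simp
  qed
  ultimately have "0 < K * ?q" by (simp only:)
  moreover have "0 < K" using K1 by simp
  ultimately show ?thesis by (rule zero_less_mult_pos)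
qed

text \<open>As a quadratic polynomial in \<open>G\<close>, the sextic has its vertex at \<open>H / 2\<close>; outside the region where the
  quadratic form is definite, the vertex lies beyond the largest value of \<open>G\<close>, attained on a mirror line.\<close>

lemma vertex_right_of_mirror:
  assumes T: "0 \<le> T" "4 * e * T\<^sup>2 \<le> 1"
  shows "2 * GG 1 (- T\<^sup>2) (2 * T ^ 3) < HH 1 (- T\<^sup>2)"
proof -
  \<comment> \<open>In terms of \<open>\<epsilon>\<close> the range of \<open>T\<close> is
    \<open>2 \<epsilon> T \<le> 1\<close>. The terms subtracted below increase with
    \<open>T\<close>, so the right endpoint decides; the bound obtained there factors through
    \<open>(\<epsilon> - 1)\<^sup>2\<close> and is positive because \<open>e > 1\<close>.\<close>
  define \<epsilon> where "\<epsilon> = sqrt e"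
  have eps: "1 < \<epsilon>" "\<epsilon>\<^sup>2 = e" using e1 by (auto simp: \<epsilon>_def)
  have "(2 * \<epsilon> * T)\<^sup>2 \<le> 1\<^sup>2" using T(2) by (simp add: power_mult_distrib eps)
  then have T1: "2 * \<epsilon> * T \<le> 1" by (rule power2_le_imp_le) simp
  have c2: "0 < (e + 1) * (3 * e - K)" using e1 K3 by simp
  have "4 * e * (HH 1 (- T\<^sup>2) - 2 * GG 1 (- T\<^sup>2) (2 * T ^ 3)) =
      4 * e\<^sup>2 - (e + 1) * (3 * e - K) * (4 * e * T\<^sup>2) - 4 * (K - 1) * e * T * (4 * e * T\<^sup>2)"
    unfolding HH_def GG_def unfolding D_def by (simp add: algebra_simps power2_eq_square power3_eq_cube)
  moreover have "(e + 1) * (3 * e - K) * (4 * e * T\<^sup>2) \<le> (e + 1) * (3 * e - K) * 1"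
    by (rule mult_left_mono) (use T c2 in auto)
  moreover have "4 * (K - 1) * e * T * (4 * e * T\<^sup>2) \<le> 4 * (K - 1) * e * T * 1"
    by (rule mult_left_mono) (use T e1 K1 in auto)
  moreover have "4 * (K - 1) * e * T = 2 * (K - 1) * \<epsilon> * (2 * \<epsilon> * T)"
    unfolding eps(2)[symmetric] by (simp add: power2_eq_square)
  moreover have "2 * (K - 1) * \<epsilon> * (2 * \<epsilon> * T) \<le> 2 * (K - 1) * \<epsilon> * 1"
    by (rule mult_left_mono) (use T1 eps K1 in auto)
  moreover have "4 * e\<^sup>2 - (e + 1) * (3 * e - K) - 2 * (K - 1) * \<epsilon> = (\<epsilon> - 1)\<^sup>2 * (K + \<epsilon> * (\<epsilon> + 2))"
    unfolding eps(2)[symmetric] by (simp add: algebra_simps power2_eq_square)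
  moreover have "0 < (\<epsilon> - 1)\<^sup>2 * (K + \<epsilon> * (\<epsilon> + 2))"
    using eps K1 by (intro mult_pos_pos add_pos_pos) auto
  ultimately have "0 < 4 * e * (HH 1 (- T\<^sup>2) - 2 * GG 1 (- T\<^sup>2) (2 * T ^ 3))" by linarith
  then show ?thesis using e1 by (simp add: zero_less_mult_iff)
qed

text \<open>The hypothesis is the discriminant condition satisfied by the invariants of three real
  centred coordinates. Depending on the sign of the discriminant of the form in \<open>G\<close> and
  \<open>H\<close>, either the square is completed or \<open>q\<close> is raised to its mirror value
  \<open>2 T ^ 3\<close>.\<close>

lemma FF_nonneg_zero:
  assumes q: "q\<^sup>2 \<le> 4 * (- x) ^ 3"
  shows "0 \<le> FF 1 x q"
    and "FF 1 x q = 0 \<Longrightarrow> (x = - e / D \<and> q = - (e\<^sup>2 - K) / ((K - 1) * D)) \<or> (x = 0 \<and> q = 0) \<or> (x = - t\<^sup>2 \<and> q = 2 * t ^ 3)"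
proof -
  have "0 \<le> (- x) ^ 3" using q by (metis (no_types, lifting) order_trans zero_le_mult_iff zero_le_numeral zero_le_power2 not_numeral_le_zero)
  then have s: "0 \<le> - x" by (simp add: zero_le_odd_power)
  define T where "T = sqrt (- x)"
  have T: "0 \<le> T" "x = - T\<^sup>2" using s by (auto simp: T_def)
  have "q\<^sup>2 \<le> (2 * T ^ 3)\<^sup>2" using q unfolding T(2) by (simp add: power_mult_distrib flip: power_mult)
  then have qT: "q \<le> 2 * T ^ 3" by (rule power2_le_imp_le) (use T in simp)
  let ?G = "GG 1 x q" and ?H = "HH 1 x" and ?G' = "GG 1 x (2 * T ^ 3)"
  have FF: "FF 1 x q' = (GG 1 x q')\<^sup>2 - GG 1 x q' * ?H + e * T\<^sup>2 * ?H\<^sup>2" for q'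
    unfolding FF_def T(2) by simp
  have "0 \<le> FF 1 x q \<and> (FF 1 x q = 0 \<longrightarrow> (x = - e / D \<and> q = - (e\<^sup>2 - K) / ((K - 1) * D)) \<or> (x = 0 \<and> q = 0) \<or> (x = - t\<^sup>2 \<and> q = 2 * t ^ 3))"
  proof (cases "1 < 4 * e * T\<^sup>2")
    case True
    have sq: "FF 1 x q = (?G - ?H / 2)\<^sup>2 + (e * T\<^sup>2 - 1 / 4) * ?H\<^sup>2"
      unfolding FF by (simp add: algebra_simps power2_eq_square)
    have pos: "0 \<le> (e * T\<^sup>2 - 1 / 4) * ?H\<^sup>2" using True by simp
    have "x = - e / D \<and> q = - (e\<^sup>2 - K) / ((K - 1) * D)" if "FF 1 x q = 0"
    proof -
      have "(e * T\<^sup>2 - 1 / 4) * ?H\<^sup>2 = 0" "(?G - ?H / 2)\<^sup>2 = 0"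
        using that sq pos by (smt (verit) zero_le_power2)+
      then have "?H = 0" "?G = 0" using True by auto
      from \<open>?H = 0\<close> have x: "x = - e / D" using D_pos by (simp add: HH_def field_simps)
      from \<open>?G = 0\<close> have "(K - 1) * e * q = (e\<^sup>2 - K) * (- e / D)" by (simp add: GG_def x)
      then have "e * ((K - 1) * q) = e * (- (e\<^sup>2 - K) / D)" by (simp add: algebra_simps diff_divide_distrib)
      from mult_left_cancel[THEN iffD1, OF _ this] have "(K - 1) * q = - (e\<^sup>2 - K) / D" using e1 by simp
      then have "q = - (e\<^sup>2 - K) / ((K - 1) * D)" using D_pos K1 by (simp add: field_simps)
      with x show ?thesis by simp
    qed
    with sq pos show ?thesis by (smt (verit) zero_le_power2)
  next
    case False
    then have v: "2 * ?G' < ?H" using vertex_right_of_mirror[OF T(1)] by (simp add: T(2))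
    have GG': "?G' - ?G = (K - 1) * e * (2 * T ^ 3 - q)" by (simp add: GG_def algebra_simps)
    have le: "?G \<le> ?G'" using GG' qT K1 e1 by (smt (verit) mult_nonneg_nonneg)
    \<comment> \<open>Difference of two values of a monic quadratic polynomial in \<open>G\<close>.
      The factor \<open>?H - ?G - ?G'\<close> is positive because \<open>?G\<close> and
      \<open>?G'\<close> both lie to the left of the vertex \<open>?H / 2\<close>.\<close>
    have diff: "FF 1 x q = FF 1 x (2 * T ^ 3) + (?G' - ?G) * (?H - ?G - ?G')"
      unfolding FF by (simp add: algebra_simps power2_eq_square)
    have pos: "0 < ?H - ?G - ?G'" using v le by simp
    have mir: "FF 1 x (2 * T ^ 3) = T\<^sup>2 * (T * (1 + e) - 1)\<^sup>2 * (e * (K + 2 * (K + e) * T + (K\<^sup>2 - 2 * e * (K - 2) + e\<^sup>2) * T\<^sup>2))"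
      unfolding T(2) by (rule FF_mirror)
    have quad: "0 < e * (K + 2 * (K + e) * T + (K\<^sup>2 - 2 * e * (K - 2) + e\<^sup>2) * T\<^sup>2)"
      using mirror_quadratic_pos e1 by simp
    have m0: "0 \<le> FF 1 x (2 * T ^ 3)" unfolding mir using quad by simp
    have p0: "0 \<le> (?G' - ?G) * (?H - ?G - ?G')" using le pos by simp
    have "(x = 0 \<and> q = 0) \<or> (x = - t\<^sup>2 \<and> q = 2 * t ^ 3)" if "FF 1 x q = 0"
    proof -
      have "(?G' - ?G) * (?H - ?G - ?G') = 0" "FF 1 x (2 * T ^ 3) = 0" using that diff m0 p0 by linarith+
      then have "?G' - ?G = 0" using pos by simp
      then have q: "q = 2 * T ^ 3" using GG' K1 e1 by simp
      from \<open>FF 1 x (2 * T ^ 3) = 0\<close> have "T\<^sup>2 * (T * (1 + e) - 1)\<^sup>2 = 0"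
        unfolding mir using quad by (metis less_irrefl mult_eq_0_iff)
      then have "T = 0 \<or> T * (1 + e) = 1" by simp
      moreover have "T = t" if "T * (1 + e) = 1" using that e1 by (simp add: t_def field_simps)
      ultimately show ?thesis using q T(2) by auto
    qed
    then show ?thesis using diff m0 p0 by auto
  qed
  then show "0 \<le> FF 1 x q" and "FF 1 x q = 0 \<Longrightarrow> (x = - e / D \<and> q = - (e\<^sup>2 - K) / ((K - 1) * D)) \<or> (x = 0 \<and> q = 0) \<or> (x = - t\<^sup>2 \<and> q = 2 * t ^ 3)"
    by auto
qed

definition nodes :: "(real \<times> real \<times> real) set" where
  "nodes = {(\<mu>,\<mu>,\<mu>), (\<mu>+2*t,\<mu>-t,\<mu>-t), (\<mu>-t,\<mu>+2*t,\<mu>-t), (\<mu>-t,\<mu>-t,\<mu>+2*t),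
     (\<mu>+\<zeta>1,\<mu>+\<zeta>2,\<mu>+\<zeta>3), (\<mu>+\<zeta>1,\<mu>+\<zeta>3,\<mu>+\<zeta>2), (\<mu>+\<zeta>2,\<mu>+\<zeta>1,\<mu>+\<zeta>3),
     (\<mu>+\<zeta>2,\<mu>+\<zeta>3,\<mu>+\<zeta>1), (\<mu>+\<zeta>3,\<mu>+\<zeta>1,\<mu>+\<zeta>2), (\<mu>+\<zeta>3,\<mu>+\<zeta>2,\<mu>+\<zeta>1)}"

lemma card_nodes: "card nodes = 10"
  using zdist t_pos zsum unfolding nodes_def by (auto simp: card_insert_if)

lemma nodes_sum: "(a,b,c) \<in> nodes \<Longrightarrow> a + b + c = 3 * \<mu>"
  using zsum unfolding nodes_def by auto

lemma f_chart_nonneg_zero: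
  assumes z: "z1 + z2 + z3 = 0"
  shows "0 \<le> f (\<mu> + z1) (\<mu> + z2) (\<mu> + z3)"
    and "f (\<mu> + z1) (\<mu> + z2) (\<mu> + z3) = 0 \<Longrightarrow> (\<mu> + z1, \<mu> + z2, \<mu> + z3) \<in> nodes"
proof -
  define x q where "x = (z1 * z2 + z2 * z3 + z3 * z1) / 3" and "q = z1 * z2 * z3"
  have z3: "z3 = - z1 - z2" using z by simp
  \<comment> \<open>Discriminant of the cubic with roots \<open>z1\<close>, \<open>z2\<close>,
    \<open>z3\<close>.\<close>
  have "27 * (4 * (- x) ^ 3 - q\<^sup>2) = ((z1 - z2) * (z2 - z3) * (z3 - z1))\<^sup>2"
    unfolding x_def q_def z3 by (simp add: field_simps power2_eq_square power3_eq_cube)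
  then have "0 \<le> 27 * (4 * (- x) ^ 3 - q\<^sup>2)" by simp
  then have q: "q\<^sup>2 \<le> 4 * (- x) ^ 3" by simp
  have fe: "f (\<mu> + z1) (\<mu> + z2) (\<mu> + z3) = FF 1 x q" unfolding x_def q_def by (rule f_chart[OF z])
  show "0 \<le> f (\<mu> + z1) (\<mu> + z2) (\<mu> + z3)" unfolding fe by (rule FF_nonneg_zero(1)[OF q])
  assume "f (\<mu> + z1) (\<mu> + z2) (\<mu> + z3) = 0"
  then consider "x = - e / D" "q = - (e\<^sup>2 - K) / ((K - 1) * D)" | "x = 0" "q = 0" | "x = - t\<^sup>2" "q = 2 * t ^ 3"
    using FF_nonneg_zero(2)[OF q] fe by auto
  then show "(\<mu> + z1, \<mu> + z2, \<mu> + z3) \<in> nodes"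
  proof cases
    case 1
    have "(z1,z2,z3) \<in> {(\<zeta>1,\<zeta>2,\<zeta>3),(\<zeta>1,\<zeta>3,\<zeta>2),(\<zeta>2,\<zeta>1,\<zeta>3),(\<zeta>2,\<zeta>3,\<zeta>1),(\<zeta>3,\<zeta>1,\<zeta>2),(\<zeta>3,\<zeta>2,\<zeta>1)}"
      by (rule same_symmetric_functions_perm) (use z zsum ze2 ze3 1 in \<open>simp_all add: x_def q_def\<close>)
    then show ?thesis unfolding nodes_def by auto
  next
    case 2
    have "(z1,z2,z3) \<in> {(0,0,0),(0,0,0),(0,0,0),(0,0,0),(0,0,0),(0,0,0)}"
      by (rule same_symmetric_functions_perm) (use z 2 in \<open>simp_all add: x_def q_def\<close>)
    then show ?thesis unfolding nodes_def by auto
  next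
    case 3
    have "(z1,z2,z3) \<in> {(2*t,-t,-t),(2*t,-t,-t),(-t,2*t,-t),(-t,-t,2*t),(-t,2*t,-t),(-t,-t,2*t)}"
      by (rule same_symmetric_functions_perm)
         (use z 3 in \<open>simp_all add: x_def q_def power2_eq_square power3_eq_cube\<close>)
    then show ?thesis unfolding nodes_def by auto
  qed
qed

text \<open>For \<open>A = 0\<close> the mixed term drops out and \<open>H = D x\<close> with
  \<open>x < 0\<close>, which leaves a square plus a positive term. This real line without zeros is
  the main tool against squares and factors later on.\<close>

lemma f_plane_pos:
  assumes "a + b + c = 0" "(a,b,c) \<noteq> (0,0,0)"
  shows "0 < f a b c"
proof -
  have c: "c = - a - b" using assms by simp
  have "0 < (a - b)\<^sup>2 + (b - c)\<^sup>2 + (c - a)\<^sup>2"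
  proof (rule ccontr)
    assume "\<not> 0 < (a - b)\<^sup>2 + (b - c)\<^sup>2 + (c - a)\<^sup>2"
    then have "(a - b)\<^sup>2 = 0" "(b - c)\<^sup>2 = 0" by (smt (verit) zero_le_power2)+
    then show False using assms by auto
  qed
  then have "sym2 a b c < 0" by (simp add: sym2_def)
  moreover have "f a b c = ((K - 1) * e * sym3 a b c)\<^sup>2 + e * (- sym2 a b c) * (D * sym2 a b c)\<^sup>2"
    unfolding f_def assms(1) by (simp add: FF_def GG_def HH_def)
  moreover have "0 < e * (- sym2 a b c) * (D * sym2 a b c)\<^sup>2"
    using \<open>sym2 a b c < 0\<close> e1 D_pos by (intro mult_pos_pos) auto
  ultimately show ?thesis using zero_le_power2[of "(K - 1) * e * sym3 a b c"] by linarith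
qed

lemma f_nonneg_zero:
  shows "0 \<le> f a b c"
    and "f a b c = 0 \<Longrightarrow> (a,b,c) \<noteq> (0,0,0) \<Longrightarrow>
           a + b + c \<noteq> 0 \<and> (\<exists>(x,y,z)\<in>nodes. \<exists>s. s \<noteq> 0 \<and> a = s * x \<and> b = s * y \<and> c = s * z)"
proof -
  have "0 \<le> f a b c \<and> (f a b c = 0 \<longrightarrow> (\<exists>(x,y,z)\<in>nodes. \<exists>s. s \<noteq> 0 \<and> a = s * x \<and> b = s * y \<and> c = s * z))"
    if ne: "a + b + c \<noteq> 0"
  proof -
    define s where "s = (a + b + c) / (3 * \<mu>)"
    have s: "s \<noteq> 0" using ne mu by (simp add: s_def)
    have "(a + b + c) / s = 3 * \<mu>" using ne mu by (simp add: s_def)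
    then have sum: "a / s - \<mu> + (b / s - \<mu>) + (c / s - \<mu>) = 0"
      by (simp add: add_divide_distrib)
    have eq: "a = s * (\<mu> + (a / s - \<mu>))" "b = s * (\<mu> + (b / s - \<mu>))" "c = s * (\<mu> + (c / s - \<mu>))"
      using s by simp_all
    have fe: "f a b c = s ^ 6 * f (\<mu> + (a / s - \<mu>)) (\<mu> + (b / s - \<mu>)) (\<mu> + (c / s - \<mu>))"
      using form_fun_scale[OF form_fun_f, of s "\<mu> + (a / s - \<mu>)"] eq by metis
    have "0 < s ^ 6" using s by (simp add: zero_less_power_eq)
    then have "0 \<le> f a b c" unfolding fe using f_chart_nonneg_zero(1)[OF sum] by simp
    moreover have "\<exists>(x,y,z)\<in>nodes. \<exists>s. s \<noteq> 0 \<and> a = s * x \<and> b = s * y \<and> c = s * z" if "f a b c = 0"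
    proof -
      have "f (\<mu> + (a / s - \<mu>)) (\<mu> + (b / s - \<mu>)) (\<mu> + (c / s - \<mu>)) = 0" using that fe s by simp
      from f_chart_nonneg_zero(2)[OF sum this] show ?thesis using s eq by blast
    qed
    ultimately show ?thesis by blast
  qed
  moreover have "f 0 0 0 = 0" using form_fun_scale[OF form_fun_f, of 0 0 0 0] by simp
  ultimately show "0 \<le> f a b c" and "f a b c = 0 \<Longrightarrow> (a,b,c) \<noteq> (0,0,0) \<Longrightarrow>
           a + b + c \<noteq> 0 \<and> (\<exists>(x,y,z)\<in>nodes. \<exists>s. s \<noteq> 0 \<and> a = s * x \<and> b = s * y \<and> c = s * z)"
    using f_plane_pos[of a b c] by (cases "a + b + c = 0"; cases "(a,b,c) = (0,0,0)"; force)+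
qed

end

section \<open>The ten acnodes\<close>

context acnodal_sextic
begin

text \<open>The test of \<open>acnodeI\<close> as a predicate, so that coordinate swaps can carry it
  from one node of each orbit to all ten.\<close>

definition transversal_min :: "real \<Rightarrow> real \<Rightarrow> real \<Rightarrow> bool" where
  "transversal_min a b c \<longleftrightarrow> (\<forall>u v w. u + v + w = 0 \<longrightarrow>
     (\<exists>C. (\<forall>s. f (a + s * u) (b + s * v) (c + s * w) = s\<^sup>2 * C s) \<and>
        isCont C 0 \<and> ((u,v,w) \<noteq> (0,0,0) \<longrightarrow> 0 < C 0)))"

lemma transversal_min_swap:
  assumes "transversal_min a b c"
  shows "transversal_min b a c" "transversal_min a c b"
proof -
  show "transversal_min b a c" unfolding transversal_min_def
  proof (intro allI impI)
    fix u v w :: real assume "u + v + w = 0"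
    then have "v + u + w = 0" by simp
    with assms obtain C where "\<forall>s. f (a + s * v) (b + s * u) (c + s * w) = s\<^sup>2 * C s" "isCont C 0"
        "(v,u,w) \<noteq> (0,0,0) \<longrightarrow> 0 < C 0" unfolding transversal_min_def by blast
    then show "\<exists>C. (\<forall>s. f (b + s * u) (a + s * v) (c + s * w) = s\<^sup>2 * C s) \<and> isCont C 0 \<and> ((u,v,w) \<noteq> (0,0,0) \<longrightarrow> 0 < C 0)"
      by (intro exI[of _ C]) (auto simp: f_swap(1)[of "b + _"])
  qed
  show "transversal_min a c b" unfolding transversal_min_def
  proof (intro allI impI)
    fix u v w :: real assume "u + v + w = 0"
    then have "u + w + v = 0" by simp
    with assms obtain C where "\<forall>s. f (a + s * u) (b + s * w) (c + s * v) = s\<^sup>2 * C s" "isCont C 0"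
        "(u,w,v) \<noteq> (0,0,0) \<longrightarrow> 0 < C 0" unfolding transversal_min_def by blast
    then show "\<exists>C. (\<forall>s. f (a + s * u) (c + s * v) (b + s * w) = s\<^sup>2 * C s) \<and> isCont C 0 \<and> ((u,v,w) \<noteq> (0,0,0) \<longrightarrow> 0 < C 0)"
      by (intro exI[of _ C]) (auto simp: f_swap(2)[of "a + _" "c + _"])
  qed
qed

lemma sum_zero_e2_neg:
  fixes u v w :: real
  assumes "u + v + w = 0" "(u,v,w) \<noteq> (0,0,0)"
  shows "u * v + v * w + w * u < 0"
proof -
  have w: "w = - u - v" using assms by simp
  have "u * v + v * w + w * u = - ((u + v / 2)\<^sup>2 + 3 / 4 * v\<^sup>2)" unfolding w by (simp add: algebra_simps power2_eq_square)
  moreover have "0 < (u + v / 2)\<^sup>2 + 3 / 4 * v\<^sup>2"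
  proof (cases "v = 0")
    case True then show ?thesis using assms by auto
  next
    case False then show ?thesis by (intro add_nonneg_pos) auto
  qed
  ultimately show ?thesis by simp
qed

text \<open>Near the centre \<open>x\<close> scales with \<open>s\<^sup>2\<close> and
  \<open>q\<close> with \<open>s ^ 3\<close>, so the leading coefficient is \<open>- e K x\<close>,
  where \<open>x < 0\<close> for a nonzero centred direction.\<close>

lemma transversal_min_centre: "transversal_min \<mu> \<mu> \<mu>"
  unfolding transversal_min_def
proof (intro allI impI)
  fix u v w :: real assume uvw: "u + v + w = 0"
  define x q where "x = (u * v + v * w + w * u) / 3" and "q = u * v * w"
  define g h where "g = (\<lambda>s. (K - 1) * e * s * q - (e\<^sup>2 - K) * x)" and "h = (\<lambda>s. D * s\<^sup>2 * x + e)"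
  define C where "C = (\<lambda>s. s\<^sup>2 * (g s)\<^sup>2 - g s * h s - e * x * (h s)\<^sup>2)"
  have "f (\<mu> + s * u) (\<mu> + s * v) (\<mu> + s * w) = s\<^sup>2 * C s" for s
  proof -
    have sum: "s * u + s * v + s * w = 0" using uvw by (simp flip: distrib_left)
    have x': "(s * u * (s * v) + s * v * (s * w) + s * w * (s * u)) / 3 = s\<^sup>2 * x"
      by (simp add: x_def power2_eq_square algebra_simps)
    have q': "s * u * (s * v) * (s * w) = s ^ 3 * q" by (simp add: q_def power3_eq_cube)
    have "GG 1 (s\<^sup>2 * x) (s ^ 3 * q) = s\<^sup>2 * g s" "HH 1 (s\<^sup>2 * x) = h s"
      by (simp_all add: GG_def HH_def g_def h_def algebra_simps power2_eq_square power3_eq_cube)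
    then show ?thesis unfolding f_chart[OF sum] x' q' FF_def C_def
      by (simp add: algebra_simps power2_eq_square)
  qed
  moreover have "isCont C 0" unfolding C_def g_def h_def by (intro continuous_intros)
  moreover have "0 < C 0" if "(u,v,w) \<noteq> (0,0,0)"
  proof -
    have "C 0 = e * K * (- x)" unfolding C_def g_def h_def by (simp add: algebra_simps power2_eq_square)
    moreover have "0 < - x" using sum_zero_e2_neg[OF uvw that] by (simp add: x_def)
    ultimately show ?thesis using e1 K1 by (simp only:) (intro mult_pos_pos; simp)
  qed
  ultimately show "\<exists>C. (\<forall>s. f (\<mu> + s * u) (\<mu> + s * v) (\<mu> + s * w) = s\<^sup>2 * C s) \<and> isCont C 0 \<and> ((u,v,w) \<noteq> (0,0,0) \<longrightarrow> 0 < C 0)"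
    by blast
qed

lemma GG_HH_node: "GG 1 (- e / D) (- (e\<^sup>2 - K) / ((K - 1) * D)) = 0" "HH 1 (- e / D) = 0"
  using D_pos K1 by (simp_all add: GG_def HH_def field_simps)

text \<open>At the generic nodes \<open>x = - e / D\<close>, so this says that the quadratic form in
  \<open>G\<close> and \<open>H\<close> is definite there.\<close>

lemma node_definite: "1 < 4 * e * (e / D)"
proof -
  have "4 * e\<^sup>2 - D = (e - 1) * (3 * e + K)" by (simp add: D_def algebra_simps power2_eq_square)
  also have "0 < \<dots>" using e1 K1 by simp
  finally have "D < 4 * e * e" by (simp add: power2_eq_square)
  then have "1 < 4 * e * e / D" using D_pos by simp
  then show ?thesis by simp
qed

text \<open>\<open>G\<close> and \<open>H\<close> vanish at the node, so the second-order term of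
  \<open>f\<close> is the definite quadratic form in their linear parts. These determine the
  direction because the three \<open>\<zeta>\<close> are distinct.\<close>

lemma transversal_min_generic: "transversal_min (\<mu> + \<zeta>1) (\<mu> + \<zeta>2) (\<mu> + \<zeta>3)"
  unfolding transversal_min_def
proof (intro allI impI)
  fix u v w :: real assume uvw: "u + v + w = 0"
  define x1 x2 where "x1 = (u * (\<zeta>2 + \<zeta>3) + v * (\<zeta>1 + \<zeta>3) + w * (\<zeta>1 + \<zeta>2)) / 3"
    and "x2 = (u * v + v * w + w * u) / 3"
  define q1 q2 q3 where "q1 = u * \<zeta>2 * \<zeta>3 + v * \<zeta>1 * \<zeta>3 + w * \<zeta>1 * \<zeta>2"
    and "q2 = u * v * \<zeta>3 + v * w * \<zeta>1 + w * u * \<zeta>2" and "q3 = u * v * w"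
  define g h where "g = (\<lambda>s. GG 1 (x1 + s * x2) (q1 + s * q2 + s\<^sup>2 * q3))" and "h = (\<lambda>s. D * (x1 + s * x2))"
  define C where "C = (\<lambda>s. (g s)\<^sup>2 - g s * h s - e * (- e / D + s * (x1 + s * x2)) * (h s)\<^sup>2)"
  have "f (\<mu> + \<zeta>1 + s * u) (\<mu> + \<zeta>2 + s * v) (\<mu> + \<zeta>3 + s * w) = s\<^sup>2 * C s" for s
  proof -
    have "s * (u + v + w) = 0" using uvw by simp
    then have sum: "(\<zeta>1 + s * u) + (\<zeta>2 + s * v) + (\<zeta>3 + s * w) = 0" using zsum by (simp add: algebra_simps)
    have "((\<zeta>1 + s * u) * (\<zeta>2 + s * v) + (\<zeta>2 + s * v) * (\<zeta>3 + s * w) + (\<zeta>3 + s * w) * (\<zeta>1 + s * u)) / 3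
        = (\<zeta>1 * \<zeta>2 + \<zeta>2 * \<zeta>3 + \<zeta>3 * \<zeta>1) / 3 + s * (x1 + s * x2)"
      by (simp add: x1_def x2_def algebra_simps add_divide_distrib)
    also have "\<dots> = - e / D + s * (x1 + s * x2)" unfolding ze2 by simp
    finally have x': "((\<zeta>1 + s * u) * (\<zeta>2 + s * v) + (\<zeta>2 + s * v) * (\<zeta>3 + s * w) + (\<zeta>3 + s * w) * (\<zeta>1 + s * u)) / 3
        = - e / D + s * (x1 + s * x2)" .
    have "(\<zeta>1 + s * u) * (\<zeta>2 + s * v) * (\<zeta>3 + s * w) = \<zeta>1 * \<zeta>2 * \<zeta>3 + s * (q1 + s * q2 + s\<^sup>2 * q3)"
      by (simp add: q1_def q2_def q3_def algebra_simps power2_eq_square)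
    then have q': "(\<zeta>1 + s * u) * (\<zeta>2 + s * v) * (\<zeta>3 + s * w) = - (e\<^sup>2 - K) / ((K - 1) * D) + s * (q1 + s * q2 + s\<^sup>2 * q3)"
      unfolding ze3 .
    have G_add: "GG 1 (a + s * b) (c + s * d) = GG 1 a c + s * GG 1 b d" for a b c d
      by (simp add: GG_def algebra_simps)
    have H_add: "HH 1 (a + s * b) = HH 1 a + s * (D * b)" for a b
      by (simp add: HH_def algebra_simps)
    have "f (\<mu> + \<zeta>1 + s * u) (\<mu> + \<zeta>2 + s * v) (\<mu> + \<zeta>3 + s * w) =
        FF 1 (- e / D + s * (x1 + s * x2)) (- (e\<^sup>2 - K) / ((K - 1) * D) + s * (q1 + s * q2 + s\<^sup>2 * q3))"
      using f_chart[OF sum] unfolding x' q' by (simp add: add.assoc)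
    also have "\<dots> = (s * g s)\<^sup>2 - s * g s * (s * h s) - e * (- e / D + s * (x1 + s * x2)) * (s * h s)\<^sup>2"
      unfolding FF_def G_add H_add GG_HH_node g_def h_def by simp
    also have "\<dots> = s\<^sup>2 * C s" unfolding C_def by (simp add: algebra_simps power2_eq_square)
    finally show ?thesis .
  qed
  moreover have "isCont C 0" unfolding C_def g_def h_def GG_def by (intro continuous_intros)
  moreover have "0 < C 0" if ne: "(u,v,w) \<noteq> (0,0,0)"
  proof -
    have C0: "C 0 = (g 0 - h 0 / 2)\<^sup>2 + (e * (e / D) - 1 / 4) * (h 0)\<^sup>2"
      unfolding C_def by (simp add: algebra_simps power2_eq_square)
    have coef: "0 < e * (e / D) - 1 / 4" using node_definite by linarith
    have "g 0 \<noteq> 0 \<or> h 0 \<noteq> 0"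
    proof (rule ccontr)
      assume "\<not> ?thesis"
      then have "h 0 = 0" "g 0 = 0" by auto
      then have "x1 = 0" using D_pos by (simp add: h_def)
      with \<open>g 0 = 0\<close> have "q1 = 0" using K1 e1 by (simp add: g_def GG_def)
      \<comment> \<open>Up to sign, the derivative in direction \<open>(u,v,w)\<close> of the cubic
        with roots \<open>\<zeta>1\<close>, \<open>\<zeta>2\<close>, \<open>\<zeta>3\<close>,
        evaluated at each root. All its coefficients are zero here.\<close>
      have "u * ((\<zeta>1 - \<zeta>2) * (\<zeta>1 - \<zeta>3)) = \<zeta>1\<^sup>2 * (u + v + w) - \<zeta>1 * (3 * x1) + q1"
           "v * ((\<zeta>2 - \<zeta>1) * (\<zeta>2 - \<zeta>3)) = \<zeta>2\<^sup>2 * (u + v + w) - \<zeta>2 * (3 * x1) + q1"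
           "w * ((\<zeta>3 - \<zeta>1) * (\<zeta>3 - \<zeta>2)) = \<zeta>3\<^sup>2 * (u + v + w) - \<zeta>3 * (3 * x1) + q1"
        by (simp_all add: x1_def q1_def algebra_simps power2_eq_square)
      then have "u = 0" "v = 0" "w = 0" using \<open>x1 = 0\<close> \<open>q1 = 0\<close> uvw zdist by auto
      then show False using ne by simp
    qed
    then show ?thesis
    proof (cases "h 0 = 0")
      case True
      then have "g 0 \<noteq> 0" using \<open>g 0 \<noteq> 0 \<or> h 0 \<noteq> 0\<close> by simp
      then show ?thesis unfolding C0 True by simp
    next
      case False
      then have "0 < (e * (e / D) - 1 / 4) * (h 0)\<^sup>2" using coef by simp
      then show ?thesis unfolding C0 using zero_le_power2[of "g 0 - h 0 / 2"] by linarith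
    qed
  qed
  ultimately show "\<exists>C. (\<forall>s. f (\<mu> + \<zeta>1 + s * u) (\<mu> + \<zeta>2 + s * v) (\<mu> + \<zeta>3 + s * w) = s\<^sup>2 * C s) \<and> isCont C 0 \<and> ((u,v,w) \<noteq> (0,0,0) \<longrightarrow> 0 < C 0)"
    by blast
qed

text \<open>At a mirror node \<open>G / H\<close> is \<open>t\<close>, a root of
  \<open>Z\<^sup>2 - Z + e t\<^sup>2\<close> by \<open>t_sq\<close>. This turns the derivative of
  the form with respect to \<open>G\<close> into \<open>(2 t - 1) H\<close>.\<close>

lemma mirror_HH_pos: "0 < HH 1 (- t\<^sup>2)"
  and mirror_GG: "GG 1 (- t\<^sup>2) (2 * t ^ 3) = t * HH 1 (- t\<^sup>2)"
proof -
  have "HH 1 (- t\<^sup>2) = t\<^sup>2 * ((e - 1) * (e\<^sup>2 + 2 * e + K)) "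
  proof -
    have "HH 1 (- t\<^sup>2) = e * (t * (1 + e))\<^sup>2 - D * t\<^sup>2" unfolding t_eq by (simp add: HH_def)
    also have "\<dots> = t\<^sup>2 * (e * (1 + e)\<^sup>2 - D)" by (simp add: algebra_simps power2_eq_square)
    also have "e * (1 + e)\<^sup>2 - D = (e - 1) * (e\<^sup>2 + 2 * e + K)"
      by (simp add: D_def algebra_simps power2_eq_square)
    finally show ?thesis .
  qed
  note H = this
  show "0 < HH 1 (- t\<^sup>2)" unfolding H using t_pos e1 K1 by (intro mult_pos_pos add_pos_pos) auto
  have "GG 1 (- t\<^sup>2) (2 * t ^ 3) = 2 * (K - 1) * e * t ^ 3 + (e\<^sup>2 - K) * t\<^sup>2 * (t * (1 + e))"
    unfolding t_eq by (simp add: GG_def)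
  also have "\<dots> = t * (t\<^sup>2 * ((e - 1) * (e\<^sup>2 + 2 * e + K)))"
    by (simp add: algebra_simps power2_eq_square power3_eq_cube)
  finally show "GG 1 (- t\<^sup>2) (2 * t ^ 3) = t * HH 1 (- t\<^sup>2)" unfolding H .
qed

text \<open>A direction splits into \<open>\<alpha>\<close> along the mirror line and
  \<open>\<beta>\<close> across it, and reflection makes the expansion even in
  \<open>\<beta>\<close>. So no mixed term occurs at second order: the \<open>\<alpha>\<close> part
  comes from \<open>FF_mirror\<close>, the \<open>\<beta>\<close> part is \<open>M\<close>, whose
  positivity is the purpose of \<open>K8\<close>.\<close>

lemma transversal_min_mirror: "transversal_min (\<mu> + 2 * t) (\<mu> - t) (\<mu> - t)"
  unfolding transversal_min_def
proof (intro allI impI)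
  fix u v w :: real assume uvw: "u + v + w = 0"
  define \<alpha> \<beta> where "\<alpha> = u / 2" and "\<beta> = (v - w) / 2"
  have uvw': "u = 2 * \<alpha>" "v = \<beta> - \<alpha>" "w = - \<beta> - \<alpha>" using uvw by (simp_all add: \<alpha>_def \<beta>_def field_simps)
  define G0 H0 G1 where "G0 = (\<lambda>T. GG 1 (- T\<^sup>2) (2 * T ^ 3))" and "H0 = (\<lambda>T. HH 1 (- T\<^sup>2))"
    and "G1 = (\<lambda>T. (e\<^sup>2 - K) / 3 - 2 * (K - 1) * e * T)"
  define M where "M = (\<lambda>T. 2 * G0 T * G1 T - G1 T * H0 T + G0 T * (D / 3) + e * (H0 T)\<^sup>2 / 3 - 2 * (e * T\<^sup>2) * H0 T * (D / 3))"
  define N where "N = (\<lambda>T. (G1 T)\<^sup>2 + G1 T * (D / 3) + e * T\<^sup>2 * (D / 3)\<^sup>2 - 2 / 3 * e * H0 T * (D / 3))"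
  define L where "L = (\<lambda>T. e * (K + 2 * (K + e) * T + (K\<^sup>2 - 2 * e * (K - 2) + e\<^sup>2) * T\<^sup>2))"
  define C where "C = (\<lambda>s. (t + s * \<alpha>)\<^sup>2 * (\<alpha> * (1 + e))\<^sup>2 * L (t + s * \<alpha>) + \<beta>\<^sup>2 * M (t + s * \<alpha>) +
      s\<^sup>2 * \<beta> ^ 4 * N (t + s * \<alpha>) + s ^ 4 * \<beta> ^ 6 * (e / 3 * (D / 3)\<^sup>2))"
  \<comment> \<open>Expansion at the centred point \<open>(2 T, b - T, - b - T)\<close>, at offset
    \<open>b\<close> from the mirror line.\<close>
  have FF_off: "FF 1 (- (T\<^sup>2 + b\<^sup>2 / 3)) (2 * T * (T\<^sup>2 - b\<^sup>2)) =
      FF 1 (- T\<^sup>2) (2 * T ^ 3) + b\<^sup>2 * M T + b ^ 4 * N T + b ^ 6 * (e / 3 * (D / 3)\<^sup>2)" for T b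
  proof -
    have "GG 1 (- (T\<^sup>2 + b\<^sup>2 / 3)) (2 * T * (T\<^sup>2 - b\<^sup>2)) = G0 T + b\<^sup>2 * G1 T"
      by (simp add: G0_def G1_def GG_def algebra_simps power2_eq_square power3_eq_cube diff_divide_distrib)
    moreover have "HH 1 (- (T\<^sup>2 + b\<^sup>2 / 3)) = H0 T - b\<^sup>2 * (D / 3)" by (simp add: H0_def HH_def algebra_simps)
    moreover have "GG 1 (- T\<^sup>2) (2 * T ^ 3) = G0 T" "HH 1 (- T\<^sup>2) = H0 T" by (simp_all add: G0_def H0_def)
    moreover have "(g + c * g')\<^sup>2 - 1 * (g + c * g') * (h - c * d) - e * (- (T2 + c / 3)) * (h - c * d)\<^sup>2 =
        (g\<^sup>2 - 1 * g * h - e * (- T2) * h\<^sup>2) + c * (2 * g * g' - g' * h + g * d + e * h\<^sup>2 / 3 - 2 * (e * T2) * h * d)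
        + c\<^sup>2 * (g'\<^sup>2 + g' * d + e * T2 * d\<^sup>2 - 2 / 3 * e * h * d) + c ^ 3 * (e / 3 * d\<^sup>2)" for g g' h d c T2
      by (simp add: algebra_simps power2_eq_square power3_eq_cube add_divide_distrib diff_divide_distrib)
    moreover have "b ^ 4 = (b\<^sup>2)\<^sup>2" "b ^ 6 = (b\<^sup>2) ^ 3" by (simp_all flip: power_mult)
    ultimately show ?thesis unfolding FF_def M_def N_def by (simp only:)
  qed
  have "f (\<mu> + 2 * t + s * u) (\<mu> - t + s * v) (\<mu> - t + s * w) = s\<^sup>2 * C s" for s
  proof -
    define T where "T = t + s * \<alpha>"
    have sum: "2 * T + (s * \<beta> - T) + (- s * \<beta> - T) = 0" by simp
    have "f (\<mu> + 2 * t + s * u) (\<mu> - t + s * v) (\<mu> - t + s * w) = f (\<mu> + 2 * T) (\<mu> + (s * \<beta> - T)) (\<mu> + (- s * \<beta> - T))"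
      unfolding uvw' T_def by (simp add: algebra_simps)
    also have "\<dots> = FF 1 (- (T\<^sup>2 + (s * \<beta>)\<^sup>2 / 3)) (2 * T * (T\<^sup>2 - (s * \<beta>)\<^sup>2))"
      unfolding f_chart[OF sum]
      by (rule arg_cong2[where f = "FF 1"]) (simp_all add: field_simps power2_eq_square)
    also have "\<dots> = T\<^sup>2 * (T * (1 + e) - 1)\<^sup>2 * L T + (s * \<beta>)\<^sup>2 * M T + (s * \<beta>) ^ 4 * N T + (s * \<beta>) ^ 6 * (e / 3 * (D / 3)\<^sup>2)"
      unfolding FF_off FF_mirror L_def ..
    also have "T * (1 + e) - 1 = s * (\<alpha> * (1 + e))"
    proof -
      have "T * (1 + e) = t * (1 + e) + s * (\<alpha> * (1 + e))" unfolding T_def by (simp only: distrib_right mult.assoc)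
      then show ?thesis unfolding t_eq by simp
    qed
    also have "T\<^sup>2 * (s * (\<alpha> * (1 + e)))\<^sup>2 * L T + (s * \<beta>)\<^sup>2 * M T + (s * \<beta>) ^ 4 * N T + (s * \<beta>) ^ 6 * (e / 3 * (D / 3)\<^sup>2) = s\<^sup>2 * C s"
    proof -
      have "T\<^sup>2 * (s * a)\<^sup>2 * l + (s * \<beta>)\<^sup>2 * m + (s * \<beta>) ^ 4 * n + (s * \<beta>) ^ 6 * k =
          s\<^sup>2 * (T\<^sup>2 * a\<^sup>2 * l + \<beta>\<^sup>2 * m + s\<^sup>2 * \<beta> ^ 4 * n + s ^ 4 * \<beta> ^ 6 * k)" for a l m n k
      proof -
        have p: "s ^ 6 = s\<^sup>2 * s ^ 4" "s ^ 4 = s\<^sup>2 * s\<^sup>2" by (simp_all flip: power_add)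
        show ?thesis unfolding power_mult_distrib distrib_left p(1) by (simp only: p(2) ac_simps)
      qed
      note id = this
      show ?thesis unfolding C_def T_def[symmetric] by (rule id)
    qed
    finally show ?thesis .
  qed
  moreover have "isCont C 0"
  proof -
    define \<tau> where "\<tau> = (\<lambda>s. t + s * \<alpha>)"
    have c: "isCont \<tau> 0" unfolding \<tau>_def by (intro continuous_intros)
    have cG: "isCont (\<lambda>s. G0 (\<tau> s)) 0" unfolding G0_def GG_def by (intro continuous_intros c)
    have cH: "isCont (\<lambda>s. H0 (\<tau> s)) 0" unfolding H0_def HH_def by (intro continuous_intros c)
    have cG1: "isCont (\<lambda>s. G1 (\<tau> s)) 0" unfolding G1_def by (intro continuous_intros c)
    have cM: "isCont (\<lambda>s. M (\<tau> s)) 0" unfolding M_def by (intro continuous_intros c cG cH cG1) simp_all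
    have cN: "isCont (\<lambda>s. N (\<tau> s)) 0" unfolding N_def by (intro continuous_intros c cG cH cG1)
    have cL: "isCont (\<lambda>s. L (\<tau> s)) 0" unfolding L_def by (intro continuous_intros c)
    have "C = (\<lambda>s. (\<tau> s)\<^sup>2 * (\<alpha> * (1 + e))\<^sup>2 * L (\<tau> s) + \<beta>\<^sup>2 * M (\<tau> s) +
      s\<^sup>2 * \<beta> ^ 4 * N (\<tau> s) + s ^ 4 * \<beta> ^ 6 * (e / 3 * (D / 3)\<^sup>2))" by (simp add: C_def \<tau>_def)
    then show ?thesis by (simp only:) (intro continuous_intros c cM cN cL)
  qed
  moreover have "0 < C 0" if ne: "(u,v,w) \<noteq> (0,0,0)"
  proof -
    have C0: "C 0 = (t * (\<alpha> * (1 + e)))\<^sup>2 * L t + \<beta>\<^sup>2 * M t" unfolding C_def by (simp add: power_mult_distrib)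
    have L: "0 < L t" unfolding L_def using mirror_quadratic_pos e1 by simp
    have H0: "0 < H0 t" "G0 t = t * H0 t" using mirror_HH_pos mirror_GG by (simp_all add: H0_def G0_def)
    have "M t = H0 t * ((2 * t - 1) * G1 t + t * (D / 3) - 2 * (e * t\<^sup>2) * (D / 3) + e * H0 t / 3)"
      unfolding M_def H0(2) by (simp add: algebra_simps power2_eq_square)
    also have "\<dots> = H0 t * ((1 - 2 * t) * (- G1 t - t * (D / 3)) + e * H0 t / 3)"
      unfolding t_sq by (simp add: algebra_simps power2_eq_square diff_divide_distrib)
    finally have M: "M t = H0 t * ((1 - 2 * t) * (- G1 t - t * (D / 3)) + e * H0 t / 3)" .
    have "3 * (- G1 t - t * (D / 3)) = t * (6 * (K - 1) * e) - (t * (1 + e)) * (e\<^sup>2 - K) - t * D"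
      unfolding t_eq by (simp add: G1_def algebra_simps diff_divide_distrib)
    also have "\<dots> = t * (e * (8 * (K - 1) - (1 + e)\<^sup>2))"
      by (simp add: D_def algebra_simps power2_eq_square)
    also have "\<dots> > 0" using t_pos e1 K8 by simp
    finally have "0 < - G1 t - t * (D / 3)" by simp
    then have "0 < (1 - 2 * t) * (- G1 t - t * (D / 3))" using t_half by simp
    moreover have "0 < e * H0 t / 3" using H0 e1 by simp
    ultimately have "0 < (1 - 2 * t) * (- G1 t - t * (D / 3)) + e * H0 t / 3" by (rule add_pos_pos)
    with H0(1) have M: "0 < M t" unfolding M by (rule mult_pos_pos)
    have "\<alpha> \<noteq> 0 \<or> \<beta> \<noteq> 0" using ne uvw' by auto
    then show ?thesis
    proof
      assume "\<alpha> \<noteq> 0"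
      then have "0 < (t * (\<alpha> * (1 + e)))\<^sup>2 * L t" using t_pos e1 L by simp
      then show ?thesis unfolding C0 using M by (intro add_pos_nonneg) auto
    next
      assume "\<beta> \<noteq> 0"
      then have "0 < \<beta>\<^sup>2 * M t" using M by simp
      then show ?thesis unfolding C0 using L by (intro add_nonneg_pos) auto
    qed
  qed
  ultimately show "\<exists>C. (\<forall>s. f (\<mu> + 2 * t + s * u) (\<mu> - t + s * v) (\<mu> - t + s * w) = s\<^sup>2 * C s) \<and> isCont C 0 \<and> ((u,v,w) \<noteq> (0,0,0) \<longrightarrow> 0 < C 0)"
    by blast
qed

lemma transversal_min_nodes: "(a,b,c) \<in> nodes \<Longrightarrow> transversal_min a b c"
proof -
  note sw = transversal_min_swap
  note m = transversal_min_mirror and g = transversal_min_generic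
  note m2 = sw(1)[OF m] and g2 = sw(1)[OF g] and g3 = sw(2)[OF g]
  note m3 = sw(2)[OF m2] and g4 = sw(2)[OF g2] and g5 = sw(1)[OF g3]
  note g6 = sw(1)[OF g4]
  have "\<forall>n\<in>nodes. case n of (a,b,c) \<Rightarrow> transversal_min a b c"
    unfolding nodes_def ball_simps prod.case
    by (intro conjI TrueI transversal_min_centre m m2 m3 g g2 g3 g4 g5 g6)
  then show "(a,b,c) \<in> nodes \<Longrightarrow> transversal_min a b c" by auto
qed

text \<open>An acnode is a real zero, hence a multiple of a listed node. Listed nodes are
  projectively distinct because they share the nonzero coordinate sum
  \<open>3 \<mu>\<close>.\<close>

lemma acnodes_f:
  assumes p: "is_form 6 p" "\<And>x y z. feval 6 p x y z = f x y z"
  shows "card (acnodes6 p) = 10"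
proof -
  have ac: "is_acnode6 p n" if n: "n \<in> nodes" for n
  proof -
    obtain a b c where [simp]: "n = (a,b,c)" by (cases n) auto
    have "transversal_min a b c" using n transversal_min_nodes by simp
    then have "is_acnode6 p (a,b,c)"
      by (intro acnodeI p(1)) (use nodes_sum[of a b c] n mu in \<open>auto simp: p(2) transversal_min_def\<close>)
    then show ?thesis by simp
  qed
  have sub: "proj_point ` {n. is_acnode6 p n} \<subseteq> proj_point ` nodes"
  proof
    fix S assume "S \<in> proj_point ` {n. is_acnode6 p n}"
    then obtain a b c where S: "S = proj_point (a,b,c)" "is_acnode6 p (a,b,c)" by auto
    then have "f a b c = 0" "(a,b,c) \<noteq> (0,0,0)" using p(2) by (auto simp: is_acnode6_def)
    from f_nonneg_zero(2)[OF this] obtain x y z s where n: "(x,y,z) \<in> nodes" "s \<noteq> 0" "a = s * x" "b = s * y" "c = s * z"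
      by auto
    have "proj_point (a,b,c) = proj_point (x,y,z)"
    proof -
      have "\<exists>r'. (r * a, r * b, r * c) = (r' * x, r' * y, r' * z) \<and> r' \<noteq> 0" if "r \<noteq> 0" for r
        using n that by (intro exI[of _ "r * s"]) simp
      moreover have "\<exists>r'. (r * x, r * y, r * z) = (r' * a, r' * b, r' * c) \<and> r' \<noteq> 0" if "r \<noteq> 0" for r
        using n that by (intro exI[of _ "r / s"]) simp
      ultimately show ?thesis unfolding proj_point_def prod.case by blast
    qed
    with S n show "S \<in> proj_point ` nodes" by blast
  qed
  then have "acnodes6 p = proj_point ` nodes" unfolding acnodes6_def using ac by blast
  moreover have "inj_on proj_point nodes"
  proof (rule inj_onI)
    fix m n assume m: "m \<in> nodes" and n: "n \<in> nodes" and eq: "proj_point m = proj_point n"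
    obtain a b c x y z where mn: "m = (a,b,c)" "n = (x,y,z)" by (metis prod_cases3)
    have "(a,b,c) \<in> proj_point m" unfolding mn proj_point_def by (auto intro!: exI[of _ 1])
    then have "(a,b,c) \<in> proj_point n" by (simp only: eq)
    then obtain s where s: "a = s * x" "b = s * y" "c = s * z" unfolding mn proj_point_def by auto
    have "3 * \<mu> = s * (3 * \<mu>)" using nodes_sum[of a b c] nodes_sum[of x y z] m n s mn by (simp flip: distrib_left)
    then have "s = 1" using mu by simp
    with s mn show "m = n" by simp
  qed
  ultimately show ?thesis using card_image[of proj_point nodes] card_nodes by simp
qed

end

section \<open>Charts for forms of given degree\<close>

text \<open>A weighted degree: the outer variable stands for a quantity of degree two, the inner one
  for a coordinate.\<close>

definition weight_le :: "nat \<Rightarrow> real poly poly \<Rightarrow> bool" where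
  "weight_le n \<Omega> \<longleftrightarrow> (\<forall>k j. coeff (coeff \<Omega> k) j \<noteq> 0 \<longrightarrow> j + 2 * k \<le> n)"

lemma weight_le_mult:
  assumes "weight_le n \<Omega>" "weight_le m \<Omega>'"
  shows "weight_le (n + m) (\<Omega> * \<Omega>')"
  unfolding weight_le_def
proof (intro allI impI)
  fix k j assume "coeff (coeff (\<Omega> * \<Omega>') k) j \<noteq> 0"
  then have "(\<Sum>i\<le>k. coeff (coeff \<Omega> i * coeff \<Omega>' (k - i)) j) \<noteq> 0" by (simp add: coeff_mult coeff_sum)
  then obtain i where i: "i \<in> {..k}" "coeff (coeff \<Omega> i * coeff \<Omega>' (k - i)) j \<noteq> 0"
    by (rule sum.not_neutral_contains_not_neutral)
  from i(2) have "(\<Sum>l\<le>j. coeff (coeff \<Omega> i) l * coeff (coeff \<Omega>' (k - i)) (j - l)) \<noteq> 0"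
    by (simp add: coeff_mult)
  then obtain l where l: "l \<in> {..j}" "coeff (coeff \<Omega> i) l * coeff (coeff \<Omega>' (k - i)) (j - l) \<noteq> 0"
    by (rule sum.not_neutral_contains_not_neutral)
  then have "coeff (coeff \<Omega> i) l \<noteq> 0" "coeff (coeff \<Omega>' (k - i)) (j - l) \<noteq> 0" by auto
  then have "l + 2 * i \<le> n" "(j - l) + 2 * (k - i) \<le> m" using assms unfolding weight_le_def by blast+
  then show "j + 2 * k \<le> n + m" using i(1) l(1) by auto
qed

text \<open>Here \<open>m\<close> is the mean of the three coordinates \<open>m - z2 - z3, m + z2, m + z3\<close>.  A function
  symmetric in the last two is a polynomial in the first centred coordinate \<open>- z2 - z3\<close> and in the
  second elementary symmetric function of the centred coordinates, here shifted by \<open>P\<close>.\<close>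

definition chart_poly :: "real \<Rightarrow> nat \<Rightarrow> (real \<Rightarrow> real \<Rightarrow> real) \<Rightarrow> bool" where
  "chart_poly P n F \<longleftrightarrow> (\<exists>\<Omega>. weight_le n \<Omega> \<and>
     (\<forall>z2 z3. F z2 z3 = poly (poly \<Omega> [:z2 * z3 - (z2 + z3)\<^sup>2 - P:]) (- z2 - z3)))"

lemma chart_poly_zero: "chart_poly P n (\<lambda>_ _. 0)"
  unfolding chart_poly_def by (intro exI[of _ 0]) (simp add: weight_le_def)

lemma chart_poly_add: "chart_poly P n F \<Longrightarrow> chart_poly P n F' \<Longrightarrow> chart_poly P n (\<lambda>z2 z3. F z2 z3 + F' z2 z3)"
  unfolding chart_poly_def
proof (elim exE conjE)
  fix \<Omega> \<Omega>' assume *: "weight_le n \<Omega>" "weight_le n \<Omega>'"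
    "\<forall>z2 z3. F z2 z3 = poly (poly \<Omega> [:z2 * z3 - (z2 + z3)\<^sup>2 - P:]) (- z2 - z3)"
    "\<forall>z2 z3. F' z2 z3 = poly (poly \<Omega>' [:z2 * z3 - (z2 + z3)\<^sup>2 - P:]) (- z2 - z3)"
  have "weight_le n (\<Omega> + \<Omega>')" using *(1,2) unfolding weight_le_def by (metis add.right_neutral coeff_add)
  with * show "\<exists>\<Omega>. weight_le n \<Omega> \<and> (\<forall>z2 z3. F z2 z3 + F' z2 z3 = poly (poly \<Omega> [:z2 * z3 - (z2 + z3)\<^sup>2 - P:]) (- z2 - z3))"
    by (intro exI[of _ "\<Omega> + \<Omega>'"]) simp
qed

lemma chart_poly_mult: "chart_poly P n F \<Longrightarrow> chart_poly P m F' \<Longrightarrow> chart_poly P (n + m) (\<lambda>z2 z3. F z2 z3 * F' z2 z3)"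
  unfolding chart_poly_def
proof (elim exE conjE)
  fix \<Omega> \<Omega>' assume *: "weight_le n \<Omega>" "weight_le m \<Omega>'"
    "\<forall>z2 z3. F z2 z3 = poly (poly \<Omega> [:z2 * z3 - (z2 + z3)\<^sup>2 - P:]) (- z2 - z3)"
    "\<forall>z2 z3. F' z2 z3 = poly (poly \<Omega>' [:z2 * z3 - (z2 + z3)\<^sup>2 - P:]) (- z2 - z3)"
  with weight_le_mult[OF *(1,2)] show "\<exists>\<Omega>. weight_le (n + m) \<Omega> \<and> (\<forall>z2 z3. F z2 z3 * F' z2 z3 = poly (poly \<Omega> [:z2 * z3 - (z2 + z3)\<^sup>2 - P:]) (- z2 - z3))"
    by (intro exI[of _ "\<Omega> * \<Omega>'"]) simp
qed

lemma chart_poly_const: "chart_poly P 0 (\<lambda>_ _. c)"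
  unfolding chart_poly_def
  by (intro exI[of _ "[:[:c:]:]"]) (auto simp: weight_le_def coeff_pCons split: nat.splits)

lemma chart_poly_cmult: "chart_poly P n F \<Longrightarrow> chart_poly P n (\<lambda>z2 z3. c * F z2 z3)"
  using chart_poly_mult[OF chart_poly_const] by simp

lemma chart_poly_power: "chart_poly P n F \<Longrightarrow> chart_poly P (k * n) (\<lambda>z2 z3. F z2 z3 ^ k)"
  by (induction k) (auto intro: chart_poly_const chart_poly_mult)

lemma chart_poly_sum:
  "finite I \<Longrightarrow> (\<And>i. i \<in> I \<Longrightarrow> chart_poly P n (F i)) \<Longrightarrow> chart_poly P n (\<lambda>z2 z3. \<Sum>i\<in>I. F i z2 z3)"
  by (induction I rule: finite_induct) (auto intro: chart_poly_zero chart_poly_add)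

lemma chart_poly_first: "chart_poly P 1 (\<lambda>z2 z3. m - z2 - z3)"
  unfolding chart_poly_def
  by (intro exI[of _ "[:[:m,1:]:]"]) (auto simp: weight_le_def coeff_pCons split: nat.splits)

lemma chart_poly_sum23: "chart_poly P 1 (\<lambda>z2 z3. (m + z2) + (m + z3))"
  unfolding chart_poly_def
  by (intro exI[of _ "[:[:2*m,-1:]:]"]) (auto simp: weight_le_def coeff_pCons split: nat.splits)

text \<open>With \<open>z = - z2 - z3\<close> and outer variable
  \<open>d = z2 * z3 - z\<^sup>2 - P\<close> one has \<open>z2 * z3 = d + P + z\<^sup>2\<close>,
  which gives the witness.\<close>

lemma chart_poly_prod23: "chart_poly P 2 (\<lambda>z2 z3. (m + z2) * (m + z3))"
  unfolding chart_poly_def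
  by (intro exI[of _ "[:[:m\<^sup>2+P,-m,1:],1:]"])
     (auto simp: weight_le_def coeff_pCons algebra_simps power2_eq_square split: nat.splits)

text \<open>Newton recurrence: each power sum follows from the two previous ones through the sum and
  the product of the coordinates.\<close>

lemma chart_poly_power_sum: "chart_poly P n (\<lambda>z2 z3. (m + z2) ^ n + (m + z3) ^ n)"
proof (induction n rule: less_induct)
  case (less n)
  consider "n = 0" | "n = 1" | k where "n = Suc (Suc k)" by (metis One_nat_def not0_implies_Suc)
  then show ?case
  proof cases
    case 1 then show ?thesis using chart_poly_const[of P 2] by simp
  next
    case 2 then show ?thesis using chart_poly_sum23 by simp
  next
    case 3
    have "chart_poly P (1 + Suc k) (\<lambda>z2 z3. ((m + z2) + (m + z3)) * ((m + z2) ^ Suc k + (m + z3) ^ Suc k))"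
      by (intro chart_poly_mult chart_poly_sum23 less) (simp add: 3)
    moreover have "chart_poly P (2 + k) (\<lambda>z2 z3. ((m + z2) * (m + z3)) * ((m + z2) ^ k + (m + z3) ^ k))"
      by (intro chart_poly_mult chart_poly_prod23 less) (simp add: 3)
    ultimately have "chart_poly P n (\<lambda>z2 z3. ((m + z2) + (m + z3)) * ((m + z2) ^ Suc k + (m + z3) ^ Suc k)
        + (- 1) * (((m + z2) * (m + z3)) * ((m + z2) ^ k + (m + z3) ^ k)))"
      unfolding 3 by (intro chart_poly_add chart_poly_cmult) simp_all
    moreover have "(b + c) * (b ^ Suc k + c ^ Suc k) + (- 1) * ((b * c) * (b ^ k + c ^ k)) = b ^ n + c ^ n" for b c :: real
      unfolding 3 by (simp add: algebra_simps)
    ultimately show ?thesis by (simp only:)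
  qed
qed

text \<open>An alternating polynomial is divisible by \<open>z2 - z3\<close>; the index
  \<open>n\<close> bounds the weight of the quotient, one less than the degree of the
  function.\<close>

definition chart_alt :: "real \<Rightarrow> nat \<Rightarrow> (real \<Rightarrow> real \<Rightarrow> real) \<Rightarrow> bool" where
  "chart_alt P n F \<longleftrightarrow> (\<exists>B. chart_poly P n B \<and> (\<forall>z2 z3. F z2 z3 = (z2 - z3) * B z2 z3))"

lemma chart_alt_zero: "chart_alt P n (\<lambda>_ _. 0)"
  unfolding chart_alt_def using chart_poly_zero[of P n] by (intro exI[of _ "\<lambda>_ _. 0"]) simp

lemma chart_alt_add: "chart_alt P n F \<Longrightarrow> chart_alt P n F' \<Longrightarrow> chart_alt P n (\<lambda>z2 z3. F z2 z3 + F' z2 z3)"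
  unfolding chart_alt_def
proof (elim exE conjE)
  fix B B' assume *: "chart_poly P n B" "chart_poly P n B'"
    "\<forall>z2 z3. F z2 z3 = (z2 - z3) * B z2 z3" "\<forall>z2 z3. F' z2 z3 = (z2 - z3) * B' z2 z3"
  then show "\<exists>B. chart_poly P n B \<and> (\<forall>z2 z3. F z2 z3 + F' z2 z3 = (z2 - z3) * B z2 z3)"
    by (intro exI[of _ "\<lambda>z2 z3. B z2 z3 + B' z2 z3"]) (simp add: chart_poly_add distrib_left)
qed

lemma chart_alt_mult: "chart_poly P m F' \<Longrightarrow> chart_alt P n F \<Longrightarrow> chart_alt P (m + n) (\<lambda>z2 z3. F' z2 z3 * F z2 z3)"
  unfolding chart_alt_def
proof (elim exE conjE)
  fix B assume *: "chart_poly P m F'" "chart_poly P n B" "\<forall>z2 z3. F z2 z3 = (z2 - z3) * B z2 z3"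
  then show "\<exists>B. chart_poly P (m + n) B \<and> (\<forall>z2 z3. F' z2 z3 * F z2 z3 = (z2 - z3) * B z2 z3)"
    by (intro exI[of _ "\<lambda>z2 z3. F' z2 z3 * B z2 z3"]) (simp add: chart_poly_mult)
qed

lemma chart_alt_cmult: "chart_alt P n F \<Longrightarrow> chart_alt P n (\<lambda>z2 z3. c * F z2 z3)"
  using chart_alt_mult[OF chart_poly_const, of P n F c] by simp

lemma chart_alt_sum:
  "finite I \<Longrightarrow> (\<And>i. i \<in> I \<Longrightarrow> chart_alt P n (F i)) \<Longrightarrow> chart_alt P n (\<lambda>z2 z3. \<Sum>i\<in>I. F i z2 z3)"
  by (induction I rule: finite_induct) (auto intro: chart_alt_zero chart_alt_add)

lemma chart_alt_power_diff: "chart_alt P n (\<lambda>z2 z3. (m + z2) ^ Suc n - (m + z3) ^ Suc n)"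
proof (induction n rule: less_induct)
  case (less n)
  consider "n = 0" | "n = 1" | k where "n = Suc (Suc k)" by (metis One_nat_def not0_implies_Suc)
  then show ?case
  proof cases
    case 1 then show ?thesis unfolding chart_alt_def using chart_poly_const[of P 1]
      by (intro exI[of _ "\<lambda>_ _. 1"]) simp
  next
    case 2
    show ?thesis unfolding 2 chart_alt_def using chart_poly_sum23[of P m]
      by (intro exI[of _ "\<lambda>z2 z3. (m + z2) + (m + z3)"]) (simp add: algebra_simps)
  next
    case 3
    have "chart_alt P (1 + Suc k) (\<lambda>z2 z3. ((m + z2) + (m + z3)) * ((m + z2) ^ Suc (Suc k) - (m + z3) ^ Suc (Suc k)))"
      by (intro chart_alt_mult chart_poly_sum23 less) (simp add: 3)
    moreover have "chart_alt P (2 + k) (\<lambda>z2 z3. ((m + z2) * (m + z3)) * ((m + z2) ^ Suc k - (m + z3) ^ Suc k))"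
      by (intro chart_alt_mult chart_poly_prod23 less) (simp add: 3)
    ultimately have "chart_alt P n (\<lambda>z2 z3. ((m + z2) + (m + z3)) * ((m + z2) ^ Suc (Suc k) - (m + z3) ^ Suc (Suc k))
        + (- 1) * (((m + z2) * (m + z3)) * ((m + z2) ^ Suc k - (m + z3) ^ Suc k)))"
      unfolding 3 by (intro chart_alt_add chart_alt_cmult) simp_all
    moreover have "(b + c) * (b ^ Suc (Suc k) - c ^ Suc (Suc k)) + (- 1) * ((b * c) * (b ^ Suc k - c ^ Suc k)) = b ^ Suc n - c ^ Suc n" for b c :: real
      unfolding 3 by (simp add: algebra_simps)
    ultimately show ?thesis by (simp only:)
  qed
qed

lemma chart_poly_symmetrised_monomial:
  "chart_poly P (j + k) (\<lambda>z2 z3. (m + z2) ^ j * (m + z3) ^ k + (m + z3) ^ j * (m + z2) ^ k)"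
proof -
  have *: "chart_poly P (j + (j + l)) (\<lambda>z2 z3. (m + z2) ^ j * (m + z3) ^ (j + l) + (m + z3) ^ j * (m + z2) ^ (j + l))" for j l
  proof -
    have "chart_poly P (j * 2 + l) (\<lambda>z2 z3. ((m + z2) * (m + z3)) ^ j * ((m + z2) ^ l + (m + z3) ^ l))"
      by (intro chart_poly_mult chart_poly_power chart_poly_prod23 chart_poly_power_sum)
    moreover have "j * 2 + l = j + (j + l)" by simp
    moreover have "(b * c) ^ j * (b ^ l + c ^ l) = b ^ j * c ^ (j + l) + c ^ j * b ^ (j + l)" for b c :: real
      by (simp add: power_mult_distrib power_add algebra_simps)
    ultimately show ?thesis by (simp only:)
  qed
  show ?thesis
  proof (cases "j \<le> k")
    case True
    then show ?thesis using *[of j "k - j"] by simp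
  next
    case False
    then show ?thesis using *[of k "j - k"] by (simp add: algebra_simps)
  qed
qed

lemma chart_alt_monomial:
  assumes "j + k = Suc n"
  shows "chart_alt P n (\<lambda>z2 z3. (m + z2) ^ j * (m + z3) ^ k - (m + z3) ^ j * (m + z2) ^ k)"
proof -
  have *: "chart_alt P (j + j + l) (\<lambda>z2 z3. (m + z2) ^ (j + Suc l) * (m + z3) ^ j - (m + z3) ^ (j + Suc l) * (m + z2) ^ j)" for j l
  proof -
    have "chart_alt P (j * 2 + l) (\<lambda>z2 z3. ((m + z2) * (m + z3)) ^ j * ((m + z2) ^ Suc l - (m + z3) ^ Suc l))"
      by (intro chart_alt_mult chart_poly_power chart_poly_prod23 chart_alt_power_diff)
    moreover have "j * 2 + l = j + j + l" by simp
    moreover have "(b * c) ^ j * (b ^ Suc l - c ^ Suc l) = b ^ (j + Suc l) * c ^ j - c ^ (j + Suc l) * b ^ j" for b c :: real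
      by (simp add: power_mult_distrib power_add algebra_simps)
    ultimately show ?thesis by (simp only:)
  qed
  consider "j = k" | "k < j" | "j < k" by linarith
  then show ?thesis
  proof cases
    case 1
    then show ?thesis using chart_alt_zero by (simp add: mult.commute)
  next
    case 2
    then obtain l where l: "j = k + Suc l" by (metis less_iff_Suc_add add_Suc_right)
    then have "n = k + k + l" using assms by simp
    then show ?thesis using *[of k l] l by simp
  next
    case 3
    then obtain l where l: "k = j + Suc l" by (metis less_iff_Suc_add add_Suc_right)
    then have "n = j + j + l" using assms by simp
    then show ?thesis using chart_alt_cmult[OF *[of j l], of "-1"] l by (simp add: mult.commute)
  qed
qed

lemma form_fun_symmetric_part:
  assumes "form_fun d F"
  shows "chart_poly P d (\<lambda>z2 z3. F (m - z2 - z3) (m + z2) (m + z3) + F (m - z2 - z3) (m + z3) (m + z2))"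
proof -
  obtain p where p: "is_form d p" "\<And>x y z. F x y z = feval d p x y z" using assms by (auto simp: form_fun_def)
  have "chart_poly P d (\<lambda>z2 z3. \<Sum>n\<in>monomials d. p n * ((m - z2 - z3) ^ fst n *
     ((m + z2) ^ fst (snd n) * (m + z3) ^ snd (snd n) + (m + z3) ^ fst (snd n) * (m + z2) ^ snd (snd n))))"
  proof (intro chart_poly_sum chart_poly_cmult finite_monomials)
    fix n assume "n \<in> monomials d"
    then have d: "d = fst n * 1 + (fst (snd n) + snd (snd n))" by (auto simp: monomials_def)
    show "chart_poly P d (\<lambda>z2 z3. (m - z2 - z3) ^ fst n *
     ((m + z2) ^ fst (snd n) * (m + z3) ^ snd (snd n) + (m + z3) ^ fst (snd n) * (m + z2) ^ snd (snd n)))"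
      unfolding d by (intro chart_poly_mult chart_poly_power chart_poly_first chart_poly_symmetrised_monomial)
  qed
  moreover have "(\<Sum>n\<in>monomials d. p n * (a ^ fst n * (b ^ fst (snd n) * c ^ snd (snd n) + c ^ fst (snd n) * b ^ snd (snd n))))
      = F a b c + F a c b" for a b c
    unfolding p(2) feval_form[OF p(1)] sum.distrib[symmetric] by (intro sum.cong) (auto simp: algebra_simps)
  ultimately show ?thesis by (simp only:)
qed

lemma form_fun_alternating_part:
  assumes "form_fun (Suc d) F"
  shows "chart_alt P d (\<lambda>z2 z3. F (m - z2 - z3) (m + z2) (m + z3) - F (m - z2 - z3) (m + z3) (m + z2))"
proof -
  obtain p where p: "is_form (Suc d) p" "\<And>x y z. F x y z = feval (Suc d) p x y z" using assms by (auto simp: form_fun_def)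
  have "chart_alt P d (\<lambda>z2 z3. \<Sum>n\<in>monomials (Suc d). p n * ((m - z2 - z3) ^ fst n *
     ((m + z2) ^ fst (snd n) * (m + z3) ^ snd (snd n) - (m + z3) ^ fst (snd n) * (m + z2) ^ snd (snd n))))"
  proof (intro chart_alt_sum chart_alt_cmult finite_monomials)
    fix n assume n: "n \<in> monomials (Suc d)"
    show "chart_alt P d (\<lambda>z2 z3. (m - z2 - z3) ^ fst n *
     ((m + z2) ^ fst (snd n) * (m + z3) ^ snd (snd n) - (m + z3) ^ fst (snd n) * (m + z2) ^ snd (snd n)))"
    proof (cases "fst (snd n) + snd (snd n)")
      case 0
      then show ?thesis using chart_alt_zero by simp
    next
      case (Suc l)
      then have d: "d = fst n * 1 + l" using n by (auto simp: monomials_def)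
      show ?thesis unfolding d by (intro chart_alt_mult chart_poly_power chart_poly_first chart_alt_monomial Suc)
    qed
  qed
  moreover have "(\<Sum>n\<in>monomials (Suc d). p n * (a ^ fst n * (b ^ fst (snd n) * c ^ snd (snd n) - c ^ fst (snd n) * b ^ snd (snd n))))
      = F a b c - F a c b" for a b c
    unfolding p(2) feval_form[OF p(1)] sum_subtractf[symmetric] by (intro sum.cong) (auto simp: algebra_simps)
  ultimately show ?thesis by (simp only:)
qed

text \<open>Weight below eight allows powers of \<open>d\<close> up to three. Because of truncated
  subtraction the degree bounds alone would still admit constants for small \<open>n\<close>, so
  vanishing is stated separately.\<close>

lemma chart_poly_expand:
  assumes "chart_poly P n F" "n < 8"
  obtains \<psi>0 \<psi>1 \<psi>2 \<psi>3 where "degree \<psi>0 \<le> n" "degree \<psi>1 \<le> n - 2" "degree \<psi>2 \<le> n - 4" "degree \<psi>3 \<le> n - 6"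
    "n < 2 \<Longrightarrow> \<psi>1 = 0" "n < 4 \<Longrightarrow> \<psi>2 = 0" "n < 6 \<Longrightarrow> \<psi>3 = 0"
    "\<And>z2 z3. F z2 z3 = (let z = - z2 - z3; d = z2 * z3 - (z2 + z3)\<^sup>2 - P in
       poly \<psi>0 z + poly \<psi>1 z * d + poly \<psi>2 z * d\<^sup>2 + poly \<psi>3 z * d ^ 3)"
proof -
  obtain \<Omega> where w: "weight_le n \<Omega>"
    and F: "\<And>z2 z3. F z2 z3 = poly (poly \<Omega> [:z2 * z3 - (z2 + z3)\<^sup>2 - P:]) (- z2 - z3)"
    using assms(1) unfolding chart_poly_def by blast
  have deg: "degree (coeff \<Omega> k) \<le> n - 2 * k" for k
  proof (rule degree_le, intro allI impI)
    fix j assume "n - 2 * k < j"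
    then have "\<not> j + 2 * k \<le> n" by linarith
    then show "coeff (coeff \<Omega> k) j = 0" using w unfolding weight_le_def by blast
  qed
  have z: "coeff \<Omega> k = 0" if "n < 2 * k" for k
  proof (rule poly_eqI)
    fix j
    have "\<not> j + 2 * k \<le> n" using that by linarith
    then show "coeff (coeff \<Omega> k) j = coeff 0 j" using w unfolding weight_le_def by (metis coeff_0)
  qed
  have "degree \<Omega> \<le> 3" by (rule degree_le) (use z assms(2) in auto)
  then have "poly \<Omega> x = (\<Sum>k\<le>3. coeff \<Omega> k * x ^ k)" for x
    unfolding poly_altdef by (intro sum.mono_neutral_left) (auto simp: coeff_eq_0)
  then have "poly (poly \<Omega> [:d:]) x = poly (coeff \<Omega> 0) x + poly (coeff \<Omega> 1) x * d + poly (coeff \<Omega> 2) x * d\<^sup>2 + poly (coeff \<Omega> 3) x * d ^ 3" for d x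
    by (simp add: eval_nat_numeral)
  note ev = this
  show thesis
  proof (rule that[of "coeff \<Omega> 0" "coeff \<Omega> 1" "coeff \<Omega> 2" "coeff \<Omega> 3"])
    show "F z2 z3 = (let z = - z2 - z3; d = z2 * z3 - (z2 + z3)\<^sup>2 - P in
       poly (coeff \<Omega> 0) z + poly (coeff \<Omega> 1) z * d + poly (coeff \<Omega> 2) z * d\<^sup>2 + poly (coeff \<Omega> 3) z * d ^ 3)" for z2 z3
      unfolding F ev Let_def ..
  qed (use deg[of 0] deg[of 1] deg[of 2] deg[of 3] z[of 1] z[of 2] z[of 3] in simp_all)
qed

section \<open>Polynomials with prescribed roots\<close>

lemma three_roots_factor:
  fixes p :: "real poly"
  assumes "poly p a = 0" "poly p b = 0" "poly p c = 0" "a \<noteq> b" "b \<noteq> c" "a \<noteq> c"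
  obtains q where "p = [:-a,1:] * [:-b,1:] * [:-c,1:] * q" "q = 0 \<or> degree p = 3 + degree q"
proof -
  obtain p1 where p1: "p = [:-a,1:] * p1" using assms(1) by (auto simp: poly_eq_0_iff_dvd)
  have "poly p1 b = 0" "poly p1 c = 0" using assms p1 by auto
  then obtain p2 where p2: "p1 = [:-b,1:] * p2" by (auto simp: poly_eq_0_iff_dvd)
  have "poly p2 c = 0" using \<open>poly p1 c = 0\<close> assms p2 by auto
  then obtain q where q: "p2 = [:-c,1:] * q" by (auto simp: poly_eq_0_iff_dvd)
  have eq: "p = [:-a,1:] * [:-b,1:] * [:-c,1:] * q" unfolding p1 p2 q by (simp only: mult.assoc)
  have "degree p = 3 + degree q" if "q \<noteq> 0"
  proof -
    have lin: "[:-x,1:] * r \<noteq> 0 \<and> degree ([:-x,1:] * r) = 1 + degree r" if "r \<noteq> 0" for x and r :: "real poly"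
      using that degree_mult_eq[of "[:-x,1:]" r] by (simp del: mult_pCons_left)
    show ?thesis using lin[OF that, of c] lin[of p2 b] lin[of p1 a] unfolding p1 p2 q by simp
  qed
  then show ?thesis using that eq by blast
qed

lemma three_double_roots_factor:
  fixes p :: "real poly"
  assumes "poly p a = 0" "poly p b = 0" "poly p c = 0" "a \<noteq> b" "b \<noteq> c" "a \<noteq> c"
    and "poly (pderiv p) a = 0" "poly (pderiv p) b = 0" "poly (pderiv p) c = 0"
  obtains q where "p = ([:-a,1:] * [:-b,1:] * [:-c,1:])\<^sup>2 * q" "q = 0 \<or> degree p = 6 + degree q"
proof -
  obtain q where q: "p = [:-a,1:] * [:-b,1:] * [:-c,1:] * q" "q = 0 \<or> degree p = 3 + degree q"
    using three_roots_factor[OF assms(1-6)] by blast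
  have "poly q a = 0" "poly q b = 0" "poly q c = 0"
  proof -
    let ?\<chi> = "[:-a,1:] * [:-b,1:] * [:-c,1:]"
    have \<chi>': "poly (pderiv ?\<chi>) x = (x - b) * (x - c) + (x - a) * (x - c) + (x - a) * (x - b)" for x
      by (simp add: pderiv_pCons algebra_simps)
    have \<chi>: "poly ?\<chi> x = (x - a) * (x - b) * (x - c)" for x by (simp add: algebra_simps)
    have "poly (pderiv p) x = poly (pderiv ?\<chi>) x * poly q x + poly ?\<chi> x * poly (pderiv q) x" for x
      unfolding q(1) pderiv_mult[of ?\<chi>] poly_add poly_mult[of ?\<chi>] poly_mult[of q] by (simp only: mult.commute add.commute)
    with assms(4-9) show "poly q a = 0" "poly q b = 0" "poly q c = 0" unfolding \<chi> \<chi>' by auto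
  qed
  then obtain r where r: "q = [:-a,1:] * [:-b,1:] * [:-c,1:] * r" "r = 0 \<or> degree q = 3 + degree r"
    using three_roots_factor[OF _ _ _ assms(4-6)] by blast
  have "p = ([:-a,1:] * [:-b,1:] * [:-c,1:])\<^sup>2 * r" unfolding q(1) r(1) power2_eq_square by (simp only: mult.assoc)
  moreover have "r = 0 \<or> degree p = 6 + degree r" using q(2) r by auto
  ultimately show ?thesis using that by blast
qed

section \<open>Forms vanishing doubly at the nodes\<close>

lemma degree_le_expand:
  fixes p :: "real poly"
  shows "degree p \<le> 0 \<Longrightarrow> p = [:coeff p 0:]" "degree p \<le> 1 \<Longrightarrow> p = [:coeff p 0, coeff p 1:]"
    "degree p \<le> 2 \<Longrightarrow> p = [:coeff p 0, coeff p 1, coeff p 2:]"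
  by (intro poly_eqI; force simp: coeff_pCons coeff_eq_0 eval_nat_numeral split: nat.splits)+

text \<open>The chart coordinates are \<open>z\<close>, the first centred coordinate, and
  \<open>d\<close>, the shifted second symmetric function; \<open>chart_dz\<close> and
  \<open>chart_dd\<close> are the partial derivatives in them.\<close>

definition chart_value :: "real poly \<Rightarrow> real poly \<Rightarrow> real poly \<Rightarrow> real poly \<Rightarrow> real \<Rightarrow> real \<Rightarrow> real" where
  "chart_value \<psi>0 \<psi>1 \<psi>2 \<psi>3 z d = poly \<psi>0 z + poly \<psi>1 z * d + poly \<psi>2 z * d\<^sup>2 + poly \<psi>3 z * d ^ 3"

definition chart_dz :: "real poly \<Rightarrow> real poly \<Rightarrow> real poly \<Rightarrow> real poly \<Rightarrow> real \<Rightarrow> real \<Rightarrow> real" where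
  "chart_dz \<psi>0 \<psi>1 \<psi>2 \<psi>3 z d = chart_value (pderiv \<psi>0) (pderiv \<psi>1) (pderiv \<psi>2) (pderiv \<psi>3) z d"

definition chart_dd :: "real poly \<Rightarrow> real poly \<Rightarrow> real poly \<Rightarrow> real \<Rightarrow> real \<Rightarrow> real" where
  "chart_dd \<psi>1 \<psi>2 \<psi>3 z d = poly \<psi>1 z + 2 * poly \<psi>2 z * d + 3 * poly \<psi>3 z * d\<^sup>2"

lemma chart_value_DERIV:
  "((\<lambda>s. chart_value \<psi>0 \<psi>1 \<psi>2 \<psi>3 (- (z2 + s * v2) - (z3 + s * v3))
        ((z2 + s * v2) * (z3 + s * v3) - ((z2 + s * v2) + (z3 + s * v3))\<^sup>2 - P)) has_real_derivative
    (- (v2 + v3)) * chart_dz \<psi>0 \<psi>1 \<psi>2 \<psi>3 (- z2 - z3) (z2 * z3 - (z2 + z3)\<^sup>2 - P) +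
    (v2 * z3 + z2 * v3 - 2 * (z2 + z3) * (v2 + v3)) * chart_dd \<psi>1 \<psi>2 \<psi>3 (- z2 - z3) (z2 * z3 - (z2 + z3)\<^sup>2 - P)) (at 0)"
proof -
  define zf where "zf = (\<lambda>s. - (z2 + s * v2) - (z3 + s * v3))"
  define df where "df = (\<lambda>s. (z2 + s * v2) * (z3 + s * v3) - ((z2 + s * v2) + (z3 + s * v3))\<^sup>2 - P)"
  have z: "(zf has_real_derivative (- (v2 + v3))) (at 0)"
    unfolding zf_def by (auto intro!: derivative_eq_intros)
  have d: "(df has_real_derivative (v2 * z3 + z2 * v3 - 2 * (z2 + z3) * (v2 + v3))) (at 0)"
    unfolding df_def by (auto intro!: derivative_eq_intros simp: algebra_simps)
  have p: "((\<lambda>s. poly p (zf s)) has_real_derivative (poly (pderiv p) (zf 0) * (- (v2 + v3)))) (at 0)" for p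
    by (rule DERIV_chain2[OF poly_DERIV z])
  have d2: "((\<lambda>s. (df s)\<^sup>2) has_real_derivative (2 * df 0 * (v2 * z3 + z2 * v3 - 2 * (z2 + z3) * (v2 + v3)))) (at 0)"
    using DERIV_power[OF d, of 2] by (simp add: algebra_simps)
  have d3: "((\<lambda>s. (df s) ^ 3) has_real_derivative (3 * (df 0)\<^sup>2 * (v2 * z3 + z2 * v3 - 2 * (z2 + z3) * (v2 + v3)))) (at 0)"
    using DERIV_power[OF d, of 3] by (simp add: algebra_simps)
  have "((\<lambda>s. poly \<psi>0 (zf s) + poly \<psi>1 (zf s) * df s + poly \<psi>2 (zf s) * (df s)\<^sup>2 + poly \<psi>3 (zf s) * (df s) ^ 3) has_real_derivative
    (- (v2 + v3)) * chart_dz \<psi>0 \<psi>1 \<psi>2 \<psi>3 (zf 0) (df 0) +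
    (v2 * z3 + z2 * v3 - 2 * (z2 + z3) * (v2 + v3)) * chart_dd \<psi>1 \<psi>2 \<psi>3 (zf 0) (df 0)) (at 0)"
    by (rule DERIV_cong[OF DERIV_add[OF DERIV_add[OF DERIV_add[OF p DERIV_mult[OF p d]] DERIV_mult[OF p d2]] DERIV_mult[OF p d3]]])
       (simp add: chart_dz_def chart_dd_def chart_value_def algebra_simps)
  then show ?thesis unfolding chart_value_def zf_def df_def by simp
qed

text \<open>For the function \<open>L g d + M d\<^sup>2 + N d ^ 3\<close>, the equations are its
  value at a mirror node, its derivative along the mirror line there (up to a factor), and its value
  at the centre. Elimination leaves \<open>L\<close> times the quantity assumed nonzero
  last.\<close>

lemma linear_system_trivial:
  fixes L M N :: real
  assumes 1: "L * g0 * d0 + M * d0\<^sup>2 + N * d0 ^ 3 = 0"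
    and 2: "L * (g0 - t * d0) + 2 * M * d0 + 3 * N * d0\<^sup>2 = 0"
    and 3: "L * Q * P + M * P\<^sup>2 - N * P ^ 3 = 0"
    and g0: "g0 = 2 * t ^ 3 - Q" and d0: "d0 = - 3 * t\<^sup>2 - P"
    and ne: "t \<noteq> 0" "P \<noteq> 0" "d0 \<noteq> 0" "P\<^sup>2 - 3 * t\<^sup>2 * P - 9 * Q * t \<noteq> 0"
  shows "L = 0" "M = 0" "N = 0"
proof -
  have "d0 * (L * g0 + M * d0 + N * d0\<^sup>2) = 0" using 1 by (simp add: algebra_simps power2_eq_square power3_eq_cube)
  then have 1: "L * g0 + M * d0 + N * d0\<^sup>2 = 0" using ne by simp
  have "P * (L * Q + M * P - N * P\<^sup>2) = 0" using 3 by (simp add: algebra_simps power2_eq_square power3_eq_cube)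
  then have 3: "L * Q + M * P - N * P\<^sup>2 = 0" using ne by simp
  have 4: "N * d0\<^sup>2 - L * (g0 + t * d0) = 0"
  proof -
    have "N * d0\<^sup>2 - L * (g0 + t * d0) = (L * (g0 - t * d0) + 2 * M * d0 + 3 * N * d0\<^sup>2) - 2 * (L * g0 + M * d0 + N * d0\<^sup>2)"
      by (simp add: algebra_simps)
    then show ?thesis using 1 2 by simp
  qed
  have 5: "L * (Q * d0 - P * g0) - N * P * d0 * (d0 + P) = 0"
  proof -
    have "L * (Q * d0 - P * g0) - N * P * d0 * (d0 + P) = d0 * (L * Q + M * P - N * P\<^sup>2) - P * (L * g0 + M * d0 + N * d0\<^sup>2)"
      by (simp add: algebra_simps power2_eq_square)
    then show ?thesis using 1 3 by simp
  qed
  have q1: "Q * d0 - P * g0 = - (t\<^sup>2) * (3 * Q + 2 * t * P)" "d0 + P = - 3 * t\<^sup>2"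
    unfolding g0 d0 by (simp_all add: algebra_simps power2_eq_square power3_eq_cube)
  have "t\<^sup>2 * (3 * N * P * d0 - L * (3 * Q + 2 * t * P)) = 0"
    using 5 unfolding q1 by (simp add: algebra_simps)
  then have 6: "3 * N * P * d0 - L * (3 * Q + 2 * t * P) = 0" using ne by simp
  have "L * (t * (P\<^sup>2 - 3 * t\<^sup>2 * P - 9 * Q * t)) = L * ((3 * Q + 2 * t * P) * d0 - 3 * P * (g0 + t * d0))"
    unfolding g0 d0 by (simp add: algebra_simps power2_eq_square power3_eq_cube)
  also have "\<dots> = - d0 * (3 * N * P * d0 - L * (3 * Q + 2 * t * P)) + 3 * P * (N * d0\<^sup>2 - L * (g0 + t * d0))"
    by (simp add: algebra_simps power2_eq_square)
  also have "\<dots> = 0" unfolding 4 6 by simp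
  finally show "L = 0" using ne by simp
  then show "N = 0" using 4 ne by simp
  then show "M = 0" using 1 \<open>L = 0\<close> ne by simp
qed

section \<open>The linear conditions imposed by the nodes\<close>

context acnodal_sextic
begin

text \<open>\<open>PP\<close> and \<open>QQ\<close> are the second and third elementary symmetric
  functions of the generic nodes; \<open>d0\<close> is the second one at the mirror nodes, shifted
  by \<open>PP\<close>.\<close>

definition PP :: real where "PP = - 3 * e / D"
definition QQ :: real where "QQ = - (e\<^sup>2 - K) / ((K - 1) * D)"
definition d0 :: real where "d0 = - 3 * t\<^sup>2 - PP"

lemma PP_ne: "PP \<noteq> 0" using e1 D_pos by (simp add: PP_def)

lemma d0_pos: "0 < d0"
proof -
  have "d0 = 3 * HH 1 (- t\<^sup>2) / D" using D_pos by (simp add: d0_def PP_def HH_def field_simps)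
  then show ?thesis using mirror_HH_pos D_pos by simp
qed

text \<open>The relation \<open>G = t H\<close> at the mirror nodes, rewritten in the invariants of
  the generic nodes; both nondegeneracy conditions below follow from it.\<close>

lemma PQ_relation: "(K - 1) * e * t * (3 * QQ + 2 * t * PP) = PP * (D / 3) * d0"
proof -
  have a: "(K - 1) * e * QQ = (e\<^sup>2 - K) * PP / 3" using K1 D_pos by (simp add: QQ_def PP_def field_simps)
  have h: "HH 1 (- t\<^sup>2) = (D / 3) * d0" using D_pos by (simp add: d0_def PP_def HH_def field_simps)
  have "t * ((K - 1) * e * t * (3 * QQ + 2 * t * PP)) = 3 * t\<^sup>2 * ((K - 1) * e * QQ) + (K - 1) * e * (2 * t ^ 3) * PP"
    by (simp add: algebra_simps power2_eq_square power3_eq_cube)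
  also have "\<dots> = PP * GG 1 (- t\<^sup>2) (2 * t ^ 3)" unfolding a by (simp add: GG_def algebra_simps diff_divide_distrib)
  also have "\<dots> = t * (PP * (D / 3) * d0)" unfolding mirror_GG h by simp
  finally have "t * ((K - 1) * e * t * (3 * QQ + 2 * t * PP)) = t * (PP * (D / 3) * d0)" .
  from mult_left_cancel[THEN iffD1, OF _ this] t_pos show ?thesis by simp
qed

lemma PQ_ne: "3 * QQ + 2 * t * PP \<noteq> 0"
  using PQ_relation PP_ne d0_pos D_pos by auto

lemma PQ_ne2: "PP\<^sup>2 - 3 * t\<^sup>2 * PP - 9 * QQ * t \<noteq> 0"
proof -
  define \<sigma> where "\<sigma> = (K - 1) * e"
  have s: "0 < \<sigma>" using K1 e1 by (simp add: \<sigma>_def)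
  have "\<sigma> * (PP\<^sup>2 - 3 * t\<^sup>2 * PP - 9 * QQ * t) = - 3 * (\<sigma> * t * (3 * QQ + 2 * t * PP)) - PP * d0 * \<sigma>"
    unfolding d0_def by (simp add: algebra_simps power2_eq_square)
  also have "\<dots> = - PP * d0 * (D + \<sigma>)" unfolding \<sigma>_def PQ_relation by (simp add: algebra_simps)
  finally have eq: "\<sigma> * (PP\<^sup>2 - 3 * t\<^sup>2 * PP - 9 * QQ * t) = - PP * d0 * (D + \<sigma>)" .
  have "- PP * d0 * (D + \<sigma>) \<noteq> 0" using PP_ne d0_pos D_pos s by simp
  then show ?thesis using eq by auto
qed

lemma node_poly: "[:- \<zeta>1, 1:] * [:- \<zeta>2, 1:] * [:- \<zeta>3, 1:] = [:- QQ, PP, 0, 1:]"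
proof -
  have "\<zeta>1 * \<zeta>2 + \<zeta>2 * \<zeta>3 + \<zeta>3 * \<zeta>1 = PP" "\<zeta>1 * \<zeta>2 * \<zeta>3 = QQ" using ze2 ze3 by (simp_all add: PP_def QQ_def)
  then show ?thesis using zsum by (simp add: algebra_simps)
qed

text \<open>One node from each orbit of the swap of \<open>b\<close> and \<open>c\<close>; the first
  two are fixed by the swap.\<close>

lemma chart_nodes:
  "(\<mu> - 0 - 0, \<mu> + 0, \<mu> + 0) \<in> nodes"
  "(\<mu> - (- t) - (- t), \<mu> + (- t), \<mu> + (- t)) \<in> nodes"
  "(\<mu> - 2 * t - (- t), \<mu> + 2 * t, \<mu> + (- t)) \<in> nodes"
  "(\<mu> - \<zeta>2 - \<zeta>3, \<mu> + \<zeta>2, \<mu> + \<zeta>3) \<in> nodes"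
  "(\<mu> - \<zeta>1 - \<zeta>3, \<mu> + \<zeta>1, \<mu> + \<zeta>3) \<in> nodes"
  "(\<mu> - \<zeta>1 - \<zeta>2, \<mu> + \<zeta>1, \<mu> + \<zeta>2) \<in> nodes"
proof -
  have z: "\<zeta>1 = - \<zeta>2 - \<zeta>3" "- \<zeta>1 - \<zeta>3 = \<zeta>2" "- \<zeta>1 - \<zeta>2 = \<zeta>3" using zsum by simp_all
  have "\<mu> - \<zeta>2 - \<zeta>3 = \<mu> + \<zeta>1" "\<mu> - \<zeta>1 - \<zeta>3 = \<mu> + \<zeta>2" "\<mu> - \<zeta>1 - \<zeta>2 = \<mu> + \<zeta>3" using zsum by simp_all
  then show "(\<mu> - \<zeta>2 - \<zeta>3, \<mu> + \<zeta>2, \<mu> + \<zeta>3) \<in> nodes" "(\<mu> - \<zeta>1 - \<zeta>3, \<mu> + \<zeta>1, \<mu> + \<zeta>3) \<in> nodes"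
    "(\<mu> - \<zeta>1 - \<zeta>2, \<mu> + \<zeta>1, \<mu> + \<zeta>2) \<in> nodes" unfolding nodes_def by simp_all
qed (simp_all add: nodes_def)

lemma nodes_swap: "(a,b,c) \<in> nodes \<Longrightarrow> (a,c,b) \<in> nodes"
  unfolding nodes_def by auto

text \<open>The shift by \<open>PP\<close> is made for this: with \<open>d = 0\<close> the
  conditions at the generic nodes involve only \<open>\<psi>0\<close> and
  \<open>\<psi>1\<close>.\<close>

lemma node_chart_d:
  "\<zeta>2 * \<zeta>3 - (\<zeta>2 + \<zeta>3)\<^sup>2 - PP = 0" "\<zeta>1 * \<zeta>3 - (\<zeta>1 + \<zeta>3)\<^sup>2 - PP = 0" "\<zeta>1 * \<zeta>2 - (\<zeta>1 + \<zeta>2)\<^sup>2 - PP = 0"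
proof -
  have P: "PP = \<zeta>1 * \<zeta>2 + \<zeta>2 * \<zeta>3 + \<zeta>3 * \<zeta>1" using ze2 by (simp add: PP_def)
  have z: "\<zeta>3 = - \<zeta>1 - \<zeta>2" using zsum by simp
  show "\<zeta>2 * \<zeta>3 - (\<zeta>2 + \<zeta>3)\<^sup>2 - PP = 0" "\<zeta>1 * \<zeta>3 - (\<zeta>1 + \<zeta>3)\<^sup>2 - PP = 0" "\<zeta>1 * \<zeta>2 - (\<zeta>1 + \<zeta>2)\<^sup>2 - PP = 0"
    unfolding P z by (simp_all add: algebra_simps power2_eq_square)
qed

definition vanishing :: "(real \<Rightarrow> real \<Rightarrow> real \<Rightarrow> real) \<Rightarrow> bool" where
  "vanishing F \<longleftrightarrow> form_fun 6 F \<and> (\<forall>(a,b,c)\<in>nodes. double_zero F a b c)"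

lemma vanishing_line_DERIV:
  assumes "vanishing F" "(\<mu> - z2 - z3, \<mu> + z2, \<mu> + z3) \<in> nodes"
  shows "F (\<mu> - z2 - z3) (\<mu> + z2) (\<mu> + z3) = 0" "F (\<mu> - z2 - z3) (\<mu> + z3) (\<mu> + z2) = 0"
    "((\<lambda>s. F (\<mu> - (z2 + s * v2) - (z3 + s * v3)) (\<mu> + (z2 + s * v2)) (\<mu> + (z3 + s * v3))) has_real_derivative 0) (at 0)"
    "((\<lambda>s. F (\<mu> - (z2 + s * v2) - (z3 + s * v3)) (\<mu> + (z3 + s * v3)) (\<mu> + (z2 + s * v2))) has_real_derivative 0) (at 0)"
proof -
  have dz: "double_zero F (\<mu> - z2 - z3) (\<mu> + z2) (\<mu> + z3)" "double_zero F (\<mu> - z2 - z3) (\<mu> + z3) (\<mu> + z2)"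
    using assms nodes_swap[OF assms(2)] unfolding vanishing_def by auto
  show "F (\<mu> - z2 - z3) (\<mu> + z2) (\<mu> + z3) = 0" "F (\<mu> - z2 - z3) (\<mu> + z3) (\<mu> + z2) = 0"
    using dz by (auto intro: double_zero_value)
  have e: "\<mu> - z2 - z3 + s * (- v2 - v3) = \<mu> - (z2 + s * v2) - (z3 + s * v3)" "\<mu> + z2 + s * v2 = \<mu> + (z2 + s * v2)"
    "\<mu> + z3 + s * v3 = \<mu> + (z3 + s * v3)" for s by (simp_all add: algebra_simps)
  show "((\<lambda>s. F (\<mu> - (z2 + s * v2) - (z3 + s * v3)) (\<mu> + (z2 + s * v2)) (\<mu> + (z3 + s * v3))) has_real_derivative 0) (at 0)"
    using double_zero_DERIV[OF dz(1), of "- v2 - v3" v2 v3] unfolding e .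
  show "((\<lambda>s. F (\<mu> - (z2 + s * v2) - (z3 + s * v3)) (\<mu> + (z3 + s * v3)) (\<mu> + (z2 + s * v2))) has_real_derivative 0) (at 0)"
    using double_zero_DERIV[OF dz(2), of "- v2 - v3" v3 v2] unfolding e .
qed

text \<open>The alternating part is \<open>(z2 - z3) * B\<close> with \<open>B\<close> of weight
  five. The generic nodes give \<open>\<psi>0\<close> three double roots, too many for degree five,
  and \<open>\<psi>1\<close> three roots. The three constants left over are eliminated by a mirror
  node off the axis and the centre, finally through \<open>PQ_ne\<close>.\<close>

lemma vanishing_alternating_part:
  assumes F: "vanishing F"
  shows "F (\<mu> - z2 - z3) (\<mu> + z2) (\<mu> + z3) = F (\<mu> - z2 - z3) (\<mu> + z3) (\<mu> + z2)"
proof -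
  have "form_fun (Suc 5) F" using F by (simp add: vanishing_def)
  from form_fun_alternating_part[OF this, of PP \<mu>] obtain B where B: "chart_poly PP 5 B"
    and FB: "\<And>z2 z3. F (\<mu> - z2 - z3) (\<mu> + z2) (\<mu> + z3) - F (\<mu> - z2 - z3) (\<mu> + z3) (\<mu> + z2) = (z2 - z3) * B z2 z3"
    unfolding chart_alt_def by blast
  obtain \<psi>0 \<psi>1 \<psi>2 \<psi>3 where deg: "degree \<psi>0 \<le> 5" "degree \<psi>1 \<le> 3" "degree \<psi>2 \<le> 1" "\<psi>3 = 0"
    and BV': "\<And>z2 z3. B z2 z3 = (let z = - z2 - z3; d = z2 * z3 - (z2 + z3)\<^sup>2 - PP in
       poly \<psi>0 z + poly \<psi>1 z * d + poly \<psi>2 z * d\<^sup>2 + poly \<psi>3 z * d ^ 3)"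
    by (rule chart_poly_expand[OF B]) auto
  have BV: "B z2 z3 = chart_value \<psi>0 \<psi>1 \<psi>2 \<psi>3 (- z2 - z3) (z2 * z3 - (z2 + z3)\<^sup>2 - PP)" for z2 z3
    unfolding BV' by (simp add: chart_value_def Let_def)
  have deriv: "(v2 - v3) * B z2 z3 + (z2 - z3) * ((- (v2 + v3)) * chart_dz \<psi>0 \<psi>1 \<psi>2 \<psi>3 (- z2 - z3) (z2 * z3 - (z2 + z3)\<^sup>2 - PP) +
    (v2 * z3 + z2 * v3 - 2 * (z2 + z3) * (v2 + v3)) * chart_dd \<psi>1 \<psi>2 \<psi>3 (- z2 - z3) (z2 * z3 - (z2 + z3)\<^sup>2 - PP)) = 0"
    if n: "(\<mu> - z2 - z3, \<mu> + z2, \<mu> + z3) \<in> nodes" for z2 z3 v2 v3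
  proof -
    note v = vanishing_line_DERIV(3,4)[OF F n, of v2 v3]
    have "((\<lambda>s. ((z2 + s * v2) - (z3 + s * v3)) * B (z2 + s * v2) (z3 + s * v3)) has_real_derivative 0) (at 0)"
      using DERIV_diff[OF v] unfolding FB by simp
    moreover have "((\<lambda>s. ((z2 + s * v2) - (z3 + s * v3)) * B (z2 + s * v2) (z3 + s * v3)) has_real_derivative
      (v2 - v3) * B z2 z3 + (z2 - z3) * ((- (v2 + v3)) * chart_dz \<psi>0 \<psi>1 \<psi>2 \<psi>3 (- z2 - z3) (z2 * z3 - (z2 + z3)\<^sup>2 - PP) +
    (v2 * z3 + z2 * v3 - 2 * (z2 + z3) * (v2 + v3)) * chart_dd \<psi>1 \<psi>2 \<psi>3 (- z2 - z3) (z2 * z3 - (z2 + z3)\<^sup>2 - PP))) (at 0)"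
    proof -
      have l: "((\<lambda>s. (z2 + s * v2) - (z3 + s * v3)) has_real_derivative (v2 - v3)) (at 0)"
        by (auto intro!: derivative_eq_intros)
      show ?thesis unfolding BV
        by (rule DERIV_cong[OF DERIV_mult[OF l chart_value_DERIV]]) (simp add: algebra_simps)
    qed
    ultimately show ?thesis by (rule DERIV_unique[symmetric])
  qed
  have off: "B z2 z3 = 0 \<and> chart_dz \<psi>0 \<psi>1 \<psi>2 \<psi>3 (- z2 - z3) (z2 * z3 - (z2 + z3)\<^sup>2 - PP) = 0 \<and>
      chart_dd \<psi>1 \<psi>2 \<psi>3 (- z2 - z3) (z2 * z3 - (z2 + z3)\<^sup>2 - PP) = 0"
    if n: "(\<mu> - z2 - z3, \<mu> + z2, \<mu> + z3) \<in> nodes" and ne: "z2 \<noteq> z3" for z2 z3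
  proof -
    have "(z2 - z3) * B z2 z3 = 0" using vanishing_line_DERIV(1,2)[OF F n] FB[of z2 z3] by simp
    then have B0: "B z2 z3 = 0" using ne by simp
    \<comment> \<open>The direction \<open>(1, - 1)\<close> fixes \<open>z\<close> and isolates the
      derivative in \<open>d\<close>; then \<open>(1, 0)\<close> yields the one in
      \<open>z\<close>.\<close>
    from deriv[OF n, of 1 "-1"] have dd: "chart_dd \<psi>1 \<psi>2 \<psi>3 (- z2 - z3) (z2 * z3 - (z2 + z3)\<^sup>2 - PP) = 0"
      using ne B0 by simp
    from deriv[OF n, of 1 0] B0 dd ne show ?thesis by simp
  qed
  note z1 = off[OF chart_nodes(4) zdist(2)] and z2 = off[OF chart_nodes(5) zdist(3)] and z3 = off[OF chart_nodes(6) zdist(1)]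
  have zz: "- \<zeta>2 - \<zeta>3 = \<zeta>1" "- \<zeta>1 - \<zeta>3 = \<zeta>2" "- \<zeta>1 - \<zeta>2 = \<zeta>3" using zsum by simp_all
  note zs = z1 z2 z3
  have "poly \<psi>0 \<zeta>1 = 0" "poly \<psi>0 \<zeta>2 = 0" "poly \<psi>0 \<zeta>3 = 0"
      "poly (pderiv \<psi>0) \<zeta>1 = 0" "poly (pderiv \<psi>0) \<zeta>2 = 0" "poly (pderiv \<psi>0) \<zeta>3 = 0"
      "poly \<psi>1 \<zeta>1 = 0" "poly \<psi>1 \<zeta>2 = 0" "poly \<psi>1 \<zeta>3 = 0"
    using zs unfolding BV node_chart_d zz by (simp_all add: chart_value_def chart_dz_def chart_dd_def)
  note r = this
  obtain q where q: "\<psi>0 = ([:-\<zeta>1,1:] * [:-\<zeta>2,1:] * [:-\<zeta>3,1:])\<^sup>2 * q" "q = 0 \<or> degree \<psi>0 = 6 + degree q"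
    using three_double_roots_factor[OF r(1-3) zdist r(4-6)] by blast
  then have p0: "\<psi>0 = 0" using deg by auto
  obtain q where q: "\<psi>1 = [:-\<zeta>1,1:] * [:-\<zeta>2,1:] * [:-\<zeta>3,1:] * q" "q = 0 \<or> degree \<psi>1 = 3 + degree q"
    using three_roots_factor[OF r(7-9) zdist] by blast
  then have "degree q \<le> 0" using deg by auto
  then obtain c where c: "q = [:c:]" using degree_le_expand(1) by blast
  have p1: "\<psi>1 = [:- QQ, PP, 0, 1:] * [:c:]" using q(1) unfolding node_poly c .
  obtain l0 l1 where p2: "\<psi>2 = [:l0, l1:]" using degree_le_expand(2)[OF deg(3)] by blast
  have d00: "- 3 * t\<^sup>2 - PP = d0" by (simp add: d0_def)
  have m: "2 * t * (- t) - (2 * t + - t)\<^sup>2 - PP = d0" "- (2 * t) - - t = - t"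
    by (simp_all add: d0_def power2_eq_square)
  from off[OF chart_nodes(3)] t_pos
  have "B (2 * t) (- t) = 0" "chart_dz \<psi>0 \<psi>1 \<psi>2 \<psi>3 (- (2 * t) - - t) (2 * t * (- t) - (2 * t + - t)\<^sup>2 - PP) = 0" by auto
  then have V: "((- t) ^ 3 - PP * t - QQ) * c * d0 + (l0 - l1 * t) * d0\<^sup>2 = 0"
    and Z: "(3 * t\<^sup>2 + PP) * c * d0 + l1 * d0\<^sup>2 = 0"
    unfolding BV m by (simp_all add: chart_value_def chart_dz_def p0 p1 p2 deg(4) pderiv_pCons algebra_simps power2_eq_square power3_eq_cube)
  \<comment> \<open>At the centre \<open>z2 - z3\<close> vanishes, so the derivative of the product
    along \<open>(1, - 1)\<close> is just \<open>2 * B 0 0\<close>.\<close>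
  from deriv[OF chart_nodes(1), of 1 "-1"] have "B 0 0 = 0" by simp
  then have O: "QQ * c * PP + l0 * PP\<^sup>2 = 0"
    unfolding BV by (simp add: chart_value_def p0 p1 p2 deg(4) mult.commute)
  have "PP * (QQ * c + l0 * PP) = 0" using O by (simp add: algebra_simps power2_eq_square)
  then have O: "QQ * c + l0 * PP = 0" using PP_ne by simp
  have "d0\<^sup>2 * (l1 - c) = 0" using Z unfolding d00[symmetric] by (simp add: algebra_simps power2_eq_square)
  then have l1: "l1 = c" using d0_pos by simp
  have "d0 * (((- t) ^ 3 - PP * t - QQ) * c + (l0 - l1 * t) * d0) = 0" using V by (simp add: algebra_simps power2_eq_square)
  then have "((- t) ^ 3 - PP * t - QQ) * c + (l0 - c * t) * (- 3 * t\<^sup>2 - PP) = 0" using d0_pos unfolding l1 d00 by simp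
  then have "2 * t ^ 3 * c - 3 * t\<^sup>2 * l0 - (QQ * c + l0 * PP) = 0"
    by (simp add: algebra_simps power2_eq_square power3_eq_cube)
  then have "t\<^sup>2 * (2 * t * c - 3 * l0) = 0" unfolding O by (simp add: algebra_simps power2_eq_square power3_eq_cube)
  then have l0: "3 * l0 = 2 * t * c" using t_pos by simp
  have "c * (3 * QQ + 2 * t * PP) = 3 * (QQ * c + l0 * PP) - PP * (3 * l0 - 2 * t * c)" by (simp add: algebra_simps)
  also have "\<dots> = 0" unfolding O l0 by simp
  finally have "c = 0" using PQ_ne by simp
  then have "B z2 z3 = 0" unfolding BV chart_value_def p0 p1 p2 deg(4) using l0 l1 by simp
  then show ?thesis using FB[of z2 z3] by simp
qed

text \<open>The same root counting in weight six. It also yields symmetry in all three coordinates: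
  the result involves only \<open>d\<close> and the third symmetric function. The remaining
  equations come from the mirror nodes and the centre.\<close>

lemma vanishing_symmetric_part:
  assumes F: "vanishing F"
  obtains c l m n where
    "\<And>z2 z3. F (\<mu> - z2 - z3) (\<mu> + z2) (\<mu> + z3) + F (\<mu> - z2 - z3) (\<mu> + z3) (\<mu> + z2) =
       (let g = (- z2 - z3) * z2 * z3 - QQ; d = z2 * z3 - (z2 + z3)\<^sup>2 - PP in c * g\<^sup>2 + l * g * d + m * d\<^sup>2 + n * d ^ 3)"
    "c * (2 * t ^ 3 - QQ)\<^sup>2 + l * (2 * t ^ 3 - QQ) * d0 + m * d0\<^sup>2 + n * d0 ^ 3 = 0"
    "- 2 * c * t * (2 * t ^ 3 - QQ) + l * (2 * t ^ 3 - QQ - t * d0) + 2 * m * d0 + 3 * n * d0\<^sup>2 = 0"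
    "c * QQ\<^sup>2 + l * QQ * PP + m * PP\<^sup>2 - n * PP ^ 3 = 0"
proof -
  define S where "S = (\<lambda>z2 z3. F (\<mu> - z2 - z3) (\<mu> + z2) (\<mu> + z3) + F (\<mu> - z2 - z3) (\<mu> + z3) (\<mu> + z2))"
  have "form_fun 6 F" using F by (simp add: vanishing_def)
  then have S: "chart_poly PP 6 S" unfolding S_def by (rule form_fun_symmetric_part)
  obtain \<psi>0 \<psi>1 \<psi>2 \<psi>3 where deg: "degree \<psi>0 \<le> 6" "degree \<psi>1 \<le> 4" "degree \<psi>2 \<le> 2" "degree \<psi>3 \<le> 0"
    and SV': "\<And>z2 z3. S z2 z3 = (let z = - z2 - z3; d = z2 * z3 - (z2 + z3)\<^sup>2 - PP in
       poly \<psi>0 z + poly \<psi>1 z * d + poly \<psi>2 z * d\<^sup>2 + poly \<psi>3 z * d ^ 3)"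
    by (rule chart_poly_expand[OF S]) auto
  have SV: "S z2 z3 = chart_value \<psi>0 \<psi>1 \<psi>2 \<psi>3 (- z2 - z3) (z2 * z3 - (z2 + z3)\<^sup>2 - PP)" for z2 z3
    unfolding SV' by (simp add: chart_value_def Let_def)
  have val: "S z2 z3 = 0" and deriv: "(- (v2 + v3)) * chart_dz \<psi>0 \<psi>1 \<psi>2 \<psi>3 (- z2 - z3) (z2 * z3 - (z2 + z3)\<^sup>2 - PP) +
    (v2 * z3 + z2 * v3 - 2 * (z2 + z3) * (v2 + v3)) * chart_dd \<psi>1 \<psi>2 \<psi>3 (- z2 - z3) (z2 * z3 - (z2 + z3)\<^sup>2 - PP) = 0"
    if n: "(\<mu> - z2 - z3, \<mu> + z2, \<mu> + z3) \<in> nodes" for z2 z3 v2 v3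
  proof -
    show "S z2 z3 = 0" using vanishing_line_DERIV(1,2)[OF F n] by (simp add: S_def)
    note v = vanishing_line_DERIV(3,4)[OF F n, of v2 v3]
    have "((\<lambda>s. S (z2 + s * v2) (z3 + s * v3)) has_real_derivative 0) (at 0)"
      using DERIV_add[OF v] unfolding S_def by simp
    then show "(- (v2 + v3)) * chart_dz \<psi>0 \<psi>1 \<psi>2 \<psi>3 (- z2 - z3) (z2 * z3 - (z2 + z3)\<^sup>2 - PP) +
    (v2 * z3 + z2 * v3 - 2 * (z2 + z3) * (v2 + v3)) * chart_dd \<psi>1 \<psi>2 \<psi>3 (- z2 - z3) (z2 * z3 - (z2 + z3)\<^sup>2 - PP) = 0"
      unfolding SV by (rule DERIV_unique[OF chart_value_DERIV])
  qed
  have off: "S z2 z3 = 0 \<and> chart_dz \<psi>0 \<psi>1 \<psi>2 \<psi>3 (- z2 - z3) (z2 * z3 - (z2 + z3)\<^sup>2 - PP) = 0 \<and>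
      chart_dd \<psi>1 \<psi>2 \<psi>3 (- z2 - z3) (z2 * z3 - (z2 + z3)\<^sup>2 - PP) = 0"
    if n: "(\<mu> - z2 - z3, \<mu> + z2, \<mu> + z3) \<in> nodes" and ne: "z2 \<noteq> z3" for z2 z3
  proof -
    from deriv[OF n, of 1 "-1"] have dd: "chart_dd \<psi>1 \<psi>2 \<psi>3 (- z2 - z3) (z2 * z3 - (z2 + z3)\<^sup>2 - PP) = 0"
      using ne by simp
    from deriv[OF n, of 1 0] dd val[OF n] show ?thesis by simp
  qed
  note z1 = off[OF chart_nodes(4) zdist(2)] and z2 = off[OF chart_nodes(5) zdist(3)] and z3 = off[OF chart_nodes(6) zdist(1)]
  have zz: "- \<zeta>2 - \<zeta>3 = \<zeta>1" "- \<zeta>1 - \<zeta>3 = \<zeta>2" "- \<zeta>1 - \<zeta>2 = \<zeta>3" using zsum by simp_all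
  note zs = z1 z2 z3
  have "poly \<psi>0 \<zeta>1 = 0" "poly \<psi>0 \<zeta>2 = 0" "poly \<psi>0 \<zeta>3 = 0"
      "poly (pderiv \<psi>0) \<zeta>1 = 0" "poly (pderiv \<psi>0) \<zeta>2 = 0" "poly (pderiv \<psi>0) \<zeta>3 = 0"
      "poly \<psi>1 \<zeta>1 = 0" "poly \<psi>1 \<zeta>2 = 0" "poly \<psi>1 \<zeta>3 = 0"
    using zs unfolding SV node_chart_d zz by (simp_all add: chart_value_def chart_dz_def chart_dd_def)
  note r = this
  obtain q where q: "\<psi>0 = ([:-\<zeta>1,1:] * [:-\<zeta>2,1:] * [:-\<zeta>3,1:])\<^sup>2 * q" "q = 0 \<or> degree \<psi>0 = 6 + degree q"
    using three_double_roots_factor[OF r(1-3) zdist r(4-6)] by blast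
  then have "degree q \<le> 0" using deg by auto
  then obtain c where c: "q = [:c:]" using degree_le_expand(1) by blast
  have p0: "\<psi>0 = [:- QQ, PP, 0, 1:]\<^sup>2 * [:c:]" using q(1) unfolding node_poly c .
  obtain q where q: "\<psi>1 = [:-\<zeta>1,1:] * [:-\<zeta>2,1:] * [:-\<zeta>3,1:] * q" "q = 0 \<or> degree \<psi>1 = 3 + degree q"
    using three_roots_factor[OF r(7-9) zdist] by blast
  then have "degree q \<le> 1" using deg by auto
  then obtain l0 l1 where l: "q = [:l0, l1:]" using degree_le_expand(2) by blast
  have p1: "\<psi>1 = [:- QQ, PP, 0, 1:] * [:l0, l1:]" using q(1) unfolding node_poly l .
  obtain m0 m1 m2 where p2: "\<psi>2 = [:m0, m1, m2:]" using degree_le_expand(3)[OF deg(3)] by blast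
  obtain n where p3: "\<psi>3 = [:n:]" using degree_le_expand(1)[OF deg(4)] by blast
  \<comment> \<open>A centred coordinate satisfies \<open>z ^ 3 + (PP + d) * z = q\<close>, so
    \<open>g = q - QQ\<close> is the node cubic plus \<open>d * z\<close>. After rewriting in
    \<open>g\<close>, the numbers \<open>e1\<close>, \<open>k1\<close>, \<open>k2\<close> are the
    coefficients that still multiply powers of \<open>z\<close>; they turn out to be zero.\<close>
  define e1 k1 k2 where "e1 = l1 - 2 * c" and "k1 = m1 - l0" and "k2 = c - l1 + m2"
  have lmm: "l1 = e1 + 2 * c" "m1 = k1 + l0" "m2 = k2 + e1 + c" by (simp_all add: e1_def k1_def k2_def)
  have cv: "chart_value \<psi>0 \<psi>1 \<psi>2 \<psi>3 z d = c * g\<^sup>2 + (l0 + e1 * z) * g * d + (m0 + k1 * z + k2 * z\<^sup>2) * d\<^sup>2 + n * d ^ 3"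
    if "g = z ^ 3 + (PP + d) * z - QQ" for g z d
    unfolding that chart_value_def p0 p1 p2 p3 lmm
    by (simp add: algebra_simps power2_eq_square power3_eq_cube)
  have cdz: "chart_dz \<psi>0 \<psi>1 \<psi>2 \<psi>3 z d = (2 * c * g + (l0 + e1 * z) * d) * (3 * z\<^sup>2 + PP + d) + e1 * g * d + (k1 + 2 * k2 * z) * d\<^sup>2"
    if "g = z ^ 3 + (PP + d) * z - QQ" for g z d
    unfolding that chart_dz_def chart_value_def p0 p1 p2 p3 lmm power2_eq_square
    by (simp add: pderiv_pCons pderiv_mult algebra_simps power2_eq_square power3_eq_cube)
  have cdd: "chart_dd \<psi>1 \<psi>2 \<psi>3 z d = (2 * c * g + (l0 + e1 * z) * d) * z + (l0 + e1 * z) * g + 2 * (m0 + k1 * z + k2 * z\<^sup>2) * d + 3 * n * d\<^sup>2"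
    if "g = z ^ 3 + (PP + d) * z - QQ" for g z d
    unfolding that chart_dd_def p1 p2 p3 lmm
    by (simp add: algebra_simps power2_eq_square power3_eq_cube)
  define g0 where "g0 = 2 * t ^ 3 - QQ"
  have d00: "PP = - 3 * t\<^sup>2 - d0" by (simp add: d0_def)
  have m: "2 * t * (- t) - (2 * t + - t)\<^sup>2 - PP = d0" "- (2 * t) - - t = - t"
      "(- t) * (- t) - (- t + - t)\<^sup>2 - PP = d0" "- (- t) - - t = 2 * t"
    by (simp_all add: d0_def power2_eq_square)
  have ga: "g0 = (- t) ^ 3 + (PP + d0) * (- t) - QQ" "g0 = (2 * t) ^ 3 + (PP + d0) * (2 * t) - QQ"
    unfolding g0_def d00 by (simp_all add: algebra_simps power2_eq_square power3_eq_cube)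
  have V1: "c * g0\<^sup>2 + (l0 + e1 * (- t)) * g0 * d0 + (m0 + k1 * (- t) + k2 * (- t)\<^sup>2) * d0\<^sup>2 + n * d0 ^ 3 = 0"
    using val[OF chart_nodes(3)] unfolding SV m cv[OF ga(1)] .
  have V2: "c * g0\<^sup>2 + (l0 + e1 * (2 * t)) * g0 * d0 + (m0 + k1 * (2 * t) + k2 * (2 * t)\<^sup>2) * d0\<^sup>2 + n * d0 ^ 3 = 0"
    using val[OF chart_nodes(2)] unfolding SV m cv[OF ga(2)] .
  have "2 * t \<noteq> - t" using t_pos by simp
  from off[OF chart_nodes(3) this] have Z: "(2 * c * g0 + (l0 + e1 * (- t)) * d0) * (3 * (- t)\<^sup>2 + PP + d0) + e1 * g0 * d0 + (k1 + 2 * k2 * (- t)) * d0\<^sup>2 = 0"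
    unfolding m cdz[OF ga(1)] by blast
  then have Z: "e1 * g0 * d0 + (k1 - 2 * k2 * t) * d0\<^sup>2 = 0" unfolding d00 by simp
  \<comment> \<open>The derivative along the mirror line \<open>z2 = z3\<close>; divided by
    \<open>6 * t\<close> it becomes the second equation of the conclusion.\<close>
  from deriv[OF chart_nodes(2), of 1 1]
  have W: "- 2 * ((2 * c * g0 + (l0 + e1 * (2 * t)) * d0) * (3 * (2 * t)\<^sup>2 + PP + d0) + e1 * g0 * d0 + (k1 + 2 * k2 * (2 * t)) * d0\<^sup>2)
      + 6 * t * ((2 * c * g0 + (l0 + e1 * (2 * t)) * d0) * (2 * t) + (l0 + e1 * (2 * t)) * g0 + 2 * (m0 + k1 * (2 * t) + k2 * (2 * t)\<^sup>2) * d0 + 3 * n * d0\<^sup>2) = 0"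
    unfolding m cdz[OF ga(2)] cdd[OF ga(2)] by simp
  have O0: "- QQ = 0 ^ 3 + (PP + (- PP)) * 0 - QQ" by simp
  have "S 0 0 = 0" using val[OF chart_nodes(1)] .
  then have O: "c * QQ\<^sup>2 + l0 * QQ * PP + m0 * PP\<^sup>2 - n * PP ^ 3 = 0"
    using cv[OF O0] unfolding SV by (simp add: power3_eq_cube)
  have "chart_dz \<psi>0 \<psi>1 \<psi>2 \<psi>3 0 (- PP) = 0" using deriv[OF chart_nodes(1), of 1 0] by simp
  then have Oz: "e1 * QQ * PP + k1 * PP\<^sup>2 = 0" unfolding cdz[OF O0] by simp
  have "PP * (e1 * QQ + k1 * PP) = 0" using Oz by (simp add: algebra_simps power2_eq_square)
  then have Oz: "e1 * QQ + k1 * PP = 0" using PP_ne by simp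
  have "d0 * (e1 * g0 + (k1 - 2 * k2 * t) * d0) = 0" using Z by (simp add: algebra_simps power2_eq_square)
  then have Z: "e1 * g0 + (k1 - 2 * k2 * t) * d0 = 0" using d0_pos by simp
  have "3 * t * d0 * (e1 * g0 + (k1 + k2 * t) * d0) = 0"
    using V1 V2 by (simp add: algebra_simps power2_eq_square)
  then have V3: "e1 * g0 + (k1 + k2 * t) * d0 = 0" using d0_pos t_pos by simp
  have "3 * k2 * t * d0 = (e1 * g0 + (k1 + k2 * t) * d0) - (e1 * g0 + (k1 - 2 * k2 * t) * d0)" by (simp add: algebra_simps)
  then have k2: "k2 = 0" using V3 Z d0_pos t_pos by simp
  have "t\<^sup>2 * (2 * e1 * t - 3 * k1) = (e1 * g0 + (k1 + k2 * t) * d0) + (e1 * QQ + k1 * PP)"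
    unfolding k2 g0_def d0_def by (simp add: algebra_simps power2_eq_square power3_eq_cube)
  then have k1: "3 * k1 = 2 * e1 * t" using V3 Oz t_pos by simp
  have "e1 * (3 * QQ + 2 * t * PP) = 3 * (e1 * QQ + k1 * PP) - PP * (3 * k1 - 2 * e1 * t)" by (simp add: algebra_simps)
  also have "\<dots> = 0" unfolding Oz k1 by simp
  finally have e1: "e1 = 0" using PQ_ne by simp
  then have k1: "k1 = 0" using k1 by simp
  show thesis
  proof (rule that[of c l0 m0 n])
    fix z2 z3
    have g: "(- z2 - z3) * z2 * z3 - QQ = (- z2 - z3) ^ 3 + (PP + (z2 * z3 - (z2 + z3)\<^sup>2 - PP)) * (- z2 - z3) - QQ"
      by (simp add: algebra_simps power2_eq_square power3_eq_cube)
    show "F (\<mu> - z2 - z3) (\<mu> + z2) (\<mu> + z3) + F (\<mu> - z2 - z3) (\<mu> + z3) (\<mu> + z2) =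
       (let g = (- z2 - z3) * z2 * z3 - QQ; d = z2 * z3 - (z2 + z3)\<^sup>2 - PP in c * g\<^sup>2 + l0 * g * d + m0 * d\<^sup>2 + n * d ^ 3)"
      using SV[of z2 z3] cv[OF g] unfolding S_def Let_def e1 k1 k2 by simp
    show "c * (2 * t ^ 3 - QQ)\<^sup>2 + l0 * (2 * t ^ 3 - QQ) * d0 + m0 * d0\<^sup>2 + n * d0 ^ 3 = 0"
      using V1 unfolding e1 k1 k2 g0_def by simp
    have "6 * t * (- 2 * c * t * g0 + l0 * (g0 - t * d0) + 2 * m0 * d0 + 3 * n * d0\<^sup>2) = 0"
      using W unfolding e1 k1 k2 d00 by (simp add: algebra_simps power2_eq_square)
    then show "- 2 * c * t * (2 * t ^ 3 - QQ) + l0 * (2 * t ^ 3 - QQ - t * d0) + 2 * m0 * d0 + 3 * n * d0\<^sup>2 = 0"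
      unfolding g0_def[symmetric] using t_pos by simp
    show "c * QQ\<^sup>2 + l0 * QQ * PP + m0 * PP\<^sup>2 - n * PP ^ 3 = 0" by (rule O)
  qed
qed

lemma vanishing_f: "vanishing f"
proof -
  have "f a b c = 0" if "(a,b,c) \<in> nodes" for a b c
  proof -
    have "\<exists>C. \<forall>s. f (a + s * 0) (b + s * 0) (c + s * 0) = s\<^sup>2 * C s"
      using transversal_min_nodes[OF that] unfolding transversal_min_def by (metis add_0)
    then obtain C where "\<forall>s. f (a + s * 0) (b + s * 0) (c + s * 0) = s\<^sup>2 * C s" ..
    then have "f (a + 0 * 0) (b + 0 * 0) (c + 0 * 0) = 0\<^sup>2 * C 0" by blast
    then show ?thesis by simp
  qed
  then show ?thesis unfolding vanishing_def
    using form_fun_f double_zero_of_nonneg[OF form_fun_f f_nonneg_zero(1)] by auto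
qed

text \<open>Subtracting the multiple of \<open>f\<close> with the same coefficient of
  \<open>g\<^sup>2\<close> leaves the system of \<open>linear_system_trivial\<close>. The same lemma
  shows that \<open>f\<close> itself has a nonzero such coefficient, since otherwise it would vanish
  on the whole chart.\<close>

theorem vanishing_unique:
  assumes F: "vanishing F"
  shows "\<exists>\<kappa>. \<forall>a b c. F a b c = \<kappa> * f a b c"
proof -
  note t0 = less_imp_neq[OF t_pos, symmetric] and d0' = less_imp_neq[OF d0_pos, symmetric]
  obtain c l m n where S:
    "\<And>z2 z3. F (\<mu> - z2 - z3) (\<mu> + z2) (\<mu> + z3) + F (\<mu> - z2 - z3) (\<mu> + z3) (\<mu> + z2) =
       (let g = (- z2 - z3) * z2 * z3 - QQ; d = z2 * z3 - (z2 + z3)\<^sup>2 - PP in c * g\<^sup>2 + l * g * d + m * d\<^sup>2 + n * d ^ 3)"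
    and 1: "c * (2 * t ^ 3 - QQ)\<^sup>2 + l * (2 * t ^ 3 - QQ) * d0 + m * d0\<^sup>2 + n * d0 ^ 3 = 0"
    "- 2 * c * t * (2 * t ^ 3 - QQ) + l * (2 * t ^ 3 - QQ - t * d0) + 2 * m * d0 + 3 * n * d0\<^sup>2 = 0"
    "c * QQ\<^sup>2 + l * QQ * PP + m * PP\<^sup>2 - n * PP ^ 3 = 0"
    using vanishing_symmetric_part[OF F] by blast
  obtain c' l' m' n' where S':
    "\<And>z2 z3. f (\<mu> - z2 - z3) (\<mu> + z2) (\<mu> + z3) + f (\<mu> - z2 - z3) (\<mu> + z3) (\<mu> + z2) =
       (let g = (- z2 - z3) * z2 * z3 - QQ; d = z2 * z3 - (z2 + z3)\<^sup>2 - PP in c' * g\<^sup>2 + l' * g * d + m' * d\<^sup>2 + n' * d ^ 3)"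
    and 2: "c' * (2 * t ^ 3 - QQ)\<^sup>2 + l' * (2 * t ^ 3 - QQ) * d0 + m' * d0\<^sup>2 + n' * d0 ^ 3 = 0"
    "- 2 * c' * t * (2 * t ^ 3 - QQ) + l' * (2 * t ^ 3 - QQ - t * d0) + 2 * m' * d0 + 3 * n' * d0\<^sup>2 = 0"
    "c' * QQ\<^sup>2 + l' * QQ * PP + m' * PP\<^sup>2 - n' * PP ^ 3 = 0"
    using vanishing_symmetric_part[OF vanishing_f] by blast
  have "c' \<noteq> 0"
  proof
    assume c': "c' = 0"
    have "l' = 0" "m' = 0" "n' = 0"
      by (rule linear_system_trivial[OF _ _ _ refl d0_def t0 PP_ne d0' PQ_ne2, of l' m' n'];
          use 2 c' in simp)+
    then have "f (\<mu> - 1 - 1) (\<mu> + 1) (\<mu> + 1) = 0" using S'[of 1 1] c' by simp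
    \<comment> \<open>Mirror parameter \<open>T = - 1\<close>: not a node, so
      \<open>FF_mirror\<close> gives a positive value.\<close>
    moreover have "f (\<mu> + (- 2)) (\<mu> + 1) (\<mu> + 1) = FF 1 (- (- 1)\<^sup>2) (2 * (- 1) ^ 3)"
      by (subst f_chart) simp_all
    moreover have "0 < (- 1)\<^sup>2 * (- 1 * (1 + e) - 1)\<^sup>2 * (e * (K + 2 * (K + e) * (- 1) + (K\<^sup>2 - 2 * e * (K - 2) + e\<^sup>2) * (- 1)\<^sup>2))"
      using mirror_quadratic_pos[of "- 1"] e1 by (intro mult_pos_pos) auto
    ultimately have "0 < f (\<mu> + (- 2)) (\<mu> + 1) (\<mu> + 1)" unfolding FF_mirror by (simp only:)
    with \<open>f (\<mu> - 1 - 1) (\<mu> + 1) (\<mu> + 1) = 0\<close> show False by simp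
  qed
  define \<kappa> where "\<kappa> = c / c'"
  have c: "c = \<kappa> * c'" using \<open>c' \<noteq> 0\<close> by (simp add: \<kappa>_def)
  have "l - \<kappa> * l' = 0" "m - \<kappa> * m' = 0" "n - \<kappa> * n' = 0"
  proof -
    let ?g = "2 * t ^ 3 - QQ"
    have a: "(l - \<kappa> * l') * ?g * d0 + (m - \<kappa> * m') * d0\<^sup>2 + (n - \<kappa> * n') * d0 ^ 3 =
      (c * ?g\<^sup>2 + l * ?g * d0 + m * d0\<^sup>2 + n * d0 ^ 3) - \<kappa> * (c' * ?g\<^sup>2 + l' * ?g * d0 + m' * d0\<^sup>2 + n' * d0 ^ 3)"
      unfolding c by (simp add: algebra_simps)
    have b: "(l - \<kappa> * l') * (?g - t * d0) + 2 * (m - \<kappa> * m') * d0 + 3 * (n - \<kappa> * n') * d0\<^sup>2 =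
      (- 2 * c * t * ?g + l * (?g - t * d0) + 2 * m * d0 + 3 * n * d0\<^sup>2) -
      \<kappa> * (- 2 * c' * t * ?g + l' * (?g - t * d0) + 2 * m' * d0 + 3 * n' * d0\<^sup>2)"
      unfolding c by (simp add: algebra_simps)
    have d: "(l - \<kappa> * l') * QQ * PP + (m - \<kappa> * m') * PP\<^sup>2 - (n - \<kappa> * n') * PP ^ 3 =
      (c * QQ\<^sup>2 + l * QQ * PP + m * PP\<^sup>2 - n * PP ^ 3) - \<kappa> * (c' * QQ\<^sup>2 + l' * QQ * PP + m' * PP\<^sup>2 - n' * PP ^ 3)"
      unfolding c by (simp add: algebra_simps)
    note sys = a[unfolded 1 2] b[unfolded 1 2] d[unfolded 1 2]
    show "l - \<kappa> * l' = 0" "m - \<kappa> * m' = 0" "n - \<kappa> * n' = 0"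
      by (rule linear_system_trivial[OF _ _ _ refl d0_def t0 PP_ne d0' PQ_ne2, of "l - \<kappa> * l'" "m - \<kappa> * m'" "n - \<kappa> * n'"];
          use sys in simp)+
  qed
  then have lmn: "l = \<kappa> * l'" "m = \<kappa> * m'" "n = \<kappa> * n'" by simp_all
  have chart: "F (\<mu> - z2 - z3) (\<mu> + z2) (\<mu> + z3) = \<kappa> * f (\<mu> - z2 - z3) (\<mu> + z2) (\<mu> + z3)" for z2 z3
  proof -
    have "2 * F (\<mu> - z2 - z3) (\<mu> + z2) (\<mu> + z3) = \<kappa> * (f (\<mu> - z2 - z3) (\<mu> + z2) (\<mu> + z3) + f (\<mu> - z2 - z3) (\<mu> + z3) (\<mu> + z2))"
      using S[of z2 z3] unfolding vanishing_alternating_part[OF F, of z2 z3, symmetric] S' Let_def c lmn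
      by (simp add: algebra_simps)
    then show ?thesis unfolding vanishing_alternating_part[OF vanishing_f, of z2 z3, symmetric] by simp
  qed
  obtain p where p: "is_form 6 p" "\<And>x y z. F x y z = feval 6 p x y z" using F by (auto simp: vanishing_def form_fun_def)
  obtain pf where pf: "is_form 6 pf" "\<And>x y z. f x y z = feval 6 pf x y z" using form_fun_f by (auto simp: form_fun_def)
  \<comment> \<open>The coordinate sum as a form: a nonzero difference would be nonzero at some
    point with nonzero coordinate sum, which scaling to the chart excludes.\<close>
  obtain ps :: "real poly3" where ps: "is_form 1 ps" "\<And>x y z. x + y + z = feval 1 ps x y z"
    using form_fun_add[OF form_fun_add[OF form_fun_coords(1,2)] form_fun_coords(3)] unfolding form_fun_def by blast
  have "ps \<noteq> (\<lambda>_. 0)" using ps(2)[of 1 0 0] by auto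
  have diff: "feval 6 (\<lambda>m. p m - \<kappa> * pf m) x y z = F x y z - \<kappa> * f x y z" for x y z
    by (simp add: feval_diff feval_cmult p(2) pf(2))
  have form: "is_form 6 (\<lambda>m. p m - \<kappa> * pf m)" by (intro is_form_diff is_form_cmult p pf)
  have zero: "F x y z - \<kappa> * f x y z = 0" if ne: "x + y + z \<noteq> 0" for x y z
  proof -
    define s where "s = (x + y + z) / (3 * \<mu>)"
    have s: "s \<noteq> 0" using ne mu by (simp add: s_def)
    have "(x + y + z) / s = 3 * \<mu>" using ne mu by (simp add: s_def)
    then have "x / s = \<mu> - (y / s - \<mu>) - (z / s - \<mu>)" by (simp add: add_divide_distrib)
    then have x: "s * (\<mu> - (y / s - \<mu>) - (z / s - \<mu>)) = x" using s by (metis nonzero_mult_div_cancel_left times_divide_eq_right)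
    have yz: "s * (\<mu> + (y / s - \<mu>)) = y" "s * (\<mu> + (z / s - \<mu>)) = z" using s by simp_all
    have F6: "form_fun 6 F" using F by (simp add: vanishing_def)
    have "F x y z = s ^ 6 * F (\<mu> - (y / s - \<mu>) - (z / s - \<mu>)) (\<mu> + (y / s - \<mu>)) (\<mu> + (z / s - \<mu>))"
      using form_fun_scale[OF F6, of s "\<mu> - (y / s - \<mu>) - (z / s - \<mu>)" "\<mu> + (y / s - \<mu>)" "\<mu> + (z / s - \<mu>)"]
      unfolding x yz .
    moreover have "f x y z = s ^ 6 * f (\<mu> - (y / s - \<mu>) - (z / s - \<mu>)) (\<mu> + (y / s - \<mu>)) (\<mu> + (z / s - \<mu>))"
      using form_fun_scale[OF form_fun_f, of s "\<mu> - (y / s - \<mu>) - (z / s - \<mu>)" "\<mu> + (y / s - \<mu>)" "\<mu> + (z / s - \<mu>)"]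
      unfolding x yz .
    ultimately show ?thesis unfolding chart by simp
  qed
  have "(\<lambda>m. p m - \<kappa> * pf m) = (\<lambda>_. 0)"
  proof (rule ccontr)
    assume "(\<lambda>m. p m - \<kappa> * pf m) \<noteq> (\<lambda>_. 0)"
    then obtain x y z :: real where "feval 6 (\<lambda>m. p m - \<kappa> * pf m) x y z \<noteq> 0" "feval 1 ps x y z \<noteq> 0"
      using forms_nonzero_point[OF form _ ps(1) \<open>ps \<noteq> (\<lambda>_. 0)\<close>] by (metis of_real_eq_id id_apply)
    then show False using zero[of x y z] unfolding diff ps(2)[symmetric] by simp
  qed
  then have "F x y z = \<kappa> * f x y z" for x y z using diff[of x y z] by simp
  then show ?thesis by blast
qed

end

section \<open>Extremality and irreducibility\<close>

lemma form_fun_sign_change: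
  fixes F :: "real \<Rightarrow> real \<Rightarrow> real \<Rightarrow> real"
  assumes F: "form_fun d F" and neg: "F a b c * F x y z < 0"
  obtains s where "0 < s" "s < 1" "F (a + s * (x - a)) (b + s * (y - b)) (c + s * (z - c)) = 0"
proof -
  obtain P where P: "\<And>s. F (a + s * (x - a)) (b + s * (y - b)) (c + s * (z - c)) = poly P s"
    using form_fun_line[OF F] by meson
  have "poly P 0 * poly P 1 < 0" using neg P[of 0] P[of 1] by simp
  then have "poly P 0 < 0 \<and> 0 < poly P 1 \<or> 0 < poly P 0 \<and> poly P 1 < 0" by (auto simp: mult_less_0_iff)
  then have "\<exists>s. 0 < s \<and> s < 1 \<and> poly P s = 0" using poly_IVT_pos[of 0 1 P] poly_IVT_neg[of 0 1 P] by auto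
  then show ?thesis using that P by auto
qed

text \<open>Antipodal values have opposite signs, so without zeros one of
  \<open>(1, - 1, 0)\<close>, \<open>(- 1, 1, 0)\<close> has sign opposite to
  \<open>(1, 1, - 2)\<close>. Both segments avoid the origin.\<close>

lemma odd_form_zero_on_plane:
  fixes F :: "real \<Rightarrow> real \<Rightarrow> real \<Rightarrow> real"
  assumes F: "form_fun d F" and "odd d"
  obtains a b c where "a + b + c = 0" "(a,b,c) \<noteq> (0,0,0)" "F a b c = 0"
proof (rule ccontr)
  assume "\<not> thesis"
  then have nz: "\<And>a b c. a + b + c = 0 \<Longrightarrow> (a,b,c) \<noteq> (0,0,0) \<Longrightarrow> F a b c \<noteq> 0" using that by blast
  have neg: "F (- 1) 1 0 = - F 1 (- 1) 0" using form_fun_scale[OF F, of "- 1" 1 "- 1" 0] \<open>odd d\<close> by simp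
  have "F 1 (- 1) 0 \<noteq> 0" "F 1 1 (- 2) \<noteq> 0" using nz by simp_all
  then have "F 1 (- 1) 0 * F 1 1 (- 2) < 0 \<or> F (- 1) 1 0 * F 1 1 (- 2) < 0"
    unfolding neg by (auto simp: mult_less_0_iff zero_less_mult_iff neq_iff)
  then show False
  proof
    assume "F 1 (- 1) 0 * F 1 1 (- 2) < 0"
    then obtain s where "F (1 + s * (1 - 1)) (- 1 + s * (1 - - 1)) (0 + s * (- 2 - 0)) = 0"
      by (rule form_fun_sign_change[OF F])
    then show False using nz[of "1 + s * (1 - 1)" "- 1 + s * (1 - - 1)" "0 + s * (- 2 - 0)"] by simp
  next
    assume "F (- 1) 1 0 * F 1 1 (- 2) < 0"
    then obtain s where "F (- 1 + s * (1 - - 1)) (1 + s * (1 - 1)) (0 + s * (- 2 - 0)) = 0"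
      by (rule form_fun_sign_change[OF F])
    then show False using nz[of "- 1 + s * (1 - - 1)" "1 + s * (1 - 1)" "0 + s * (- 2 - 0)"] by simp
  qed
qed

lemma quadratic_form_parallelogram:
  fixes q :: "real \<Rightarrow> real \<Rightarrow> real \<Rightarrow> real"
  assumes "form_fun 2 q"
  shows "q (a + x) (b + y) (c + z) + q (a - x) (b - y) (c - z) = 2 * q a b c + 2 * q x y z"
proof -
  obtain p where p: "is_form 2 p" "\<And>x y z. q x y z = feval 2 p x y z" using assms by (auto simp: form_fun_def)
  have "p (i,j,k) * (a + x) ^ i * (b + y) ^ j * (c + z) ^ k + p (i,j,k) * (a - x) ^ i * (b - y) ^ j * (c - z) ^ k =
     2 * (p (i,j,k) * a ^ i * b ^ j * c ^ k) + 2 * (p (i,j,k) * x ^ i * y ^ j * z ^ k)"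
    if "i + j + k = 2" for i j k
  proof -
    have k: "k = 2 - i - j" and i: "i = 0 \<or> i = 1 \<or> i = 2" and j: "j = 0 \<or> j = 1 \<or> j = 2"
      using that by linarith+
    show ?thesis using i j that unfolding k
      by (elim disjE; simp add: distrib_left distrib_right left_diff_distrib right_diff_distrib power2_eq_square)
  qed
  then show ?thesis unfolding p(2) feval_form[OF p(1)] sum_distrib_left sum.distrib[symmetric]
    by (intro sum.cong) (auto simp: monomials_def)
qed

lemma poly_map_of_real:
  "poly (map_poly complex_of_real p) (of_real s) = of_real (poly p s)"
  by (induction p) (simp_all add: map_poly_pCons)

lemma poly_map_cnj: "poly (map_poly cnj p) (of_real s) = cnj (poly p (of_real s))"
  by (induction p) (simp_all add: map_poly_pCons)

lemma poly_map_Re: "poly (map_poly Re p) s = Re (poly p (of_real s))"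
  by (induction p) (simp_all add: map_poly_pCons)

lemma poly_map_Im: "poly (map_poly Im p) s = Im (poly p (of_real s))"
  by (induction p) (simp_all add: map_poly_pCons)

lemma coeff_prod_low:
  fixes G H :: "'a::comm_ring_1 poly"
  shows "coeff (G * H) 0 = coeff G 0 * coeff H 0"
    "coeff (G * H) 1 = coeff G 0 * coeff H 1 + coeff G 1 * coeff H 0"
  by (simp_all add: coeff_mult)

lemma poly_double_root_at_0:
  fixes W :: "'a::comm_ring_1 poly"
  assumes "coeff W 0 = 0" "coeff W 1 = 0"
  shows "\<exists>W2. \<forall>s. poly W s = s\<^sup>2 * poly W2 s"
proof -
  obtain w0 W1 where W1: "W = pCons w0 W1" by (cases W) auto
  obtain w1 W2 where W2: "W1 = pCons w1 W2" by (cases W1) auto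
  have "w0 = 0" "w1 = 0" using assms by (simp_all add: W1 W2)
  then show ?thesis by (intro exI[of _ W2]) (simp add: W1 W2 power2_eq_square mult.assoc)
qed

text \<open>If \<open>s\<^sup>2\<close> divides a product, then \<open>s\<close> divides both
  factors or \<open>s\<^sup>2\<close> divides one. Each alternative survives complex conjugation of
  one factor.\<close>

lemma double_root_factor_low_coeffs:
  fixes G H :: "'a::idom poly"
  assumes "coeff (G * H) 0 = 0" "coeff (G * H) 1 = 0"
  shows "coeff G 0 = 0 \<and> coeff H 0 = 0 \<or> coeff G 0 = 0 \<and> coeff G 1 = 0 \<or> coeff H 0 = 0 \<and> coeff H 1 = 0"
  using assms unfolding coeff_prod_low by auto

section \<open>Consequences of uniqueness: extremality, no squares, no factors\<close>

context acnodal_sextic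
begin

definition fp :: "real poly3" where
  "fp = (SOME p. is_form 6 p \<and> (\<forall>x y z. f x y z = feval 6 p x y z))"

lemma fp: "is_form 6 fp" "feval 6 fp x y z = f x y z"
proof -
  have "is_form 6 fp \<and> (\<forall>x y z. f x y z = feval 6 fp x y z)"
    unfolding fp_def using form_fun_f unfolding form_fun_def by (rule someI_ex)
  then show "is_form 6 fp" "feval 6 fp x y z = f x y z" by auto
qed

lemma f_pos: "0 < f 1 (- 1) 0" by (rule f_plane_pos) auto

lemma fp_nonzero: "fp \<noteq> (\<lambda>_. 0)"
  using f_pos fp(2)[of 1 "-1" 0] by auto

lemma nodes_zero: "(a,b,c) \<in> nodes \<Longrightarrow> f a b c = 0"
  using vanishing_f unfolding vanishing_def by (auto intro: double_zero_value)

lemma fp_symmetric: "symmetric_poly3 fp"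
proof -
  have 1: "(\<lambda>(i,j,k). fp (i,k,j)) = fp"
    by (rule form_eqI[OF is_form_swap(1)[OF fp(1)] fp(1)]) (unfold feval_swap fp(2), rule f_swap(2))
  have 2: "(\<lambda>(i,j,k). fp (j,i,k)) = fp"
    by (rule form_eqI[OF is_form_swap(2)[OF fp(1)] fp(1)]) (unfold feval_swap fp(2), rule f_swap(1))
  have a: "fp (i,k,j) = fp (i,j,k)" for i j k using fun_cong[OF 1, of "(i,j,k)"] by simp
  have b: "fp (j,i,k) = fp (i,j,k)" for i j k using fun_cong[OF 2, of "(i,j,k)"] by simp
  show ?thesis unfolding symmetric_poly3_def using a b by metis
qed

lemma fp_Ps036: "fp \<in> Ps036"
proof -
  have "f (inverse \<mu> * \<mu>) (inverse \<mu> * \<mu>) (inverse \<mu> * \<mu>) = 0"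
    unfolding form_fun_scale[OF form_fun_f] using nodes_zero[of \<mu> \<mu> \<mu>] by (simp add: nodes_def)
  then have "f 1 1 1 = 0" using mu by simp
  then show ?thesis unfolding Ps036_def P36_def H36_def using fp f_nonneg_zero(1) fp_symmetric by simp
qed

text \<open>A nonnegative form below \<open>f\<close> vanishes at the nodes, hence doubly, and
  \<open>vanishing_unique\<close> applies.\<close>

lemma below_f:
  assumes g: "g \<in> P36" and le: "\<And>x y z. feval 6 g x y z \<le> f x y z"
  shows "\<exists>s\<ge>0. g = (\<lambda>m. s * fp m)"
proof -
  have form: "is_form 6 g" and nn: "\<And>x y z. 0 \<le> feval 6 g x y z" using g by (auto simp: P36_def H36_def)
  have "vanishing (feval 6 g)" unfolding vanishing_def
  proof (intro conjI form_fun_feval form ballI)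
    fix n assume n: "n \<in> nodes"
    obtain a b c where [simp]: "n = (a,b,c)" by (cases n) auto
    have "feval 6 g a b c = 0" using nn[of a b c] le[of a b c] nodes_zero[of a b c] n by simp
    then show "case n of (a,b,c) \<Rightarrow> double_zero (feval 6 g) a b c"
      using double_zero_of_nonneg[OF form_fun_feval[OF form] nn] by simp
  qed
  from vanishing_unique[OF this] obtain s where s: "\<And>a b c. feval 6 g a b c = s * f a b c" by blast
  have "0 \<le> s" using nn[of 1 "-1" 0] f_pos unfolding s by (simp add: zero_le_mult_iff)
  moreover have "g = (\<lambda>m. s * fp m)"
    by (rule form_eqI[OF form is_form_cmult[OF fp(1)]]) (simp add: s feval_cmult fp(2))
  ultimately show ?thesis by blast
qed

lemma fp_extremal: "fp \<in> extremal P36"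
proof -
  have "(\<exists>t\<ge>0. g = (\<lambda>m. t * fp m)) \<and> (\<exists>t\<ge>0. h = (\<lambda>m. t * fp m))"
    if gh: "g \<in> P36" "h \<in> P36" "fp = (\<lambda>m. g m + h m)" for g h
  proof -
    have sum: "f x y z = feval 6 g x y z + feval 6 h x y z" for x y z
      unfolding fp(2)[symmetric] gh(3) feval_add ..
    have "0 \<le> feval 6 g x y z" "0 \<le> feval 6 h x y z" for x y z using gh by (auto simp: P36_def)
    then show ?thesis using below_f[OF gh(1)] below_f[OF gh(2)] sum by simp
  qed
  then show ?thesis unfolding extremal_def using fp_Ps036 fp_nonzero by (auto simp: Ps036_def)
qed

text \<open>Each square in a representation lies below \<open>f\<close>, so it is a multiple of
  \<open>f\<close>. A cubic has a zero on the plane where \<open>f\<close> is positive, so the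
  multiple is zero.\<close>

lemma fp_not_sos: "fp \<notin> Sigma36"
proof
  assume "fp \<in> Sigma36"
  then obtain gs where gs: "\<forall>g\<in>set gs. is_form 3 g" and eq: "fp = (\<lambda>m. \<Sum>g\<leftarrow>gs. pmul g g m)"
    unfolding Sigma36_def by blast
  have ev: "feval 6 (\<lambda>m. \<Sum>g\<leftarrow>gs. pmul g g m) x y z = (\<Sum>g\<leftarrow>gs. (feval 3 g x y z)\<^sup>2)"
    if "\<forall>g\<in>set gs. is_form 3 g" for gs :: "real poly3 list" and x y z
    using that
  proof (induction gs)
    case (Cons g gs)
    have "feval (3 + 3) (pmul g g) x y z = feval 3 g x y z * feval 3 g x y z" using Cons.prems by (intro feval_pmul) auto
    then show ?case using Cons by (simp add: feval_add power2_eq_square)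
  qed simp
  have fsum: "f x y z = (\<Sum>g\<leftarrow>gs. (feval 3 g x y z)\<^sup>2)" for x y z
    using ev[OF gs, of x y z] fp(2)[of x y z] unfolding eq[symmetric] by simp
  have "feval 3 g x y z = 0" if g: "g \<in> set gs" for g x y z
  proof -
    have form: "is_form 3 g" using gs g by blast
    have e6: "feval 6 (pmul g g) a b c = (feval 3 g a b c)\<^sup>2" for a b c
      using feval_pmul[OF form form, of a b c] by (simp add: power2_eq_square)
    have "is_form (3 + 3) (pmul g g)" by (rule is_form_pmul[OF form form])
    then have "pmul g g \<in> P36" using e6 by (simp add: P36_def H36_def)
    moreover have "feval 6 (pmul g g) a b c \<le> f a b c" for a b c
      unfolding e6 fsum using g by (intro member_le_sum_list) auto
    ultimately obtain s where s: "pmul g g = (\<lambda>m. s * fp m)" using below_f by blast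
    have sq: "(feval 3 g a b c)\<^sup>2 = s * f a b c" for a b c
      unfolding e6[symmetric] s feval_cmult fp(2) ..
    obtain a b c where abc: "a + b + c = 0" "(a,b,c) \<noteq> (0,0,0)" "feval 3 g a b c = 0"
      by (rule odd_form_zero_on_plane[OF form_fun_feval[OF form]]) auto
    then have "s * f a b c = 0" using sq[of a b c] by simp
    then have "s = 0" using f_plane_pos[OF abc(1,2)] by simp
    then show ?thesis using sq[of x y z] by simp
  qed
  then have "(\<Sum>g\<leftarrow>gs. (feval 3 g 1 (- 1) 0)\<^sup>2) = (\<Sum>g\<leftarrow>gs. 0)" by (intro arg_cong[where f = sum_list] map_cong) auto
  then show False using fsum[of 1 "-1" 0] f_pos by simp
qed

text \<open>\<open>q\<close> is nonnegative and vanishes at no more than one node, so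
  \<open>w\<close> vanishes doubly at the others. The product of \<open>w\<close> with the square of
  a linear form through that node is then a multiple of \<open>f\<close>, and comparison on the
  plane \<open>A = 0\<close> gives a contradiction.\<close>

lemma no_quadratic_factor_pos:
  assumes q: "form_fun 2 q" and w: "form_fun 4 w" and f: "\<And>a b c. f a b c = q a b c * w a b c"
    and pos: "0 < q 1 (- 1) 0"
  shows False
proof -
  have nz: "q a b c \<noteq> 0" if "a + b + c = 0" "(a,b,c) \<noteq> (0,0,0)" for a b c
    using f_plane_pos[OF that] unfolding f by auto
  \<comment> \<open>A sign change along the segment from \<open>(1, - 1, 0)\<close> could only
    happen at the origin; then the endpoint is a negative multiple of the start, and even degree
    gives it the same sign.\<close>
  have plane: "0 < q a b c" if abc: "a + b + c = 0" "(a,b,c) \<noteq> (0,0,0)" for a b c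
  proof (rule ccontr)
    assume "\<not> 0 < q a b c"
    then have "q 1 (- 1) 0 * q a b c < 0" using nz[OF abc] pos by (simp add: mult_less_0_iff)
    then obtain s where s: "0 < s" "s < 1" "q (1 + s * (a - 1)) (- 1 + s * (b - - 1)) (0 + s * (c - 0)) = 0"
      by (rule form_fun_sign_change[OF q])
    have "1 + s * (a - 1) + (- 1 + s * (b - - 1)) + (0 + s * (c - 0)) = s * (a + b + c)" by (simp add: algebra_simps)
    also have "\<dots> = 0" using abc(1) by simp
    finally have "(1 + s * (a - 1), - 1 + s * (b - - 1), 0 + s * (c - 0)) = (0,0,0)" using nz s(3) by blast
    then have z: "s * a = - (1 - s)" "s * b = (1 - s)" "s * c = 0" by (auto simp: algebra_simps)
    have "s\<^sup>2 * q a b c = q (s * a) (s * b) (s * c)" by (rule form_fun_scale[OF q, symmetric])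
    also have "\<dots> = (- (1 - s))\<^sup>2 * q 1 (- 1) 0" unfolding z using form_fun_scale[OF q, of "- (1 - s)" 1 "- 1" 0] by simp
    finally have "0 \<le> s\<^sup>2 * q a b c" using pos by simp
    then show False using \<open>\<not> 0 < q a b c\<close> nz[OF abc] s(1) by (simp add: zero_le_mult_iff)
  qed
  have nonneg: "0 \<le> q a b c" for a b c
  proof (rule ccontr)
    assume "\<not> 0 \<le> q a b c"
    then have neg: "q a b c < 0" by simp
    have "q 0 0 0 = 0" using form_fun_scale[OF q, of 0 0 0 0] by simp
    then have sum: "a + b + c \<noteq> 0" using neg plane[of a b c] by fastforce
    \<comment> \<open>Segments from a point with \<open>q < 0\<close> to the points
      \<open>(1, j, - 1 - j)\<close> each contain a zero of \<open>q\<close>, hence a multiple of a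
      node. With finitely many nodes two segments meet the same one, although their points are
      projectively distinct for different \<open>j\<close>.\<close>
    define R where "R = (\<lambda>(j::nat) (n,s,r). n \<in> nodes \<and> 0 < s \<and> s < 1 \<and> r \<noteq> 0 \<and> a + s * (1 - a) = r * fst n \<and>
        b + s * (real j - b) = r * fst (snd n) \<and> c + s * (- 1 - real j - c) = r * snd (snd n))"
    have "\<exists>nsr. R j nsr" for j
    proof -
      have "q a b c * q 1 (real j) (- 1 - real j) < 0"
        using neg plane[of 1 "real j" "- 1 - real j"] by (simp add: mult_less_0_iff)
      then obtain s where s: "0 < s" "s < 1" "q (a + s * (1 - a)) (b + s * (real j - b)) (c + s * (- 1 - real j - c)) = 0"
        by (rule form_fun_sign_change[OF q])
      have "a + s * (1 - a) + (b + s * (real j - b)) + (c + s * (- 1 - real j - c)) = (1 - s) * (a + b + c)" by (simp add: algebra_simps)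
      moreover have "(1 - s) * (a + b + c) \<noteq> 0" using s sum by simp
      ultimately have "a + s * (1 - a) + (b + s * (real j - b)) + (c + s * (- 1 - real j - c)) \<noteq> 0" by (simp only:) simp
      moreover have "x + y + z \<noteq> 0 \<Longrightarrow> (x,y,z) \<noteq> (0,0,0)" for x y z :: real by auto
      ultimately have ne: "(a + s * (1 - a), b + s * (real j - b), c + s * (- 1 - real j - c)) \<noteq> (0,0,0)" by blast
      have "f (a + s * (1 - a)) (b + s * (real j - b)) (c + s * (- 1 - real j - c)) = 0" unfolding f s(3) by simp
      from f_nonneg_zero(2)[OF this ne, THEN conjunct2] obtain n r where n: "n \<in> nodes" "r \<noteq> 0"
          "a + s * (1 - a) = r * fst n" "b + s * (real j - b) = r * fst (snd n)" "c + s * (- 1 - real j - c) = r * snd (snd n)"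
        unfolding case_prod_unfold by blast
      then have "R j (n,s,r)" unfolding R_def prod.case using s by blast
      then show ?thesis by blast
    qed
    then obtain X where X: "\<And>j. R j (X j)" by metis
    define n s r where "n = (\<lambda>j. fst (X j))" and "s = (\<lambda>j. fst (snd (X j)))" and "r = (\<lambda>j. snd (snd (X j)))"
    have X': "n j \<in> nodes \<and> 0 < s j \<and> s j < 1 \<and> r j \<noteq> 0 \<and> a + s j * (1 - a) = r j * fst (n j) \<and>
        b + s j * (real j - b) = r j * fst (snd (n j)) \<and> c + s j * (- 1 - real j - c) = r j * snd (snd (n j))" for j
      using X[of j] unfolding R_def n_def s_def r_def case_prod_unfold .
    have s: "0 < s j \<and> s j < 1" and r: "r j \<noteq> 0" and
      eq: "a + s j * (1 - a) = r j * fst (n j)" "b + s j * (real j - b) = r j * fst (snd (n j))"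
        "c + s j * (- 1 - real j - c) = r j * snd (snd (n j))" for j
      using X'[of j] by blast+
    have "finite nodes" by (simp add: nodes_def)
    then have "finite (range n)" by (rule finite_subset[rotated]) (use X' in blast)
    then have "\<not> inj n" using finite_imageD infinite_UNIV_nat by blast
    then obtain i j where ij: "n i = n j" "i \<noteq> j" unfolding inj_def by blast
    define k where "k = r i / r j"
    have k: "r i = k * r j" using r by (simp add: k_def)
    have e: "a + s i * (1 - a) = k * (a + s j * (1 - a))" "b + s i * (real i - b) = k * (b + s j * (real j - b))"
        "c + s i * (- 1 - real i - c) = k * (c + s j * (- 1 - real j - c))"
      unfolding eq ij(1) k by simp_all
    have "(1 - s i) * (a + b + c) = (a + s i * (1 - a)) + (b + s i * (real i - b)) + (c + s i * (- 1 - real i - c))" by (simp add: algebra_simps)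
    also have "\<dots> = k * ((1 - s j) * (a + b + c))" unfolding e by (simp add: algebra_simps)
    finally have k1: "1 - s i = k * (1 - s j)" using sum by simp
    have "s i = (a + s i * (1 - a)) - (1 - s i) * a" by (simp add: algebra_simps)
    also have "\<dots> = k * s j" unfolding e(1) k1 by (simp add: algebra_simps)
    finally have k2: "s i = k * s j" .
    have "s i * real i = (b + s i * (real i - b)) - (1 - s i) * b" by (simp add: algebra_simps)
    also have "\<dots> = k * s j * real j" unfolding e(2) k1 by (simp add: algebra_simps)
    finally have "s i * real i = s i * real j" unfolding k2 .
    then show False using s[of i] ij(2) by simp
  qed
  have unique: "n = n'" if n: "n \<in> nodes" "n' \<in> nodes" "(case n of (a,b,c) \<Rightarrow> q a b c) = 0" "(case n' of (a,b,c) \<Rightarrow> q a b c) = 0" for n n'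
  proof (rule ccontr)
    assume ne: "n \<noteq> n'"
    obtain a b c x y z where nn: "n = (a,b,c)" "n' = (x,y,z)" by (metis prod_cases3)
    have sums: "a + b + c = 3 * \<mu>" "x + y + z = 3 * \<mu>" using nodes_sum n nn by auto
    \<comment> \<open>With nonnegativity, the parallelogram law forces \<open>q \<le> 0\<close> at
      the half-difference of two zeros; for nodes this lies on the plane, where \<open>q\<close> is
      positive.\<close>
    have "q ((a + x) / 2 + (a - x) / 2) ((b + y) / 2 + (b - y) / 2) ((c + z) / 2 + (c - z) / 2) +
      q ((a + x) / 2 - (a - x) / 2) ((b + y) / 2 - (b - y) / 2) ((c + z) / 2 - (c - z) / 2) =
      2 * q ((a + x) / 2) ((b + y) / 2) ((c + z) / 2) + 2 * q ((a - x) / 2) ((b - y) / 2) ((c - z) / 2)"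
      by (rule quadratic_form_parallelogram[OF q])
    moreover have "(u + v) / 2 + (u - v) / 2 = u" "(u + v) / 2 - (u - v) / 2 = v" for u v :: real by (simp_all add: field_simps)
    ultimately have "0 = 2 * q ((a + x) / 2) ((b + y) / 2) ((c + z) / 2) + 2 * q ((a - x) / 2) ((b - y) / 2) ((c - z) / 2)"
      using n(3,4) nn by simp
    moreover have "0 < q ((a - x) / 2) ((b - y) / 2) ((c - z) / 2)"
      by (rule plane) (use sums ne nn in \<open>auto simp: field_simps\<close>)
    ultimately show False using nonneg[of "(a + x) / 2" "(b + y) / 2" "(c + z) / 2"] by simp
  qed
  obtain l1 l2 :: real where l: "(l1,l2) \<noteq> (0,0)" "\<And>a b c. (a,b,c) \<in> nodes \<Longrightarrow> q a b c = 0 \<Longrightarrow> l1 * a + l2 * b = 0"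
  proof (cases "\<exists>a b c. (a,b,c) \<in> nodes \<and> q a b c = 0")
    case True
    then obtain a b c where abc: "(a,b,c) \<in> nodes" "q a b c = 0" by blast
    then have u: "a' = a \<and> b' = b" if "(a',b',c') \<in> nodes" "q a' b' c' = 0" for a' b' c'
      using unique[of "(a',b',c')" "(a,b,c)"] that by simp
    show ?thesis
    proof (cases "a = 0 \<and> b = 0")
      case True then show ?thesis using u by (intro that[of 1 0]) auto
    next
      case False then show ?thesis using u by (intro that[of b "- a"]) auto
    qed
  next
    case False then show ?thesis by (intro that[of 1 0]) auto
  qed
  define F where "F = (\<lambda>a b c. w a b c * (l1 * a + l2 * b) * (l1 * a + l2 * b))"
  have "form_fun 1 (\<lambda>a b c. l1 * a + l2 * b)" by (intro form_fun_add form_fun_cmult form_fun_coords)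
  then have "form_fun (4 + 1 + 1) F" unfolding F_def by (intro form_fun_mult w)
  then have F6: "form_fun 6 F" by simp
  have "vanishing F" unfolding vanishing_def
  proof (intro conjI F6 ballI)
    fix n assume n: "n \<in> nodes"
    obtain a b c where [simp]: "n = (a,b,c)" by (cases n) auto
    have "double_zero F a b c" unfolding double_zero_def
    proof (intro allI)
      fix u v z
      obtain B where B: "\<And>s. w (a + s * u) (b + s * v) (c + s * z) = poly B s" using form_fun_line[OF w] by meson
      obtain A where A: "\<And>s. q (a + s * u) (b + s * v) (c + s * z) = poly A s" using form_fun_line[OF q] by meson
      show "\<exists>C. \<forall>s. F (a + s * u) (b + s * v) (c + s * z) = s\<^sup>2 * poly C s"
      proof (cases "q a b c = 0")
        case True
        then have "l1 * a + l2 * b = 0" using l n by simp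
        then have L: "l1 * (a + s * u) + l2 * (b + s * v) = s * (l1 * u + l2 * v)" for s by (simp add: algebra_simps)
        show ?thesis unfolding F_def B L
          by (intro exI[of _ "smult ((l1 * u + l2 * v)\<^sup>2) B"]) (simp add: power2_eq_square)
      next
        case False
        have "double_zero f a b c" using vanishing_f n by (auto simp: vanishing_def)
        then obtain C where C: "\<And>s. f (a + s * u) (b + s * v) (c + s * z) = s\<^sup>2 * poly C s"
        unfolding double_zero_def by meson
        have "poly (A * B) s = poly ([:0,0,1:] * C) s" for s
          using C[of s] unfolding f A B by (simp add: power2_eq_square)
        then have "A * B = [:0,0,1:] * C" using poly_eq_poly_eq_iff by blast
        then have "coeff (A * B) 0 = 0" "coeff (A * B) 1 = 0" by simp_all
        moreover have "coeff A 0 \<noteq> 0" using A[of 0] False by (simp add: poly_0_coeff_0)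
        ultimately have "coeff B 0 = 0" "coeff B 1 = 0" using double_root_factor_low_coeffs[of A B] by auto
        then obtain B2 where B2: "\<And>s. poly B s = s\<^sup>2 * poly B2 s" using poly_double_root_at_0 by blast
        show ?thesis unfolding F_def B B2
          by (intro exI[of _ "B2 * [:l1 * a + l2 * b, l1 * u + l2 * v:] ^ 2"]) (simp add: power2_eq_square algebra_simps)
      qed
    qed
    then show "case n of (a,b,c) \<Rightarrow> double_zero F a b c" by simp
  qed
  from vanishing_unique[OF this] obtain \<kappa> where \<kappa>: "\<And>a b c. F a b c = \<kappa> * f a b c" by blast
  \<comment> \<open>The zero of the linear form on the plane \<open>A = 0\<close>.\<close>
  have "F l2 (- l1) (l1 - l2) = 0" by (simp add: F_def)
  moreover have "0 < f l2 (- l1) (l1 - l2)" by (rule f_plane_pos) (use l(1) in auto)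
  ultimately have "\<kappa> = 0" unfolding \<kappa> by simp
  obtain a b c where abc: "a + b + c = 0" "(a,b,c) \<noteq> (0,0,0)" "l1 * a + l2 * b \<noteq> 0"
  proof (cases "l1 = l2")
    case True then show ?thesis using l(1) by (intro that[of 1 0 "-1"]) auto
  next
    case False then show ?thesis by (intro that[of 1 "-1" 0]) auto
  qed
  have "w a b c \<noteq> 0" using f_plane_pos[OF abc(1,2)] unfolding f by auto
  then have "F a b c \<noteq> 0" using abc(3) by (simp add: F_def)
  then show False unfolding \<kappa> \<open>\<kappa> = 0\<close> by simp
qed

lemma no_quadratic_factor:
  assumes q: "form_fun 2 q" and w: "form_fun 4 w" and f: "\<And>a b c. f a b c = q a b c * w a b c"
  shows False
proof (cases "0 < q 1 (- 1) 0")
  case True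
  then show False using no_quadratic_factor_pos[OF q w f] by blast
next
  case False
  have "q 1 (- 1) 0 \<noteq> 0" using f_pos unfolding f by auto
  with False have "0 < (- 1) * q 1 (- 1) 0" by simp
  then show False
    by (intro no_quadratic_factor_pos[OF form_fun_cmult[OF q, of "- 1"] form_fun_cmult[OF w, of "- 1"]]) (simp_all add: f)
qed

lemma no_real_factor:
  assumes g: "form_fun a g" and h: "form_fun b h" and f: "\<And>x y z. f x y z = g x y z * h x y z"
    and ab: "a + b = 6" "0 < a" "0 < b"
  shows False
proof -
  have "even a"
  proof (rule ccontr)
    assume "odd a"
    then obtain x y z where xyz: "x + y + z = 0" "(x,y,z) \<noteq> (0,0,0)" "g x y z = 0" by (rule odd_form_zero_on_plane[OF g])
    from f_plane_pos[OF xyz(1,2)] xyz(3) show False unfolding f by simp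
  qed
  then obtain k where "a = 2 * k" by (rule evenE)
  moreover from this have "k = 1 \<or> k = 2" using ab by arith
  ultimately have "a = 2 \<and> b = 4 \<or> a = 4 \<and> b = 2" using ab by auto
  then show False
  proof
    assume "a = 2 \<and> b = 4"
    then show False using no_quadratic_factor[of g h] g h f by blast
  next
    assume "a = 4 \<and> b = 2"
    moreover have "f x y z = h x y z * g x y z" for x y z using f by simp
    ultimately show False using no_quadratic_factor[of h g] g h by blast
  qed
qed

lemma no_complex_factor:
  assumes g: "is_form a g" and h: "is_form b h" and gh: "pmul g h = complexify fp"
    and ab: "a + b = 6" "0 < a" "0 < b"
  shows False
proof -
  define gv where "gv = (\<lambda>x y z :: real. feval a g (of_real x) (of_real y) (of_real z))"
  define hv where "hv = (\<lambda>x y z :: real. feval b h (of_real x) (of_real y) (of_real z))"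
  have f: "gv x y z * hv x y z = of_real (f x y z)" for x y z
    unfolding gv_def hv_def feval_pmul[OF g h, symmetric] gh ab(1) feval_complexify fp(2) ..
  define hc where "hc = (\<lambda>m. cnj (h m))"
  have hc: "is_form b hc" using h by (auto simp: is_form_def hc_def)
  have "is_form 6 (pmul g hc)" using is_form_pmul[OF g hc] ab by simp
  then have forms: "is_form 6 (\<lambda>m. Re (pmul g hc m))" "is_form 6 (\<lambda>m. Im (pmul g hc m))"
    unfolding is_form_def by (metis zero_complex.simps)+
  have val: "feval 6 (pmul g hc) (of_real x) (of_real y) (of_real z) = gv x y z * cnj (hv x y z)" for x y z
    using feval_pmul[OF g hc, of "of_real x" "of_real y" "of_real z"] ab feval_cnj[of b h x y z]
    by (simp add: gv_def hv_def hc_def)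
  have low: "\<exists>W. \<forall>s. gv (x + s * u) (y + s * v) (z + s * w) * cnj (hv (x + s * u) (y + s * v) (z + s * w)) = (of_real s)\<^sup>2 * poly W (of_real s)"
    if n: "(x,y,z) \<in> nodes" for x y z u v w
  proof -
    obtain G where G: "\<And>s. feval a g (of_real x + s * of_real u) (of_real y + s * of_real v) (of_real z + s * of_real w) = poly G s"
      using feval_line[of a g "of_real x" "of_real u" "of_real y" "of_real v" "of_real z" "of_real w"] by meson
    obtain H where H: "\<And>s. feval b h (of_real x + s * of_real u) (of_real y + s * of_real v) (of_real z + s * of_real w) = poly H s"
      using feval_line[of b h "of_real x" "of_real u" "of_real y" "of_real v" "of_real z" "of_real w"] by meson
    have gvl: "gv (x + s * u) (y + s * v) (z + s * w) = poly G (of_real s)" for s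
      unfolding gv_def G[symmetric] by simp
    have hvl: "hv (x + s * u) (y + s * v) (z + s * w) = poly H (of_real s)" for s
      unfolding hv_def H[symmetric] by simp
    have "double_zero f x y z" using vanishing_f n by (auto simp: vanishing_def)
    then obtain C where C: "\<And>s. f (x + s * u) (y + s * v) (z + s * w) = s\<^sup>2 * poly C s"
        unfolding double_zero_def by meson
    have "poly (G * H - [:0,0,1:] * map_poly of_real C) (of_real s) = 0" for s :: real
      using f[of "x + s * u" "y + s * v" "z + s * w"]
      unfolding gvl hvl C by (simp add: poly_map_of_real power2_eq_square)
    then have "range complex_of_real \<subseteq> {x. poly (G * H - [:0,0,1:] * map_poly of_real C) x = 0}" by auto
    moreover have "infinite (range complex_of_real)"
      using finite_imageD[of complex_of_real UNIV] infinite_UNIV_char_0 by (auto simp: inj_def)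
    ultimately have "G * H - [:0,0,1:] * map_poly of_real C = 0"
      using poly_roots_finite finite_subset by blast
    then have "G * H = [:0,0,1:] * map_poly of_real C" by simp
    then have "coeff (G * H) 0 = 0" "coeff (G * H) 1 = 0" by simp_all
    from double_root_factor_low_coeffs[OF this]
    have "coeff (G * map_poly cnj H) 0 = 0" "coeff (G * map_poly cnj H) 1 = 0"
      unfolding coeff_prod_low by (auto simp: coeff_map_poly)
    then obtain W where "\<And>s. poly (G * map_poly cnj H) s = s\<^sup>2 * poly W s" using poly_double_root_at_0 by blast
    then have "gv (x + s * u) (y + s * v) (z + s * w) * cnj (hv (x + s * u) (y + s * v) (z + s * w)) = (of_real s)\<^sup>2 * poly W (of_real s)" for s
      unfolding gvl hvl poly_map_cnj[symmetric] poly_mult[symmetric] .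
    then show ?thesis by blast
  qed
  have part: "\<exists>\<kappa>. \<forall>x y z. R (gv x y z * cnj (hv x y z)) = \<kappa> * f x y z" if R: "R \<in> {Re, Im}" for R
  proof -
    have form: "is_form 6 (\<lambda>m. R (pmul g hc m))" using forms R by auto
    have ev: "feval 6 (\<lambda>m. R (pmul g hc m)) x y z = R (gv x y z * cnj (hv x y z))" for x y z
      using R by (auto simp only: feval_Re feval_Im val insert_iff empty_iff)
    have sc: "R ((complex_of_real s)\<^sup>2 * X) = s\<^sup>2 * R X" for s X using R by (auto simp flip: of_real_power)
    have pm: "poly (map_poly R X) s = R (poly X (of_real s))" for X s using R poly_map_Re poly_map_Im by auto
    have "vanishing (feval 6 (\<lambda>m. R (pmul g hc m)))" unfolding vanishing_def
    proof (intro conjI form_fun_feval form ballI, clarify)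
      fix x y z assume n: "(x,y,z) \<in> nodes"
      show "double_zero (feval 6 (\<lambda>m. R (pmul g hc m))) x y z" unfolding double_zero_def
      proof (intro allI)
        fix u v w
        obtain W where W: "\<And>s. gv (x + s * u) (y + s * v) (z + s * w) * cnj (hv (x + s * u) (y + s * v) (z + s * w)) = (of_real s)\<^sup>2 * poly W (of_real s)"
          using low[OF n] by blast
        show "\<exists>C. \<forall>s. feval 6 (\<lambda>m. R (pmul g hc m)) (x + s * u) (y + s * v) (z + s * w) = s\<^sup>2 * poly C s"
          unfolding ev W sc by (intro exI[of _ "map_poly R W"]) (simp add: pm)
      qed
    qed
    from vanishing_unique[OF this] show ?thesis unfolding ev .
  qed
  obtain k1 where k1: "\<And>x y z. Re (gv x y z * cnj (hv x y z)) = k1 * f x y z" using part[of Re] by blast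
  obtain k2 where k2: "\<And>x y z. Im (gv x y z * cnj (hv x y z)) = k2 * f x y z" using part[of Im] by blast
  define k where "k = Complex k1 k2"
  have k: "gv x y z * cnj (hv x y z) = k * of_real (f x y z)" for x y z
    using k1[of x y z] k2[of x y z] by (intro complex_eqI) (simp_all add: k_def)
  have hk: "cnj (hv x y z) = k * hv x y z" if "f x y z \<noteq> 0" for x y z
  proof -
    have ne: "gv x y z \<noteq> 0" using f[of x y z] that by auto
    have "gv x y z * cnj (hv x y z) = gv x y z * (k * hv x y z)" unfolding k f[symmetric] by simp
    then show ?thesis using ne by simp
  qed
  have "cmod (hv 1 (- 1) 0) \<noteq> 0" using f[of 1 "- 1" 0] f_pos by auto
  moreover have "cmod (hv 1 (- 1) 0) = cmod k * cmod (hv 1 (- 1) 0)"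
    using hk[of 1 "- 1" 0] f_pos by (metis complex_mod_cnj norm_mult less_irrefl)
  ultimately have "cmod k = 1" by simp
  \<comment> \<open>Since \<open>cnj h = k * h\<close> with \<open>cmod k = 1\<close>, multiplying
    \<open>h\<close> by a square root of \<open>k\<close> makes it real.\<close>
  define d where "d = csqrt k"
  have d2: "d * d = k" using power2_csqrt[of k] by (simp add: d_def power2_eq_square)
  have "cmod d * cmod d = 1" using \<open>cmod k = 1\<close> d2 by (metis norm_mult)
  then have d1: "cnj d * d = 1"
    by (metis complex_norm_square mult.commute of_real_1 power2_eq_square)
  have hreal: "Im (d * hv x y z) = 0" if "f x y z \<noteq> 0" for x y z
  proof -
    have "cnj (d * hv x y z) = (cnj d * d) * (d * hv x y z)" by (simp add: hk[OF that] d2[symmetric] mult.assoc)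
    then have "cnj (d * hv x y z) = d * hv x y z" by (simp add: d1)
    then show ?thesis by (metis Reals_cnj_iff complex_is_Real_iff)
  qed
  have dh: "is_form b (\<lambda>m. d * h m)" and dg: "is_form a (\<lambda>m. cnj d * g m)" using g h by (auto intro: is_form_cmult)
  have parts: "is_form b (\<lambda>m. Im (d * h m))" "is_form b (\<lambda>m. Re (d * h m))"
      "is_form a (\<lambda>m. Re (cnj d * g m))"
    using dh dg unfolding is_form_def by (metis zero_complex.simps)+
  have evh: "feval b (\<lambda>m. Im (d * h m)) x y z = Im (d * hv x y z)" "feval b (\<lambda>m. Re (d * h m)) x y z = Re (d * hv x y z)" for x y z
    by (simp_all only: feval_Im feval_Re feval_cmult hv_def)
  have evg: "feval a (\<lambda>m. Re (cnj d * g m)) x y z = Re (cnj d * gv x y z)" for x y z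
    by (simp only: feval_Re feval_cmult gv_def)
  have zero_off_f: "feval n r x y z = 0"
    if r: "is_form n r" and off: "\<And>x y z. f x y z \<noteq> 0 \<Longrightarrow> feval n r x y z = 0" for n and r :: "real poly3" and x y z
  proof (cases "r = (\<lambda>_. 0)")
    case False
    obtain x' y' z' :: real where "feval n r (of_real x') (of_real y') (of_real z') \<noteq> 0" "feval 6 fp (of_real x') (of_real y') (of_real z') \<noteq> 0"
      by (rule forms_nonzero_point[OF r False fp(1) fp_nonzero])
    then show ?thesis using off[of x' y' z'] by (simp add: fp(2))
  qed simp
  have h0: "Im (d * hv x y z) = 0" for x y z
    using zero_off_f[OF parts(1)] hreal unfolding evh by blast
  have prod: "(cnj d * gv x y z) * (d * hv x y z) = of_real (f x y z)" for x y z
  proof -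
    have "(cnj d * gv x y z) * (d * hv x y z) = (cnj d * d) * (gv x y z * hv x y z)" by simp
    then show ?thesis unfolding d1 f by simp
  qed
  have "f x y z = feval a (\<lambda>m. Re (cnj d * g m)) x y z * feval b (\<lambda>m. Re (d * h m)) x y z" for x y z
  proof -
    have "f x y z = Re ((cnj d * gv x y z) * (d * hv x y z))" unfolding prod by simp
    also have "\<dots> = Re (cnj d * gv x y z) * Re (d * hv x y z)"
    proof -
      have "Re (X * Y) = Re X * Re Y" if "Im Y = 0" for X Y using that by simp
      from this[OF h0] show ?thesis .
    qed
    finally show ?thesis unfolding evh evg .
  qed
  from no_real_factor[OF form_fun_feval[OF parts(3)] form_fun_feval[OF parts(2)] this ab] show False .
qed

lemma fp_irreducible: "irreducible_poly3 (complexify fp)"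
proof -
  have form: "is_form 6 (complexify fp)" using fp(1) by (auto simp: is_form_def complexify_def)
  have "{m. complexify fp m \<noteq> 0} \<subseteq> monomials 6" using form by (auto simp: is_form_def monomials_def)
  then have fin: "finite_support (complexify fp)" unfolding finite_support_def using finite_subset finite_monomials by blast
  have ne: "complexify fp \<noteq> (\<lambda>_. 0)"
    using fp_nonzero by (auto simp: complexify_def fun_eq_iff)
  have nu: "\<not> is_unit_poly3 (complexify fp)" using form unfolding is_unit_poly3_def is_form_def by fastforce
  have unit: "is_unit_poly3 r" if "is_form 0 r" "r \<noteq> (\<lambda>_. 0)" for r :: "complex poly3"
  proof -
    have z: "r m = 0" if "m \<noteq> (0,0,0)" for m
      using \<open>is_form 0 r\<close> that by (cases m) (auto simp: is_form_def)
    then have "r (0,0,0) \<noteq> 0" using that(2) by (metis (no_types))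
    with z show ?thesis unfolding is_unit_poly3_def by blast
  qed
  have "is_unit_poly3 g \<or> is_unit_poly3 h"
    if gh: "finite_support g" "finite_support h" "complexify fp = pmul g h" for g h
  proof -
    obtain a b where ab: "a + b = 6" "is_form a g" "is_form b h"
      using factors_of_form[OF gh(1,2), of 6] form ne unfolding gh(3) by blast
    have "g \<noteq> (\<lambda>_. 0)" "h \<noteq> (\<lambda>_. 0)" using ne unfolding gh(3) by (auto simp: pmul_def)
    moreover have "a = 0 \<or> b = 0" using no_complex_factor[OF ab(2,3) gh(3)[symmetric] ab(1)] by blast
    ultimately show ?thesis using unit ab by auto
  qed
  then show ?thesis unfolding irreducible_poly3_def using fin ne nu by blast
qed

end

section \<open>Rational parametrisation and the open set of zeros\<close>

lemma sextic_of_real: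
  "sextic (of_real K) (of_real e) (of_real D) (of_real \<mu>) (of_real a) (of_real b) (of_real c) =
   complex_of_real (sextic K e D \<mu> a b c)"
  by (simp add: sextic_def sym2_def sym3_def Let_def)

text \<open>Cardano's shape for the roots of a cubic without quadratic term.\<close>

lemma cube_root_unity_sym:
  fixes \<omega> \<alpha> \<beta> :: complex
  assumes w: "\<omega>\<^sup>2 = - 1 - \<omega>"
  defines "z0 \<equiv> \<alpha> + \<beta>" and "z1 \<equiv> \<omega> * \<alpha> + \<omega>\<^sup>2 * \<beta>" and "z2 \<equiv> \<omega>\<^sup>2 * \<alpha> + \<omega> * \<beta>"
  shows "z0 + z1 + z2 = 0" "z0 * z1 + z1 * z2 + z2 * z0 = - 3 * \<alpha> * \<beta>" "z0 * z1 * z2 = \<alpha> ^ 3 + \<beta> ^ 3"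
proof -
  have ww: "\<omega> * \<omega> = - 1 - \<omega>" using w by (simp add: power2_eq_square)
  have ww': "\<omega> * (\<omega> * x) = - x - \<omega> * x" for x
  proof -
    have "\<omega> * (\<omega> * x) = (\<omega> * \<omega>) * x" by simp
    then show ?thesis unfolding ww by (simp add: algebra_simps)
  qed
  show "z0 + z1 + z2 = 0" unfolding z0_def z1_def z2_def w by (simp add: algebra_simps)
  show "z0 * z1 + z1 * z2 + z2 * z0 = - 3 * \<alpha> * \<beta>"
    unfolding z0_def z1_def z2_def w by (simp add: algebra_simps ww ww')
  show "z0 * z1 * z2 = \<alpha> ^ 3 + \<beta> ^ 3"
    unfolding z0_def z1_def z2_def w by (simp add: algebra_simps ww ww' power3_eq_cube)
qed

text \<open>On the rational curve \<open>A = N + e v\<close>, \<open>x = - N v\<close> one finds \<open>G = N H\<close>, and the quadratic form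
  \<open>G\<^sup>2 - A G H - e x H\<^sup>2\<close> vanishes identically.\<close>

lemma sextic_on_curve:
  fixes K e N v q A x :: complex
  assumes A: "A = N + e * v" and x: "x = - N * v" and q: "(K - 1) * q = N * (N\<^sup>2 + (K - 3) * N * v + K * v\<^sup>2)"
  shows "((K - 1) * e * q - (e\<^sup>2 - K) * x * A)\<^sup>2
      - A * ((K - 1) * e * q - (e\<^sup>2 - K) * x * A) * ((K - e * (K - 3) + e\<^sup>2) * x + e * A\<^sup>2)
      - e * x * ((K - e * (K - 3) + e\<^sup>2) * x + e * A\<^sup>2)\<^sup>2 = 0"
proof -
  define H where "H = (K - e * (K - 3) + e\<^sup>2) * x + e * A\<^sup>2"
  have "(K - 1) * e * q - (e\<^sup>2 - K) * x * A = e * ((K - 1) * q) - (e\<^sup>2 - K) * x * A" by simp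
  also have "\<dots> = N * H" unfolding q H_def A x by (simp add: algebra_simps power2_eq_square)
  finally have G: "(K - 1) * e * q - (e\<^sup>2 - K) * x * A = N * H" .
  have "(N * H)\<^sup>2 - A * (N * H) * H - e * x * H\<^sup>2 = H\<^sup>2 * (N\<^sup>2 - A * N - e * x)"
    by (simp add: algebra_simps power2_eq_square)
  also have "N\<^sup>2 - A * N - e * x = 0" unfolding A x by (simp add: algebra_simps power2_eq_square)
  finally show ?thesis unfolding G H_def[symmetric] by simp
qed

text \<open>With \<open>S = s ^ 3\<close>, \<open>T = t ^ 3\<close>,
  \<open>K = 1 + k\<^sup>2\<close> this is the hypothesis on \<open>(K - 1) * q\<close> in
  \<open>sextic_on_curve\<close>, cleared of denominators and a common factor.\<close>

lemma curve_q_identity: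
  fixes k S T :: complex
  shows "k\<^sup>2 * (T * (T + k * S) ^ 3 + S * (S - k * T) ^ 3) =
    (1 + k\<^sup>2) ^ 3 * (S * T)\<^sup>2 + (1 + k\<^sup>2) * (k\<^sup>2 - 2) * (S * T) * ((T + k * S) * (S - k * T)) + ((T + k * S) * (S - k * T))\<^sup>2"
  by (simp add: algebra_simps power2_eq_square power3_eq_cube)

context acnodal_sextic
begin

lemma complexify_fp:
  "feval 6 (complexify fp) x y z = sextic (of_real K) (of_real e) (of_real D) (of_real \<mu>) x y z"
proof -
  obtain p where p: "is_form 6 p" "\<And>x y z. sextic (complex_of_real K) (of_real e) (of_real D) (of_real \<mu>) x y z = feval 6 p x y z"
    using form_fun_sextic unfolding form_fun_def by blast
  have c: "is_form 6 (complexify fp)" using fp(1) by (auto simp: is_form_def complexify_def)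
  have "complexify fp = p"
    by (rule form_eqI[OF c p(1)]) (unfold p(2)[symmetric] sextic_of_real feval_complexify fp(2), simp add: f_eq_sextic)
  then show ?thesis using p(2) by simp
qed

text \<open>The conic has points with coordinates
  \<open>y = \<omega>^i r - 1 / (\<omega>^i r)\<close>, where \<open>r = s / t\<close>. In
  \<open>y\<^sup>2 + k y\<close> the factor of \<open>\<omega>^i\<close> is
  \<open>k r + 1 / r\<^sup>2\<close>, that of \<open>\<omega>^(2 i)\<close> is
  \<open>r\<^sup>2 - k / r\<close>; times \<open>s ^ 3 t ^ 3 / L\<close> these are
  \<open>\<alpha>\<close> and \<open>\<beta>\<close>.\<close>

lemma fp_rational: "rational_curve6 fp"
proof -
  define k where "k = complex_of_real (sqrt (K - 1))"
  have kK: "k\<^sup>2 = of_real K - 1"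
  proof -
    have "k\<^sup>2 = of_real ((sqrt (K - 1))\<^sup>2)" by (simp add: k_def)
    also have "(sqrt (K - 1))\<^sup>2 = K - 1" using K1 by simp
    finally show ?thesis by simp
  qed
  have k0: "k \<noteq> 0" using K1 by (simp add: k_def)
  define \<omega> where "\<omega> = Complex (- 1 / 2) (sqrt 3 / 2)"
  have w: "\<omega>\<^sup>2 = - 1 - \<omega>" by (simp add: \<omega>_def complex_eq_iff power2_eq_square)
  define L E M :: complex where "L = of_real K" and "E = of_real e" and "M = of_real \<mu>"
  have L: "L \<noteq> 0" "L = 1 + k\<^sup>2" using K1 kK by (simp_all add: L_def)
  have D: "of_real D = L - E * (L - 3) + E\<^sup>2" by (simp add: D_def L_def E_def)
  define \<rho> where "\<rho> = M * E * k / L\<^sup>2"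
  have rho: "\<rho> \<noteq> 0" using mu e1 k0 L by (simp add: \<rho>_def M_def E_def)
  \<comment> \<open>Entry \<open>i\<close> belongs to \<open>s ^ i * t ^ (6 - i)\<close>; the cube
    root of unity \<open>w\<close> selects the coordinate.\<close>
  define cf where "cf = (\<lambda>w. \<lambda>i::nat. [- \<rho>, w / L, - k * w\<^sup>2 / L, M * (1 - E * (L - 2) / L\<^sup>2), k * w / L, w\<^sup>2 / L, \<rho>] ! i)"
  define \<alpha> where "\<alpha> = (\<lambda>s t. s * t\<^sup>2 * (t ^ 3 + k * s ^ 3) / L)"
  define \<beta> where "\<beta> = (\<lambda>s t. s\<^sup>2 * t * (s ^ 3 - k * t ^ 3) / L)"
  define N where "N = (\<lambda>s t :: complex. s ^ 3 * t ^ 3)"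
  define V where "V = (\<lambda>s t. (t ^ 3 + k * s ^ 3) * (s ^ 3 - k * t ^ 3))"
  define A where "A = (\<lambda>s t. N s t + E * (V s t / L\<^sup>2))"
  have be: "beval 6 (cf w) s t = M * A s t + (w * \<alpha> s t + w\<^sup>2 * \<beta> s t)" for w s t
  proof -
    have V: "V s t = k * (s ^ 6 - t ^ 6) - (L - 2) * (s ^ 3 * t ^ 3)"
      unfolding V_def L by (simp add: algebra_simps power2_eq_square flip: power_add)
    have "beval 6 (cf w) s t = \<rho> * (s ^ 6 - t ^ 6) + M * (1 - E * (L - 2) / L\<^sup>2) * (s ^ 3 * t ^ 3)
        + (w * (s * t ^ 5 + k * (s ^ 4 * t\<^sup>2)) + w\<^sup>2 * (s ^ 5 * t - k * (s\<^sup>2 * t ^ 4))) / L"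
      unfolding beval_def cf_def by (simp add: eval_nat_numeral algebra_simps add_divide_distrib diff_divide_distrib)
    moreover have "\<rho> * (s ^ 6 - t ^ 6) + M * (1 - E * (L - 2) / L\<^sup>2) * (s ^ 3 * t ^ 3) = M * A s t"
      unfolding A_def N_def V \<rho>_def by (simp add: algebra_simps add_divide_distrib diff_divide_distrib)
    moreover have "(w * (s * t ^ 5 + k * (s ^ 4 * t\<^sup>2)) + w\<^sup>2 * (s ^ 5 * t - k * (s\<^sup>2 * t ^ 4))) / L = w * \<alpha> s t + w\<^sup>2 * \<beta> s t"
      unfolding \<alpha>_def \<beta>_def by (simp add: algebra_simps add_divide_distrib diff_divide_distrib eval_nat_numeral)
    ultimately show ?thesis by simp
  qed
  have w4: "(\<omega>\<^sup>2)\<^sup>2 = \<omega>"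
  proof -
    have "(\<omega>\<^sup>2)\<^sup>2 = (- 1 - \<omega>)\<^sup>2" by (simp only: w)
    also have "\<dots> = 1 + 2 * \<omega> + \<omega>\<^sup>2" by (simp add: algebra_simps power2_eq_square)
    also have "\<dots> = \<omega>" unfolding w by simp
    finally show ?thesis .
  qed
  have pts: "beval 6 (cf 1) s t = M * A s t + (\<alpha> s t + \<beta> s t)"
      "beval 6 (cf \<omega>) s t = M * A s t + (\<omega> * \<alpha> s t + \<omega>\<^sup>2 * \<beta> s t)"
      "beval 6 (cf (\<omega>\<^sup>2)) s t = M * A s t + (\<omega>\<^sup>2 * \<alpha> s t + \<omega> * \<beta> s t)" for s t
    unfolding be w4 by simp_all
  note cu = cube_root_unity_sym[OF w]
  have vanish: "feval 6 (complexify fp) (beval 6 (cf 1) s t) (beval 6 (cf \<omega>) s t) (beval 6 (cf (\<omega>\<^sup>2)) s t) = 0" for s t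
  proof -
    let ?z0 = "\<alpha> s t + \<beta> s t" and ?z1 = "\<omega> * \<alpha> s t + \<omega>\<^sup>2 * \<beta> s t" and ?z2 = "\<omega>\<^sup>2 * \<alpha> s t + \<omega> * \<beta> s t"
    have mean: "(M * A s t + ?z0 + (M * A s t + ?z1) + (M * A s t + ?z2)) / (3 * M) = A s t"
    proof -
      have "M * A s t + ?z0 + (M * A s t + ?z1) + (M * A s t + ?z2) = 3 * M * A s t + (?z0 + ?z1 + ?z2)" by (simp add: algebra_simps)
      then show ?thesis unfolding cu using mu by (simp add: M_def)
    qed
    have x: "- 3 * \<alpha> s t * \<beta> s t / 3 = - N s t * (V s t / L\<^sup>2)"
      by (simp add: \<alpha>_def \<beta>_def N_def V_def power2_eq_square power3_eq_cube)
    have q: "(L - 1) * (\<alpha> s t ^ 3 + \<beta> s t ^ 3) = N s t * ((N s t)\<^sup>2 + (L - 3) * N s t * (V s t / L\<^sup>2) + L * (V s t / L\<^sup>2)\<^sup>2)"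
    proof -
      define S T where "S = s ^ 3" and "T = t ^ 3"
      have "\<alpha> s t ^ 3 = S * T\<^sup>2 * (T + k * S) ^ 3 / L ^ 3" "\<beta> s t ^ 3 = S\<^sup>2 * T * (S - k * T) ^ 3 / L ^ 3"
        by (simp_all add: \<alpha>_def \<beta>_def S_def T_def power_mult_distrib power_divide flip: power_mult)
      then have "\<alpha> s t ^ 3 + \<beta> s t ^ 3 = S * T * (T * (T + k * S) ^ 3 + S * (S - k * T) ^ 3) / L ^ 3"
        by (simp add: power2_eq_square algebra_simps add_divide_distrib)
      then have "(L - 1) * (\<alpha> s t ^ 3 + \<beta> s t ^ 3) = S * T * (k\<^sup>2 * (T * (T + k * S) ^ 3 + S * (S - k * T) ^ 3)) / L ^ 3"
        by (simp add: L(2))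
      also have "\<dots> = S * T * (L ^ 3 * (S * T)\<^sup>2 + L * (L - 3) * (S * T) * V s t + (V s t)\<^sup>2) / L ^ 3"
        unfolding curve_q_identity unfolding L(2) V_def S_def T_def by simp
      also have "\<dots> = N s t * ((N s t)\<^sup>2 + (L - 3) * N s t * (V s t / L\<^sup>2) + L * (V s t / L\<^sup>2)\<^sup>2)"
      proof -
        have "(L ^ 3 * n\<^sup>2 + L * (L - 3) * n * v + v\<^sup>2) / L ^ 3 = n\<^sup>2 + (L - 3) * n * (v / L\<^sup>2) + L * (v / L\<^sup>2)\<^sup>2" for n v
          using L(1) by (simp add: field_simps power2_eq_square power3_eq_cube)
        note id = this
        have "S * T = N s t" by (simp add: N_def S_def T_def)
        show ?thesis unfolding \<open>S * T = N s t\<close> id[symmetric] by (rule times_divide_eq_right[symmetric])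
      qed
      finally show ?thesis .
    qed
    have "feval 6 (complexify fp) (beval 6 (cf 1) s t) (beval 6 (cf \<omega>) s t) (beval 6 (cf (\<omega>\<^sup>2)) s t) =
        sextic L E (L - E * (L - 3) + E\<^sup>2) M (M * A s t + ?z0) (M * A s t + ?z1) (M * A s t + ?z2)"
      unfolding complexify_fp pts D L_def[symmetric] E_def[symmetric] M_def[symmetric] ..
    also have "\<dots> = 0"
      unfolding sextic_def Let_def mean sym2_centered[OF cu(1)] sym3_centered[OF cu(1)] cu(2,3)
      by (rule sextic_on_curve[OF _ x q]) (simp add: A_def)
    finally show ?thesis .
  qed
  \<comment> \<open>The parameter \<open>(1,0)\<close> maps to the centre
    \<open>(1 : 1 : 1)\<close>, while at \<open>(1,1)\<close> the three coordinates are not all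
    equal.\<close>
  have p1: "beval 6 (cf w) 1 0 = \<rho>" for w
    unfolding be by (simp add: A_def N_def V_def \<alpha>_def \<beta>_def \<rho>_def)
  have not_all_equal: "\<not> (beval 6 (cf 1) 1 1 = c \<and> beval 6 (cf \<omega>) 1 1 = c \<and> beval 6 (cf (\<omega>\<^sup>2)) 1 1 = c)" for c
  proof
    let ?z0 = "\<alpha> 1 1 + \<beta> 1 1" and ?z1 = "\<omega> * \<alpha> 1 1 + \<omega>\<^sup>2 * \<beta> 1 1" and ?z2 = "\<omega>\<^sup>2 * \<alpha> 1 1 + \<omega> * \<beta> 1 1"
    assume "beval 6 (cf 1) 1 1 = c \<and> beval 6 (cf \<omega>) 1 1 = c \<and> beval 6 (cf (\<omega>\<^sup>2)) 1 1 = c"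
    then have "?z0 = ?z1" "?z0 = ?z2" unfolding pts by (metis add_left_imp_eq)+
    then have "3 * ?z0 = ?z0 + ?z1 + ?z2" by simp
    then have "3 * ?z0 = 0" unfolding cu .
    then have "?z0 = 0" by (metis mult_eq_0_iff zero_neq_numeral)
    moreover have "?z0 = 2 / L" by (simp add: \<alpha>_def \<beta>_def flip: add_divide_distrib)
    ultimately show False using L(1) by simp
  qed
  have distinct: "(beval 6 (cf 1) 1 0, beval 6 (cf \<omega>) 1 0, beval 6 (cf (\<omega>\<^sup>2)) 1 0) \<noteq> (0,0,0) \<and>
      (beval 6 (cf 1) 1 1, beval 6 (cf \<omega>) 1 1, beval 6 (cf (\<omega>\<^sup>2)) 1 1) \<noteq> (0,0,0) \<and>
      (\<nexists>c. beval 6 (cf 1) 1 1 = c * beval 6 (cf 1) 1 0 \<and> beval 6 (cf \<omega>) 1 1 = c * beval 6 (cf \<omega>) 1 0 \<and>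
        beval 6 (cf (\<omega>\<^sup>2)) 1 1 = c * beval 6 (cf (\<omega>\<^sup>2)) 1 0)"
    unfolding p1 using rho not_all_equal by blast
  show ?thesis unfolding rational_curve6_def using vanish distinct by blast
qed

end

text \<open>Both pairs are the second and third elementary symmetric functions of the centred coordinates of
  a node, divided by the square resp. cube of the coordinate \<open>t\<close> of the mirror nodes, which makes them independent
  of the scale. The junk values at vanishing denominators are excluded where they are used.\<close>

definition node_invariants :: "real \<times> real \<Rightarrow> real \<times> real" where
  "node_invariants = (\<lambda>p. (- 3 * snd p * (1 + snd p)\<^sup>2 / (fst p - snd p * (fst p - 3) + (snd p)\<^sup>2),
     - ((snd p)\<^sup>2 - fst p) * (1 + snd p) ^ 3 / ((fst p - 1) * (fst p - snd p * (fst p - 3) + (snd p)\<^sup>2))))"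

definition point_invariants :: "real \<times> real \<times> real \<Rightarrow> real \<times> real" where
  "point_invariants = (\<lambda>p. let u = fst p; v = fst (snd p); w = snd (snd p); m = (u + v + 1) / 3; k = m * ((w - 1) / (w + 2)) in
     (((u - m) * (v - m) + (v - m) * (1 - m) + (1 - m) * (u - m)) / k\<^sup>2, (u - m) * (v - m) * (1 - m) / k ^ 3))"

section \<open>Solving for the parameters near one point\<close>

definition param_region :: "(real \<times> real) set" where
  "param_region = {p. 1 < snd p \<and> snd p < 3 \<and> snd p < fst p \<and> fst p < 3 * snd p \<and> (1 + snd p)\<^sup>2 < 8 * (fst p - 1)}"

lemma open_param_region: "open param_region"
  unfolding param_region_def
  by (intro open_Collect_conj open_Collect_less continuous_intros)

lemma param_region_denominators:
  assumes "p \<in> param_region"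
  shows "0 < fst p - snd p * (fst p - 3) + (snd p)\<^sup>2" "fst p \<noteq> 1"
proof -
  obtain K e where p: "p = (K,e)" by (cases p)
  have "K - e * (K - 3) + e\<^sup>2 = (3 - e) * (2 * e) + (3 * e - K) * (e - 1)"
    by (simp add: algebra_simps power2_eq_square)
  moreover have "0 < (3 - e) * (2 * e)" "0 < (3 * e - K) * (e - 1)"
    using assms by (auto simp: param_region_def p intro!: mult_pos_pos)
  ultimately have "0 < K - e * (K - 3) + e\<^sup>2" by linarith
  then show "0 < fst p - snd p * (fst p - 3) + (snd p)\<^sup>2" by (simp add: p)
  show "fst p \<noteq> 1" using assms by (auto simp: param_region_def)
qed

text \<open>\<open>f'\<close> is the derivative at \<open>(4,2)\<close> and \<open>g'\<close> its
  inverse. There \<open>e\<^sup>2 = K\<close>, so one generic centred coordinate is zero and the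
  other two are opposite, which permits a rational triple \<open>(u,v,w)\<close> as base
  point.\<close>

lemma node_invariants_interior: "(- 9, 0) \<in> interior (node_invariants ` param_region)"
proof -
  define f' where "f' = (\<lambda>h::real \<times> real. (- 3 / 2 * fst h - 6 * snd h, 3 / 2 * fst h - 6 * snd h))"
  define g' where "g' = (\<lambda>y::real \<times> real. ((snd y - fst y) / 3, - (fst y + snd y) / 12))"
  have "node_invariants (4,2) \<in> interior (node_invariants ` param_region)"
  proof (rule sussmann_open_mapping[OF open_param_region])
    show "continuous_on param_region node_invariants"
      unfolding node_invariants_def
      by (intro continuous_intros ballI) (use param_region_denominators in fastforce)+
    show "(4,2) \<in> param_region" by (simp add: param_region_def)
    then show "(4,2) \<in> interior param_region" using open_param_region by (simp add: interior_open)
    show "(node_invariants has_derivative f') (at (4,2))"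
      unfolding node_invariants_def f'_def
      by (rule derivative_eq_intros refl | simp)+ (simp add: fun_eq_iff field_simps)
    have "linear g'" by (rule linearI) (simp_all add: g'_def field_simps)
    then show "bounded_linear g'" by (simp add: linear_conv_bounded_linear)
    show "f' \<circ> g' = id" by (auto simp: f'_def g'_def fun_eq_iff field_simps)
  qed simp
  then show ?thesis by (simp add: node_invariants_def)
qed

text \<open>For \<open>(w,1,1)\<close>, half the first centred coordinate divided by the mean is
  \<open>\<tau>\<close>, so a mirror node must have \<open>\<mu> = t / \<tau>\<close>. Scaling
  \<open>(u,v,1)\<close> to this mean turns equal invariants into the equations for the
  \<open>\<zeta>\<close>, because \<open>t * (1 + e) = 1\<close>.\<close>

lemma acnodal_sextic_of_invariants:
  assumes KE: "(K,e) \<in> param_region" and inv: "node_invariants (K,e) = point_invariants (u,v,w)"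
    and ne: "u \<noteq> v" "v \<noteq> 1" "u \<noteq> 1" "u + v + 1 \<noteq> 0" "w \<noteq> 1" "w \<noteq> - 2"
  defines "D \<equiv> K - e * (K - 3) + e\<^sup>2" and "t \<equiv> 1 / (1 + e)" and "m \<equiv> (u + v + 1) / 3" and "\<tau> \<equiv> (w - 1) / (w + 2)"
  shows "acnodal_sextic K e (t / \<tau>) (t / \<tau> / m * (u - m)) (t / \<tau> / m * (v - m)) (t / \<tau> / m * (1 - m)) D t"
proof -
  have e: "1 < e" "0 < t" using KE by (auto simp: param_region_def t_def)
  have tau: "\<tau> \<noteq> 0" "w + 2 \<noteq> 0" using ne by (auto simp: \<tau>_def)
  have m: "m \<noteq> 0" using ne by (simp add: m_def)
  define s where "s = t / \<tau> / m"
  have s: "s \<noteq> 0" using tau m e by (simp add: s_def)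
  have sk: "s * (m * \<tau>) = t" using tau m by (simp add: s_def)
  have te: "t * (1 + e) = 1" using e by (simp add: t_def)
  have i1: "((u - m) * (v - m) + (v - m) * (1 - m) + (1 - m) * (u - m)) / (m * \<tau>)\<^sup>2 = - 3 * e * (1 + e)\<^sup>2 / D"
    and i2: "(u - m) * (v - m) * (1 - m) / (m * \<tau>) ^ 3 = - (e\<^sup>2 - K) * (1 + e) ^ 3 / ((K - 1) * D)"
    using inv unfolding node_invariants_def point_invariants_def Let_def m_def \<tau>_def D_def by auto
  have mt: "m * \<tau> \<noteq> 0" using m tau by simp
  show ?thesis unfolding s_def[symmetric]
  proof
    show "1 < e" "e < 3" "e < K" "K < 3 * e" "(1 + e)\<^sup>2 < 8 * (K - 1)" using KE by (auto simp: param_region_def)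
    show "t / \<tau> \<noteq> 0" using e tau by simp
    show "D = K - e * (K - 3) + e\<^sup>2" "t = 1 / (1 + e)" by (simp_all add: D_def t_def)
    have "u - m + (v - m) + (1 - m) = 0" by (simp add: m_def field_simps)
    then show "s * (u - m) + s * (v - m) + s * (1 - m) = 0" by (simp flip: distrib_left)
    have "s * (u - m) * (s * (v - m)) + s * (v - m) * (s * (1 - m)) + s * (1 - m) * (s * (u - m)) =
        (s * (m * \<tau>))\<^sup>2 * (((u - m) * (v - m) + (v - m) * (1 - m) + (1 - m) * (u - m)) / (m * \<tau>)\<^sup>2)"
    proof -
      have "(s * (m * \<tau>))\<^sup>2 * (X / (m * \<tau>)\<^sup>2) = s\<^sup>2 * X" for X using mt by (simp add: power_mult_distrib)
      from this show ?thesis by (simp only:) (simp add: power2_eq_square algebra_simps)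
    qed
    also have "\<dots> = (t * (1 + e))\<^sup>2 * (- 3 * e / D)" unfolding sk i1 by (simp add: power_mult_distrib)
    finally show "s * (u - m) * (s * (v - m)) + s * (v - m) * (s * (1 - m)) + s * (1 - m) * (s * (u - m)) = - 3 * e / D"
      unfolding te by simp
    have "s * (u - m) * (s * (v - m)) * (s * (1 - m)) =
        (s * (m * \<tau>)) ^ 3 * ((u - m) * (v - m) * (1 - m) / (m * \<tau>) ^ 3)"
    proof -
      have "(s * (m * \<tau>)) ^ 3 * (X / (m * \<tau>) ^ 3) = s ^ 3 * X" for X using mt by (simp add: power_mult_distrib)
      from this show ?thesis by (simp only:) (simp add: power3_eq_cube)
    qed
    also have "\<dots> = (t * (1 + e)) ^ 3 * (- (e\<^sup>2 - K) / ((K - 1) * D))" unfolding sk i2 by (simp add: power_mult_distrib)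
    finally show "s * (u - m) * (s * (v - m)) * (s * (1 - m)) = - (e\<^sup>2 - K) / ((K - 1) * D)"
      unfolding te by simp
    show "s * (u - m) \<noteq> s * (v - m)" "s * (v - m) \<noteq> s * (1 - m)" "s * (u - m) \<noteq> s * (1 - m)"
      using s ne by simp_all
  qed
qed

theorem theorem1p5:
  shows "\<exists>U :: (real \<times> real \<times> real) set. open U \<and> U \<noteq> {} \<and>
    (\<forall>u v w. (u, v, w) \<in> U \<longrightarrow>
       (\<exists>f. f \<in> Ps036 \<and>
            feval 6 f u v 1 = 0 \<and> feval 6 f w 1 1 = 0 \<and> feval 6 f 1 1 1 = 0 \<and>
            irreducible_poly3 (complexify f) \<and>
            f \<in> extremal P36 \<and> f \<notin> Sigma36 \<and>
            irreducible_poly3 (complexify f) \<and> rational_curve6 f \<and>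
            card (acnodes6 f) = 10))"
proof -
  \<comment> \<open>Excludes coinciding generic coordinates and every vanishing denominator in
    \<open>point_invariants\<close>.\<close>
  define W :: "(real \<times> real \<times> real) set" where
    "W = {p. fst p \<noteq> fst (snd p) \<and> fst (snd p) \<noteq> 1 \<and> fst p \<noteq> 1 \<and> fst p + fst (snd p) + 1 \<noteq> 0 \<and> snd (snd p) \<noteq> 1 \<and> snd (snd p) \<noteq> - 2}"
  define U where "U = W \<inter> point_invariants -` interior (node_invariants ` param_region)"
  have "open W" unfolding W_def
    by (intro open_Collect_conj open_Collect_neq continuous_intros)
  moreover have "continuous_on W point_invariants"
    unfolding point_invariants_def Let_def W_def by (intro continuous_intros) auto
  ultimately have "open U" unfolding U_def by (intro continuous_open_preimage) auto
  moreover have "(0, 1/2, 5/2) \<in> U"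
  proof -
    \<comment> \<open>Centred coordinates \<open>- 1/2\<close>, \<open>0\<close>, \<open>1/2\<close>
      and scale \<open>k = 1/6\<close>, matching the invariants of the parameters
      \<open>(4,2)\<close>.\<close>
    have "point_invariants (0, 1/2, 5/2) = (- 9, 0)" by (simp add: point_invariants_def Let_def power2_eq_square)
    then show ?thesis using node_invariants_interior by (simp add: U_def W_def)
  qed
  moreover have "\<exists>f. f \<in> Ps036 \<and> feval 6 f u v 1 = 0 \<and> feval 6 f w 1 1 = 0 \<and> feval 6 f 1 1 1 = 0 \<and>
            irreducible_poly3 (complexify f) \<and> f \<in> extremal P36 \<and> f \<notin> Sigma36 \<and>
            irreducible_poly3 (complexify f) \<and> rational_curve6 f \<and> card (acnodes6 f) = 10"
    if uvw: "(u,v,w) \<in> U" for u v w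
  proof -
    have ne: "u \<noteq> v" "v \<noteq> 1" "u \<noteq> 1" "u + v + 1 \<noteq> 0" "w \<noteq> 1" "w \<noteq> - 2" using uvw by (auto simp: U_def W_def)
    have "point_invariants (u,v,w) \<in> node_invariants ` param_region"
      using uvw interior_subset by (auto simp: U_def)
    then obtain K e where KE: "(K,e) \<in> param_region" "node_invariants (K,e) = point_invariants (u,v,w)"
      by (metis imageE surj_pair)
    define D where "D = K - e * (K - 3) + e\<^sup>2"
    define t where "t = 1 / (1 + e)"
    define m where "m = (u + v + 1) / 3"
    define \<tau> where "\<tau> = (w - 1) / (w + 2)"
    define \<mu> where "\<mu> = t / \<tau>"
    interpret acnodal_sextic K e \<mu> "\<mu> / m * (u - m)" "\<mu> / m * (v - m)" "\<mu> / m * (1 - m)" D t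
      unfolding \<mu>_def D_def t_def m_def \<tau>_def by (rule acnodal_sextic_of_invariants[OF KE ne])
    have m: "m \<noteq> 0" using ne by (simp add: m_def)
    have w2: "w + 2 \<noteq> 0" using ne by simp
    have mu_m: "\<mu> / m \<noteq> 0" using m mu by simp
    have on: "f a b c = 0" if "(s * a, s * b, s * c) \<in> nodes" "s \<noteq> 0" for s a b c
      using nodes_zero[OF that(1)] form_fun_scale[OF form_fun_f, of s a b c] that(2) by simp
    have "(\<mu> / m * u, \<mu> / m * v, \<mu> / m * 1) \<in> nodes"
    proof -
      have e: "\<mu> / m * y = \<mu> + \<mu> / m * (y - m)" for y using m by (simp add: field_simps)
      show ?thesis unfolding e[of u] e[of v] e[of 1] nodes_def by simp
    qed
    from on[OF this mu_m] have 1: "f u v 1 = 0" .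
    have "(3 * \<mu> / (w + 2) * w, 3 * \<mu> / (w + 2) * 1, 3 * \<mu> / (w + 2) * 1) \<in> nodes"
    proof -
      have "\<tau> \<noteq> 0" using ne w2 by (simp add: \<tau>_def)
      then have "t = \<mu> * \<tau>" by (simp add: \<mu>_def)
      then have e: "3 * \<mu> / (w + 2) * w = \<mu> + 2 * t" "3 * \<mu> / (w + 2) * 1 = \<mu> - t"
        using w2 by (simp_all add: \<tau>_def field_simps)
      show ?thesis unfolding e nodes_def by simp
    qed
    from on[OF this] mu w2 have 2: "f w 1 1 = 0" by simp
    show ?thesis
      using fp_Ps036 1 2 fp_irreducible fp_extremal fp_not_sos fp_rational acnodes_f[OF fp]
      by (intro exI[of _ fp]) (simp add: fp(2) Ps036_def)
  qed
  ultimately show ?thesis by (intro exI[of _ U]) blast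
qed

end
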